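(* Let $G$ be a finitely generated group, and let $K$ be a normal subgroup of $G$ such that $Q=G/K$ is nilpotent. Assume that for any finite field $F$ of prime order and any non-trivial finite-dimensional irreducible representation $\rho$ of $G$ over $F$ with $\ker\rho\supseteq K$ we have $H^1(G,\rho)=0$. Then the quotient $G/[K,K]$ is nilpotent or, equivalently, $K/[K,K]$ is annihilated by some power of the augmentation ideal of $\mathbb Z[Q]$.
   Context: $Q=G/K$ acts on $K/[K,K]$ by conjugation, making it a $\mathbb Z[Q]$-module. $H^1(G,\rho)$ is group cohomology with coefficients in the underlying space of $\rho$. *)

theory Defs
  imports "HOL-Algebra.Algebra" "HOL-Library.Poly_Mapping"
begin

section \<open>Finitely generated and nilpotent groups\<close>

definition finitely_generated_group :: "('a, 'b) monoid_scheme \<Rightarrow> bool" where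
  "finitely_generated_group G \<longleftrightarrow>
     group G \<and> (\<exists>S. finite S \<and> S \<subseteq> carrier G \<and> generate G S = carrier G)"

definition commutator_subgroup :: "('a, 'b) monoid_scheme \<Rightarrow> 'a set \<Rightarrow> 'a set \<Rightarrow> 'a set" where
  "commutator_subgroup G H L =
     generate G (\<Union>h\<in>H. \<Union>l\<in>L. {h \<otimes>\<^bsub>G\<^esub> l \<otimes>\<^bsub>G\<^esub> inv\<^bsub>G\<^esub> h \<otimes>\<^bsub>G\<^esub> inv\<^bsub>G\<^esub> l})"

lemma derived_eq_commutator_subgroup: "derived G H = commutator_subgroup G H H"
  by (simp add: derived_def commutator_subgroup_def)

fun lower_central_series :: "('a, 'b) monoid_scheme \<Rightarrow> nat \<Rightarrow> 'a set" where
  "lower_central_series G 0 = carrier G"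
| "lower_central_series G (Suc n) =
     commutator_subgroup G (lower_central_series G n) (carrier G)"

definition nilpotent_group :: "('a, 'b) monoid_scheme \<Rightarrow> bool" where
  "nilpotent_group G \<longleftrightarrow> group G \<and> (\<exists>n. lower_central_series G n = {\<one>\<^bsub>G\<^esub>})"


section \<open>Linear representations\<close>

text \<open>A finite field and a finite-dimensional space over it are finite sets, so up to
  isomorphism both may be taken with carriers in \<open>nat\<close>; quantifying over \<open>F :: nat ring\<close> and
  \<open>V :: (nat, nat) module\<close> therefore covers all finite-dimensional representations over
  finite fields.\<close>

definition GL_group :: "('k, 'c) ring_scheme \<Rightarrow> ('k, 'v, 'd) module_scheme \<Rightarrow> ('v \<Rightarrow> 'v) monoid" where
  "GL_group F V = BijGroup (carrier V)
     \<lparr>carrier := {f \<in> Bij (carrier V).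
        (\<forall>v\<in>carrier V. \<forall>w\<in>carrier V. f (v \<oplus>\<^bsub>V\<^esub> w) = f v \<oplus>\<^bsub>V\<^esub> f w) \<and>
        (\<forall>a\<in>carrier F. \<forall>v\<in>carrier V. f (a \<odot>\<^bsub>V\<^esub> v) = a \<odot>\<^bsub>V\<^esub> f v)}\<rparr>"

definition representation ::
  "('a, 'b) monoid_scheme \<Rightarrow> ('k, 'c) ring_scheme \<Rightarrow> ('k, 'v, 'd) module_scheme \<Rightarrow> ('a \<Rightarrow> 'v \<Rightarrow> 'v) \<Rightarrow> bool" where
  "representation G F V \<rho> \<longleftrightarrow> group G \<and> field F \<and> module F V \<and> \<rho> \<in> hom G (GL_group F V)"

definition finite_dimensional_space :: "('k, 'c) ring_scheme \<Rightarrow> ('k, 'v, 'd) module_scheme \<Rightarrow> bool" where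
  "finite_dimensional_space F V \<longleftrightarrow>
     (\<exists>B. finite B \<and> B \<subseteq> carrier V \<and> (\<forall>W. submodule W F V \<and> B \<subseteq> W \<longrightarrow> W = carrier V))"

definition irreducible_representation ::
  "('a, 'b) monoid_scheme \<Rightarrow> ('k, 'c) ring_scheme \<Rightarrow> ('k, 'v, 'd) module_scheme \<Rightarrow> ('a \<Rightarrow> 'v \<Rightarrow> 'v) \<Rightarrow> bool" where
  "irreducible_representation G F V \<rho> \<longleftrightarrow>
     representation G F V \<rho> \<and> carrier V \<noteq> {\<zero>\<^bsub>V\<^esub>} \<and>
     (\<forall>W. submodule W F V \<and> (\<forall>g\<in>carrier G. \<rho> g ` W \<subseteq> W) \<longrightarrow> W = {\<zero>\<^bsub>V\<^esub>} \<or> W = carrier V)"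

text \<open>The representation is trivial when every group element acts as the identity; for an
  irreducible representation this excludes exactly the one-dimensional trivial one.\<close>

definition trivial_representation ::
  "('a, 'b) monoid_scheme \<Rightarrow> ('k, 'c) ring_scheme \<Rightarrow> ('k, 'v, 'd) module_scheme \<Rightarrow> ('a \<Rightarrow> 'v \<Rightarrow> 'v) \<Rightarrow> bool" where
  "trivial_representation G F V \<rho> \<longleftrightarrow> kernel G (GL_group F V) \<rho> = carrier G"


section \<open>First cohomology\<close>

text \<open>The degree-one part of the inhomogeneous (bar) cochain complex
  \<open>V \<rightarrow> Map(G, V) \<rightarrow> Map(G \<times> G, V)\<close> with \<open>(d v)(g) = g v - v\<close> and
  \<open>(d c)(g, h) = g c(h) - c(g h) + c(g)\<close>. Functions on the group are taken to be extensional.\<close>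

definition cocycles1 ::
  "('a, 'b) monoid_scheme \<Rightarrow> ('v, 'd) ring_scheme \<Rightarrow> ('a \<Rightarrow> 'v \<Rightarrow> 'v) \<Rightarrow> ('a \<Rightarrow> 'v) set" where
  "cocycles1 G V \<rho> = {c \<in> carrier G \<rightarrow>\<^sub>E carrier V.
     \<forall>g\<in>carrier G. \<forall>h\<in>carrier G. \<rho> g (c h) \<ominus>\<^bsub>V\<^esub> c (g \<otimes>\<^bsub>G\<^esub> h) \<oplus>\<^bsub>V\<^esub> c g = \<zero>\<^bsub>V\<^esub>}"

definition coboundaries1 ::
  "('a, 'b) monoid_scheme \<Rightarrow> ('v, 'd) ring_scheme \<Rightarrow> ('a \<Rightarrow> 'v \<Rightarrow> 'v) \<Rightarrow> ('a \<Rightarrow> 'v) set" where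
  "coboundaries1 G V \<rho> = (\<lambda>v. \<lambda>g\<in>carrier G. \<rho> g v \<ominus>\<^bsub>V\<^esub> v) ` carrier V"

definition cocycle_group1 ::
  "('a, 'b) monoid_scheme \<Rightarrow> ('v, 'd) ring_scheme \<Rightarrow> ('a \<Rightarrow> 'v \<Rightarrow> 'v) \<Rightarrow> ('a \<Rightarrow> 'v) monoid" where
  "cocycle_group1 G V \<rho> =
     \<lparr>carrier = cocycles1 G V \<rho>,
      monoid.mult = (\<lambda>c d. \<lambda>g\<in>carrier G. c g \<oplus>\<^bsub>V\<^esub> d g),
      one = (\<lambda>g\<in>carrier G. \<zero>\<^bsub>V\<^esub>)\<rparr>"

definition cohomology1 ::
  "('a, 'b) monoid_scheme \<Rightarrow> ('v, 'd) ring_scheme \<Rightarrow> ('a \<Rightarrow> 'v \<Rightarrow> 'v) \<Rightarrow> ('a \<Rightarrow> 'v) set monoid" where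
  "cohomology1 G V \<rho> = cocycle_group1 G V \<rho> Mod coboundaries1 G V \<rho>"

lemma representation_simps:
  assumes "representation G F V \<rho>" "g \<in> carrier G" "h \<in> carrier G" "v \<in> carrier V" "w \<in> carrier V"
  shows "\<rho> g v \<in> carrier V" "\<rho> g (v \<oplus>\<^bsub>V\<^esub> w) = \<rho> g v \<oplus>\<^bsub>V\<^esub> \<rho> g w"
    "\<rho> (g \<otimes>\<^bsub>G\<^esub> h) v = \<rho> g (\<rho> h v)"
proof -
  have *: "\<rho> x \<in> carrier (GL_group F V)" if "x \<in> carrier G" for x
    using assms(1) that by (auto simp: representation_def hom_def)
  then have B: "\<rho> x \<in> Bij (carrier V)" if "x \<in> carrier G" for x
    using that by (fastforce simp: GL_group_def)
  show "\<rho> g v \<in> carrier V" using Bij_imp_funcset[OF B[OF assms(2)]] assms(4) by auto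
  show "\<rho> g (v \<oplus>\<^bsub>V\<^esub> w) = \<rho> g v \<oplus>\<^bsub>V\<^esub> \<rho> g w"
    using *[OF assms(2)] assms(4,5) by (auto simp: GL_group_def)
  have "\<rho> (g \<otimes>\<^bsub>G\<^esub> h) = \<rho> g \<otimes>\<^bsub>GL_group F V\<^esub> \<rho> h"
    using assms(1-3) by (auto simp: representation_def hom_def)
  then show "\<rho> (g \<otimes>\<^bsub>G\<^esub> h) v = \<rho> g (\<rho> h v)"
    using B assms by (simp add: GL_group_def BijGroup_def compose_def)
qed

lemma cocycle_iff:
  assumes "representation G F V \<rho>"
  shows "c \<in> cocycles1 G V \<rho> \<longleftrightarrow> c \<in> carrier G \<rightarrow>\<^sub>E carrier V \<and>
    (\<forall>g\<in>carrier G. \<forall>h\<in>carrier G. c (g \<otimes>\<^bsub>G\<^esub> h) = c g \<oplus>\<^bsub>V\<^esub> \<rho> g (c h))"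
proof -
  interpret G: group G using assms by (simp add: representation_def)
  interpret V: abelian_group V using assms by (simp add: representation_def module_def)
  have "x \<ominus>\<^bsub>V\<^esub> y \<oplus>\<^bsub>V\<^esub> z = \<zero>\<^bsub>V\<^esub> \<longleftrightarrow> y = z \<oplus>\<^bsub>V\<^esub> x"
    if "x \<in> carrier V" "y \<in> carrier V" "z \<in> carrier V" for x y z
  proof -
    have "x \<ominus>\<^bsub>V\<^esub> y \<oplus>\<^bsub>V\<^esub> z = (z \<oplus>\<^bsub>V\<^esub> x) \<ominus>\<^bsub>V\<^esub> y"
      using that by (simp add: a_minus_def V.a_ac)
    then show ?thesis using that by (auto simp: V.r_neg a_minus_def intro: V.minus_unique)
        (metis V.add.inv_closed V.add.m_closed V.minus_equality V.minus_minus a_minus_def)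
  qed
  then have "\<rho> g (c h) \<ominus>\<^bsub>V\<^esub> c (g \<otimes>\<^bsub>G\<^esub> h) \<oplus>\<^bsub>V\<^esub> c g = \<zero>\<^bsub>V\<^esub> \<longleftrightarrow> c (g \<otimes>\<^bsub>G\<^esub> h) = c g \<oplus>\<^bsub>V\<^esub> \<rho> g (c h)"
    if "c \<in> carrier G \<rightarrow>\<^sub>E carrier V" "g \<in> carrier G" "h \<in> carrier G" for g h
    using that representation_simps(1)[OF assms, of g g "c h" "c h"] by (auto simp: PiE_iff)
  then show ?thesis unfolding cocycles1_def by auto
qed

lemma comm_group_cocycle_group1:
  assumes "representation G F V \<rho>"
  shows "comm_group (cocycle_group1 G V \<rho>)"
proof -
  interpret G: group G using assms by (simp add: representation_def)
  interpret V: abelian_group V using assms by (simp add: representation_def module_def)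
  note rs = representation_simps[OF assms]
  have rs1: "\<rho> g v \<in> carrier V" if "g \<in> carrier G" "v \<in> carrier V" for g v
    using rs(1)[OF that(1) that(1) that(2) that(2)] .
  have rs2: "\<rho> g (v \<oplus>\<^bsub>V\<^esub> w) = \<rho> g v \<oplus>\<^bsub>V\<^esub> \<rho> g w"
    if "g \<in> carrier G" "v \<in> carrier V" "w \<in> carrier V" for g v w
    using rs(2)[OF that(1) that(1) that(2) that(3)] .
  have r0: "\<rho> g \<zero>\<^bsub>V\<^esub> = \<zero>\<^bsub>V\<^esub>" if "g \<in> carrier G" for g
    using rs(1,2)[OF that that V.zero_closed V.zero_closed] V.add.l_cancel_one by fastforce
  have rm: "\<rho> g (\<ominus>\<^bsub>V\<^esub> v) = \<ominus>\<^bsub>V\<^esub> \<rho> g v" if "g \<in> carrier G" "v \<in> carrier V" for g v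
  proof -
    have "\<rho> g (\<ominus>\<^bsub>V\<^esub> v) \<oplus>\<^bsub>V\<^esub> \<rho> g v = \<zero>\<^bsub>V\<^esub>"
      using rs(2)[OF that(1) that(1), of "\<ominus>\<^bsub>V\<^esub> v" v] that by (simp add: V.l_neg r0)
    then show ?thesis using that rs(1) by (metis V.a_inv_closed V.minus_equality)
  qed
  show ?thesis
  proof (rule comm_groupI)
    fix c d assume "c \<in> carrier (cocycle_group1 G V \<rho>)" "d \<in> carrier (cocycle_group1 G V \<rho>)"
    then show "c \<otimes>\<^bsub>cocycle_group1 G V \<rho>\<^esub> d \<in> carrier (cocycle_group1 G V \<rho>)"
      by (auto simp: cocycle_group1_def cocycle_iff[OF assms] rs2 rs1 PiE_iff V.a_ac)
  next
    show "\<one>\<^bsub>cocycle_group1 G V \<rho>\<^esub> \<in> carrier (cocycle_group1 G V \<rho>)"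
      by (auto simp: cocycle_group1_def cocycle_iff[OF assms] r0)
  next
    fix c assume c: "c \<in> carrier (cocycle_group1 G V \<rho>)"
    show "\<exists>d\<in>carrier (cocycle_group1 G V \<rho>). d \<otimes>\<^bsub>cocycle_group1 G V \<rho>\<^esub> c = \<one>\<^bsub>cocycle_group1 G V \<rho>\<^esub>"
      by (rule bexI[of _ "\<lambda>g\<in>carrier G. \<ominus>\<^bsub>V\<^esub> c g"])
        (use c in \<open>auto simp: cocycle_group1_def cocycle_iff[OF assms] rs1 rm PiE_iff V.minus_add V.l_neg
          cong: restrict_cong\<close>)
  qed (auto simp: cocycle_group1_def cocycle_iff[OF assms] PiE_iff extensional_def fun_eq_iff V.a_ac)
qed

lemma subgroup_coboundaries1:
  assumes "representation G F V \<rho>"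
  shows "subgroup (coboundaries1 G V \<rho>) (cocycle_group1 G V \<rho>)"
proof -
  interpret G: group G using assms by (simp add: representation_def)
  interpret V: abelian_group V using assms by (simp add: representation_def module_def)
  interpret Z: comm_group "cocycle_group1 G V \<rho>" by (rule comm_group_cocycle_group1[OF assms])
  note rs = representation_simps[OF assms]
  define d where "d v = (\<lambda>g\<in>carrier G. \<rho> g v \<ominus>\<^bsub>V\<^esub> v)" for v
  have B: "coboundaries1 G V \<rho> = d ` carrier V"
    by (simp add: coboundaries1_def d_def)
  have dZ: "d v \<in> carrier (cocycle_group1 G V \<rho>)" if v: "v \<in> carrier V" for v
  proof -
    have "\<rho> g (\<rho> h v) \<ominus>\<^bsub>V\<^esub> v = (\<rho> g v \<ominus>\<^bsub>V\<^esub> v) \<oplus>\<^bsub>V\<^esub> \<rho> g (\<rho> h v \<ominus>\<^bsub>V\<^esub> v)"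
      if g: "g \<in> carrier G" and h: "h \<in> carrier G" for g h
    proof -
      have hv: "\<rho> h v \<ominus>\<^bsub>V\<^esub> v \<in> carrier V" using rs(1)[OF h h v v] v by simp
      have "(\<rho> h v \<ominus>\<^bsub>V\<^esub> v) \<oplus>\<^bsub>V\<^esub> v = \<rho> h v"
        using rs(1)[OF h h v v] v by (simp add: a_minus_def V.a_assoc V.l_neg)
      then have "\<rho> g (\<rho> h v) = \<rho> g (\<rho> h v \<ominus>\<^bsub>V\<^esub> v) \<oplus>\<^bsub>V\<^esub> \<rho> g v"
        using rs(2)[OF g g hv v] by simp
      then show ?thesis
        using rs(1)[OF g g hv v] rs(1)[OF g g v v] v by (simp add: a_minus_def V.a_ac)
    qed
    then show ?thesis
      using v by (auto simp: d_def cocycle_group1_def cocycle_iff[OF assms] rs)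
  qed
  have dadd: "d v \<otimes>\<^bsub>cocycle_group1 G V \<rho>\<^esub> d w = d (v \<oplus>\<^bsub>V\<^esub> w)"
    if "v \<in> carrier V" "w \<in> carrier V" for v w
    using that by (auto simp: d_def cocycle_group1_def fun_eq_iff rs a_minus_def V.minus_add V.a_ac)
  interpret h: group_hom "add_monoid V" "cocycle_group1 G V \<rho>" d
    by unfold_locales (auto simp: hom_def dZ dadd)
  show ?thesis unfolding B using h.img_is_subgroup by simp
qed


section \<open>Integral group rings and the augmentation ideal\<close>

text \<open>The multiplication is spelled out because the product of the type \<open>'a \<Rightarrow>\<^sub>0 int\<close>
  is the convolution for a type-class monoid, not for the group \<open>Q\<close>.\<close>

definition group_ring_mult ::
  "('a, 'b) monoid_scheme \<Rightarrow> ('a \<Rightarrow>\<^sub>0 int) \<Rightarrow> ('a \<Rightarrow>\<^sub>0 int) \<Rightarrow> ('a \<Rightarrow>\<^sub>0 int)" where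
  "group_ring_mult Q r s =
     (\<Sum>x\<in>Poly_Mapping.keys r. \<Sum>y\<in>Poly_Mapping.keys s.
        Poly_Mapping.single (x \<otimes>\<^bsub>Q\<^esub> y) (Poly_Mapping.lookup r x * Poly_Mapping.lookup s y))"

definition integral_group_ring :: "('a, 'b) monoid_scheme \<Rightarrow> ('a \<Rightarrow>\<^sub>0 int) ring" where
  "integral_group_ring Q =
     \<lparr>carrier = {r. Poly_Mapping.keys r \<subseteq> carrier Q},
      monoid.mult = group_ring_mult Q,
      one = Poly_Mapping.single \<one>\<^bsub>Q\<^esub> 1,
      ring.zero = 0,
      ring.add = (+)\<rparr>"

definition augmentation :: "('a \<Rightarrow>\<^sub>0 int) \<Rightarrow> int" where
  "augmentation r = (\<Sum>x\<in>Poly_Mapping.keys r. Poly_Mapping.lookup r x)"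

definition augmentation_ideal :: "('a, 'b) monoid_scheme \<Rightarrow> ('a \<Rightarrow>\<^sub>0 int) set" where
  "augmentation_ideal Q = {r \<in> carrier (integral_group_ring Q). augmentation r = 0}"

text \<open>The extension of an action of \<open>Q\<close> on a (multiplicatively written) abelian group \<open>M\<close>
  to \<open>\<int>[Q]\<close>: additively, \<open>r m = (\<Sum>x. r(x) (x m))\<close>.\<close>

definition group_ring_action ::
  "('m, 'c) monoid_scheme \<Rightarrow> ('a \<Rightarrow> 'm \<Rightarrow> 'm) \<Rightarrow> ('a \<Rightarrow>\<^sub>0 int) \<Rightarrow> 'm \<Rightarrow> 'm" where
  "group_ring_action M \<alpha> r m =
     (\<Otimes>\<^bsub>M\<^esub>x\<in>Poly_Mapping.keys r. \<alpha> x m [^]\<^bsub>M\<^esub> Poly_Mapping.lookup r x)"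

definition annihilates ::
  "('a \<Rightarrow>\<^sub>0 int) set \<Rightarrow> ('m, 'c) monoid_scheme \<Rightarrow> ('a \<Rightarrow> 'm \<Rightarrow> 'm) \<Rightarrow> bool" where
  "annihilates I M \<alpha> \<longleftrightarrow> (\<forall>r\<in>I. \<forall>m\<in>carrier M. group_ring_action M \<alpha> r m = \<one>\<^bsub>M\<^esub>)"

lemma augmentation_superset:
  assumes "finite A" "Poly_Mapping.keys r \<subseteq> A"
  shows "augmentation r = (\<Sum>x\<in>A. Poly_Mapping.lookup r x)"
  unfolding augmentation_def
  by (rule sum.mono_neutral_left) (use assms in \<open>auto simp: in_keys_iff\<close>)

lemma augmentation_add: "augmentation (r + s) = augmentation r + augmentation s"
proof -
  let ?A = "Poly_Mapping.keys r \<union> Poly_Mapping.keys s"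
  have "augmentation (r + s) = (\<Sum>x\<in>?A. Poly_Mapping.lookup (r + s) x)"
    by (rule augmentation_superset) (use keys_add[of r s] in auto)
  also have "\<dots> = (\<Sum>x\<in>?A. Poly_Mapping.lookup r x) + (\<Sum>x\<in>?A. Poly_Mapping.lookup s x)"
    by (simp add: lookup_add sum.distrib)
  finally show ?thesis
    by (simp add: augmentation_superset[of ?A r] augmentation_superset[of ?A s])
qed

lemma augmentation_sum: "augmentation (sum f A) = (\<Sum>x\<in>A. augmentation (f x))"
proof (induction A rule: infinite_finite_induct)
  case (insert x A) then show ?case by (simp add: augmentation_add)
qed (auto simp: augmentation_def)

lemma augmentation_single: "augmentation (Poly_Mapping.single x n) = n"
  by (cases "n = 0") (auto simp: augmentation_def)

lemma augmentation_mult: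
  "augmentation (group_ring_mult Q r s) = augmentation r * augmentation s"
  by (simp add: group_ring_mult_def augmentation_sum augmentation_single
      augmentation_def[of r] augmentation_def[of s] sum_product)

lemma group_ring_mult_superset:
  assumes "finite A" "Poly_Mapping.keys r \<subseteq> A" "finite B" "Poly_Mapping.keys s \<subseteq> B"
  shows "group_ring_mult Q r s = (\<Sum>x\<in>A. \<Sum>y\<in>B.
     Poly_Mapping.single (x \<otimes>\<^bsub>Q\<^esub> y) (Poly_Mapping.lookup r x * Poly_Mapping.lookup s y))"
proof -
  have "(\<Sum>y\<in>Poly_Mapping.keys s. Poly_Mapping.single (x \<otimes>\<^bsub>Q\<^esub> y) (Poly_Mapping.lookup r x * Poly_Mapping.lookup s y))
      = (\<Sum>y\<in>B. Poly_Mapping.single (x \<otimes>\<^bsub>Q\<^esub> y) (Poly_Mapping.lookup r x * Poly_Mapping.lookup s y))" for x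
    by (rule sum.mono_neutral_left) (use assms in \<open>auto simp: in_keys_iff\<close>)
  then have "group_ring_mult Q r s = (\<Sum>x\<in>Poly_Mapping.keys r. \<Sum>y\<in>B.
     Poly_Mapping.single (x \<otimes>\<^bsub>Q\<^esub> y) (Poly_Mapping.lookup r x * Poly_Mapping.lookup s y))"
    by (simp add: group_ring_mult_def)
  also have "\<dots> = (\<Sum>x\<in>A. \<Sum>y\<in>B.
     Poly_Mapping.single (x \<otimes>\<^bsub>Q\<^esub> y) (Poly_Mapping.lookup r x * Poly_Mapping.lookup s y))"
    by (rule sum.mono_neutral_left) (use assms in \<open>auto simp: in_keys_iff\<close>)
  finally show ?thesis .
qed

lemma group_ring_mult_add_left:
  "group_ring_mult Q (r + r') s = group_ring_mult Q r s + group_ring_mult Q r' s"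
proof -
  let ?A = "Poly_Mapping.keys r \<union> Poly_Mapping.keys r'"
  have *: "Poly_Mapping.keys (r + r') \<subseteq> ?A" by (rule keys_add)
  show ?thesis
    unfolding group_ring_mult_superset[OF _ * finite_keys order_refl, simplified]
      group_ring_mult_superset[of ?A r "Poly_Mapping.keys s" s, simplified]
      group_ring_mult_superset[of ?A r' "Poly_Mapping.keys s" s, simplified]
    by (simp add: lookup_add distrib_right single_add sum.distrib)
qed

lemma group_ring_mult_add_right:
  "group_ring_mult Q r (s + s') = group_ring_mult Q r s + group_ring_mult Q r s'"
proof -
  let ?B = "Poly_Mapping.keys s \<union> Poly_Mapping.keys s'"
  have *: "Poly_Mapping.keys (s + s') \<subseteq> ?B" by (rule keys_add)
  show ?thesis
    unfolding group_ring_mult_superset[OF finite_keys order_refl _ *, simplified]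
      group_ring_mult_superset[of "Poly_Mapping.keys r" r ?B s, simplified]
      group_ring_mult_superset[of "Poly_Mapping.keys r" r ?B s', simplified]
    by (simp add: lookup_add distrib_left single_add sum.distrib)
qed

lemma group_ring_mult_zero [simp]:
  "group_ring_mult Q 0 s = 0" "group_ring_mult Q r 0 = 0"
  by (simp_all add: group_ring_mult_def)

lemma group_ring_mult_sum_left:
  "group_ring_mult Q (sum f A) s = (\<Sum>x\<in>A. group_ring_mult Q (f x) s)"
  by (induction A rule: infinite_finite_induct) (auto simp: group_ring_mult_add_left)

lemma group_ring_mult_sum_right:
  "group_ring_mult Q r (sum f A) = (\<Sum>x\<in>A. group_ring_mult Q r (f x))"
  by (induction A rule: infinite_finite_induct) (auto simp: group_ring_mult_add_right)

lemma group_ring_mult_single: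
  "group_ring_mult Q (Poly_Mapping.single x m) (Poly_Mapping.single y n)
     = Poly_Mapping.single (x \<otimes>\<^bsub>Q\<^esub> y) (m * n)"
  by (subst group_ring_mult_superset[of "{x}" _ "{y}"]) auto

lemma poly_mapping_eq_sum_single:
  "r = (\<Sum>x\<in>Poly_Mapping.keys r. Poly_Mapping.single x (Poly_Mapping.lookup r x))"
  by (rule poly_mapping_eqI)
    (auto simp: lookup_sum lookup_single when_def sum.If_cases sum.delta in_keys_iff)

lemma group_ring_mult_assoc:
  assumes "group Q" "Poly_Mapping.keys r \<subseteq> carrier Q" "Poly_Mapping.keys s \<subseteq> carrier Q"
    "Poly_Mapping.keys t \<subseteq> carrier Q"
  shows "group_ring_mult Q (group_ring_mult Q r s) t = group_ring_mult Q r (group_ring_mult Q s t)"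
proof -
  interpret group Q by fact
  have 1: "group_ring_mult Q (group_ring_mult Q r s) (\<Sum>z\<in>Poly_Mapping.keys t. Poly_Mapping.single z (Poly_Mapping.lookup t z))
    = (\<Sum>x\<in>Poly_Mapping.keys r. \<Sum>y\<in>Poly_Mapping.keys s. \<Sum>z\<in>Poly_Mapping.keys t.
       Poly_Mapping.single ((x \<otimes>\<^bsub>Q\<^esub> y) \<otimes>\<^bsub>Q\<^esub> z) (Poly_Mapping.lookup r x * Poly_Mapping.lookup s y * Poly_Mapping.lookup t z))"
    unfolding group_ring_mult_def[of Q r s] group_ring_mult_sum_left
    by (simp add: group_ring_mult_sum_right group_ring_mult_single)
  have 2: "group_ring_mult Q (\<Sum>x\<in>Poly_Mapping.keys r. Poly_Mapping.single x (Poly_Mapping.lookup r x)) (group_ring_mult Q s t)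
    = (\<Sum>x\<in>Poly_Mapping.keys r. \<Sum>y\<in>Poly_Mapping.keys s. \<Sum>z\<in>Poly_Mapping.keys t.
       Poly_Mapping.single (x \<otimes>\<^bsub>Q\<^esub> (y \<otimes>\<^bsub>Q\<^esub> z)) (Poly_Mapping.lookup r x * (Poly_Mapping.lookup s y * Poly_Mapping.lookup t z)))"
    unfolding group_ring_mult_def[of Q s t] group_ring_mult_sum_left
    by (simp add: group_ring_mult_sum_right group_ring_mult_single)
  show ?thesis
    unfolding 1[folded poly_mapping_eq_sum_single] 2[folded poly_mapping_eq_sum_single]
    by (intro sum.cong refl) (use assms in \<open>simp add: m_assoc subset_iff mult.assoc\<close>)
qed

lemma keys_sum_subset:
  "(\<And>x. x \<in> A \<Longrightarrow> Poly_Mapping.keys (f x) \<subseteq> C) \<Longrightarrow> Poly_Mapping.keys (sum f A) \<subseteq> C"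
proof (induction A rule: infinite_finite_induct)
  case (insert x A)
  then show ?case using keys_add[of "f x" "sum f A"] by auto
qed auto

lemma group_ring_mult_closed:
  assumes "group Q" "Poly_Mapping.keys r \<subseteq> carrier Q" "Poly_Mapping.keys s \<subseteq> carrier Q"
  shows "Poly_Mapping.keys (group_ring_mult Q r s) \<subseteq> carrier Q"
proof -
  interpret group Q by fact
  show ?thesis unfolding group_ring_mult_def
    by (intro keys_sum_subset) (use assms in \<open>auto split: if_splits\<close>)
qed

lemma ring_integral_group_ring:
  assumes "group Q"
  shows "ring (integral_group_ring Q)"
proof -
  interpret group Q by fact
  have one_l: "group_ring_mult Q (Poly_Mapping.single \<one>\<^bsub>Q\<^esub> 1) r = r"
    and one_r: "group_ring_mult Q r (Poly_Mapping.single \<one>\<^bsub>Q\<^esub> 1) = r"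
    if "Poly_Mapping.keys r \<subseteq> carrier Q" for r
  proof -
    have "(\<Sum>x\<in>Poly_Mapping.keys r. Poly_Mapping.single (\<one>\<^bsub>Q\<^esub> \<otimes>\<^bsub>Q\<^esub> x) (Poly_Mapping.lookup r x))
        = (\<Sum>x\<in>Poly_Mapping.keys r. Poly_Mapping.single x (Poly_Mapping.lookup r x))"
      by (intro sum.cong refl) (use that in auto)
    then show "group_ring_mult Q (Poly_Mapping.single \<one>\<^bsub>Q\<^esub> 1) r = r"
      by (simp add: group_ring_mult_def flip: poly_mapping_eq_sum_single)
    have "(\<Sum>x\<in>Poly_Mapping.keys r. Poly_Mapping.single (x \<otimes>\<^bsub>Q\<^esub> \<one>\<^bsub>Q\<^esub>) (Poly_Mapping.lookup r x))
        = (\<Sum>x\<in>Poly_Mapping.keys r. Poly_Mapping.single x (Poly_Mapping.lookup r x))"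
      by (intro sum.cong refl) (use that in auto)
    then show "group_ring_mult Q r (Poly_Mapping.single \<one>\<^bsub>Q\<^esub> 1) = r"
      by (simp add: group_ring_mult_def flip: poly_mapping_eq_sum_single)
  qed
  have inv: "\<exists>y. Poly_Mapping.keys y \<subseteq> carrier Q \<and> y + r = 0"
    if "Poly_Mapping.keys r \<subseteq> carrier Q" for r :: "_ \<Rightarrow>\<^sub>0 int"
    by (rule exI[of _ "- r"]) (use that in \<open>auto simp: in_keys_iff subset_iff\<close>)
  show ?thesis
  proof (rule ringI)
    show "abelian_group (integral_group_ring Q)"
      by (rule abelian_groupI)
        (use inv in \<open>auto simp: integral_group_ring_def add_ac dest!: subsetD[OF keys_add]\<close>)
    show "Group.monoid (integral_group_ring Q)"
      by (rule monoidI)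
        (use assms group_ring_mult_closed[OF assms] in
          \<open>auto simp: integral_group_ring_def one_l one_r group_ring_mult_assoc\<close>)
  qed (auto simp: integral_group_ring_def group_ring_mult_add_left group_ring_mult_add_right)
qed

lemma ideal_augmentation_ideal:
  assumes "group Q"
  shows "ideal (augmentation_ideal Q) (integral_group_ring Q)"
proof -
  interpret ring "integral_group_ring Q" by (rule ring_integral_group_ring[OF assms])
  have aug_uminus: "augmentation (- r) = - augmentation r" for r :: "'a \<Rightarrow>\<^sub>0 int"
    using augmentation_add[of r "- r"] by (simp add: augmentation_def)
  have keys_uminus': "Poly_Mapping.keys (- r) = Poly_Mapping.keys r" for r :: "'a \<Rightarrow>\<^sub>0 int"
    by (auto simp: in_keys_iff)
  have a_inv: "\<ominus>\<^bsub>integral_group_ring Q\<^esub> r = - r" if "r \<in> carrier (integral_group_ring Q)" for r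
    by (rule minus_equality) (use that in \<open>auto simp: integral_group_ring_def keys_uminus'\<close>)
  show ?thesis
  proof (rule idealI)
    show "ring (integral_group_ring Q)" by (rule ring_axioms)
    show "subgroup (augmentation_ideal Q) (add_monoid (integral_group_ring Q))"
    proof (rule subgroup.intro)
      fix x assume "x \<in> augmentation_ideal Q"
      then show "inv\<^bsub>add_monoid (integral_group_ring Q)\<^esub> x \<in> augmentation_ideal Q"
        using a_inv[of x] unfolding a_inv_def
        by (auto simp: augmentation_ideal_def aug_uminus integral_group_ring_def keys_uminus')
    qed (auto simp: augmentation_ideal_def augmentation_add integral_group_ring_def
          augmentation_def[of 0] dest!: subsetD[OF keys_add])
  next
    fix a x assume *: "a \<in> augmentation_ideal Q" "x \<in> carrier (integral_group_ring Q)"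
    then have c: "x \<otimes>\<^bsub>integral_group_ring Q\<^esub> a \<in> carrier (integral_group_ring Q)"
      "a \<otimes>\<^bsub>integral_group_ring Q\<^esub> x \<in> carrier (integral_group_ring Q)"
      by (auto simp: augmentation_ideal_def)
    moreover have "augmentation (x \<otimes>\<^bsub>integral_group_ring Q\<^esub> a) = 0"
      "augmentation (a \<otimes>\<^bsub>integral_group_ring Q\<^esub> x) = 0"
      using * by (auto simp: integral_group_ring_def augmentation_mult augmentation_ideal_def)
    ultimately show "x \<otimes>\<^bsub>integral_group_ring Q\<^esub> a \<in> augmentation_ideal Q"
      "a \<otimes>\<^bsub>integral_group_ring Q\<^esub> x \<in> augmentation_ideal Q"
      by (auto simp: augmentation_ideal_def)
  qed
qed


section \<open>The conjugation action on the abelianization of a normal subgroup\<close>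

definition abelianized_subgroup :: "('a, 'b) monoid_scheme \<Rightarrow> 'a set \<Rightarrow> 'a set monoid" where
  "abelianized_subgroup G K = (G\<lparr>carrier := K\<rparr>) Mod (derived G K)"

text \<open>For a coset \<open>q\<close> of \<open>K\<close> and a coset \<open>m\<close> of \<open>[K,K]\<close> in \<open>K\<close>, the conjugates of
  elements of \<open>m\<close> by elements of \<open>q\<close> form a single coset of \<open>[K,K]\<close>; see the lemma below.\<close>

definition conjugation_action :: "('a, 'b) monoid_scheme \<Rightarrow> 'a set \<Rightarrow> 'a set \<Rightarrow> 'a set" where
  "conjugation_action G q m = (\<Union>g\<in>q. \<Union>k\<in>m. {g \<otimes>\<^bsub>G\<^esub> k \<otimes>\<^bsub>G\<^esub> inv\<^bsub>G\<^esub> g})"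

lemma conjugation_action_coset:
  assumes "normal K G" "g \<in> carrier G" "k \<in> K"
  shows "conjugation_action G (K #>\<^bsub>G\<^esub> g) (derived G K #>\<^bsub>G\<^esub> k)
           = derived G K #>\<^bsub>G\<^esub> (g \<otimes>\<^bsub>G\<^esub> k \<otimes>\<^bsub>G\<^esub> inv\<^bsub>G\<^esub> g)"
proof -
  interpret normal K G by fact
  define D where "D = derived G K"
  have KG: "K \<subseteq> carrier G" by (rule subset)
  interpret D: normal D G
    unfolding D_def by (rule derived_is_normal[OF assms(1)])
  have comm: "h \<otimes>\<^bsub>G\<^esub> x \<otimes>\<^bsub>G\<^esub> inv\<^bsub>G\<^esub> h \<otimes>\<^bsub>G\<^esub> inv\<^bsub>G\<^esub> x \<in> D" if "h \<in> K" "x \<in> K" for h x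
    unfolding D_def derived_def by (rule generate.incl) (use that in blast)
  define x where "x = g \<otimes>\<^bsub>G\<^esub> k \<otimes>\<^bsub>G\<^esub> inv\<^bsub>G\<^esub> g"
  have k: "k \<in> carrier G" using assms KG by blast
  have x: "x \<in> K" unfolding x_def by (rule inv_op_closed2[OF assms(2,3)])
  then have xc: "x \<in> carrier G" using KG by blast
  have "(h \<otimes>\<^bsub>G\<^esub> g) \<otimes>\<^bsub>G\<^esub> (d \<otimes>\<^bsub>G\<^esub> k) \<otimes>\<^bsub>G\<^esub> inv\<^bsub>G\<^esub> (h \<otimes>\<^bsub>G\<^esub> g) \<in> D #>\<^bsub>G\<^esub> x" if "h \<in> K" "d \<in> D" for h d
  proof -
    have hc: "h \<in> carrier G" and dc: "d \<in> carrier G" using that KG D.subset by auto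
    let ?e = "(h \<otimes>\<^bsub>G\<^esub> g) \<otimes>\<^bsub>G\<^esub> d \<otimes>\<^bsub>G\<^esub> inv\<^bsub>G\<^esub> (h \<otimes>\<^bsub>G\<^esub> g)"
    let ?c = "h \<otimes>\<^bsub>G\<^esub> x \<otimes>\<^bsub>G\<^esub> inv\<^bsub>G\<^esub> h \<otimes>\<^bsub>G\<^esub> inv\<^bsub>G\<^esub> x"
    have e: "?e \<in> D" by (rule D.inv_op_closed2) (use that hc assms in auto)
    have "(h \<otimes>\<^bsub>G\<^esub> g) \<otimes>\<^bsub>G\<^esub> (d \<otimes>\<^bsub>G\<^esub> k) \<otimes>\<^bsub>G\<^esub> inv\<^bsub>G\<^esub> (h \<otimes>\<^bsub>G\<^esub> g) = (?e \<otimes>\<^bsub>G\<^esub> ?c) \<otimes>\<^bsub>G\<^esub> x"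
      using hc dc k assms(2) xc
      by (simp add: x_def m_assoc inv_mult_group inv_solve_left inv_solve_left' flip: m_assoc)
         (simp add: m_assoc inv_mult_group)
    moreover have "?e \<otimes>\<^bsub>G\<^esub> ?c \<in> D" using e comm[OF that(1) x] by (rule D.m_closed)
    ultimately show ?thesis by (auto simp: r_coset_def)
  qed
  moreover have "d \<otimes>\<^bsub>G\<^esub> x \<in> conjugation_action G (K #>\<^bsub>G\<^esub> g) (D #>\<^bsub>G\<^esub> k)" if "d \<in> D" for d
  proof -
    have dc: "d \<in> carrier G" using that D.subset by auto
    let ?d = "inv\<^bsub>G\<^esub> g \<otimes>\<^bsub>G\<^esub> d \<otimes>\<^bsub>G\<^esub> g"
    have "?d \<in> D" by (rule D.inv_op_closed1) (use that assms in auto)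
    moreover have "d \<otimes>\<^bsub>G\<^esub> x = g \<otimes>\<^bsub>G\<^esub> (?d \<otimes>\<^bsub>G\<^esub> k) \<otimes>\<^bsub>G\<^esub> inv\<^bsub>G\<^esub> g"
      using dc k assms(2) by (simp add: x_def r_inv flip: m_assoc)
    moreover have "g \<in> K #>\<^bsub>G\<^esub> g" using rcos_self[OF assms(2) subgroup_axioms] .
    moreover have "?d \<otimes>\<^bsub>G\<^esub> k \<in> D #>\<^bsub>G\<^esub> k" using \<open>?d \<in> D\<close> by (auto simp: r_coset_def)
    ultimately show ?thesis unfolding conjugation_action_def by blast
  qed
  ultimately show ?thesis
    unfolding D_def[symmetric] x_def[symmetric] conjugation_action_def
    by (auto simp: r_coset_def)
qed

end

theory Submission
  imports Defs "HOL-Computational_Algebra.Polynomial" "HOL-Computational_Algebra.Primes"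
begin

text \<open>If \<open>G/[K,K]\<close> is not nilpotent, Zorn's lemma yields a normal subgroup \<open>N \<supseteq> [K,K]\<close> that is
  maximal with \<open>G/N\<close> not nilpotent: the terms of the lower central series are normally finitely
  generated, so a union of a chain of such subgroups is another one. Let \<open>A\<close> be the image in \<open>G/N\<close>
  of a term of the lower central series that lies in \<open>K\<close>. It is an abelian group on which \<open>G\<close> acts
  through a nilpotent group; the action on \<open>A\<close> is not nilpotent, but it is nilpotent on every proper
  quotient. Take \<open>z\<close> acting non-trivially and centrally. Each polynomial in \<open>z\<close> acts on \<open>A\<close> either as
  zero or injectively, so the annihilator \<open>P\<close> of \<open>A\<close> in \<open>\<int>[z]\<close> is prime. By a variant of P. Hall's
  generic freeness there is a non-zero \<open>s\<close> in \<open>\<int>[z]/P\<close> such that every element comaximal with \<open>s\<close> is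
  a unit, which forces \<open>\<int>[z]/P\<close> to be a finite field. Hence \<open>z\<close> has finite order on \<open>A\<close>, \<open>A\<close> has prime
  exponent \<open>p\<close>, and \<open>A\<close> is irreducible. The acting group is thus a finitely generated nilpotent group
  with torsion centre, so it is finite, and so is \<open>A\<close>. Finally, an element \<open>z\<close> that is central modulo
  the preimage \<open>M\<close> of \<open>A\<close> but not in \<open>M\<close> gives an outer derivation \<open>g \<mapsto> [g, z]\<close>, a non-zero class in
  \<open>H\<^sup>1(G, A)\<close>.

  The second claim follows because nilpotency of \<open>G/[K,K]\<close> means that the series of iterated fixed
  points modulo the previous term exhausts \<open>K/[K,K]\<close>, and the augmentation ideal shifts this series
  down by one.\<close>

text \<open>Just non-nilpotency and generic freeness pull in opposite directions. If
  \<open>f\<close> in \<open>\<int>[z]\<close> does not kill \<open>A\<close>, then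
  \<open>A/fA\<close> is a nilpotent quotient, so a power of \<open>z - 1\<close> maps
  \<open>A\<close> into \<open>fA\<close>; if \<open>f\<close> is also comaximal with
  \<open>z - 1\<close> modulo \<open>P\<close>, this forces \<open>fA = A\<close>. Generic freeness,
  however, lets a non-unit comaximal with \<open>s\<close> act surjectively only on an
  \<open>s\<close>-torsion module, and \<open>A\<close> is not one because \<open>s\<close> acts
  injectively. The element that produces units is therefore \<open>s (z - 1)\<close>. Units alone do
  not make the residue ring finite at once. They exclude ideals \<open>P\<close> extended from
  \<open>\<int>\<close>, in particular \<open>P = 0\<close>, since a polynomial ring over a domain
  has too few units. Characteristic zero is excluded by a second use of generic freeness, over
  \<open>\<int>\<close> with the zero ideal, in which a large prime \<open>q\<close> takes the place
  of \<open>f\<close>. The choice of \<open>N\<close> gives only that proper quotients of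
  \<open>A\<close> are nilpotent. Irreducibility comes out at the end: \<open>z - 1\<close> becomes
  a root of unity in the residue field and so cannot be nilpotent on a nonzero quotient.\<close>

context group
begin

lemma inv_mult_cancel:
  assumes "x \<in> carrier G" "y \<in> carrier G"
  shows "inv x \<otimes> (x \<otimes> y) = y" "x \<otimes> (inv x \<otimes> y) = y"
  using assms by (simp_all flip: m_assoc)

text \<open>Together with the basic group laws these freely reduce words in carrier elements and
  their inverses, which settles the commutator identities below.\<close>

lemmas word_simps = m_assoc inv_mult_group inv_mult_cancel

end

section \<open>Upper and lower central series\<close>

text \<open>For normal \<open>N\<close> this is the preimage of the centre of \<open>G/N\<close>,
  and its iterates form the upper central series above \<open>N\<close>. Staying inside
  \<open>G\<close> avoids iterated quotient groups.\<close>

definition central_mod :: "('a, 'b) monoid_scheme \<Rightarrow> 'a set \<Rightarrow> 'a set" where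
  "central_mod G N = {g \<in> carrier G. \<forall>x\<in>carrier G. g \<otimes>\<^bsub>G\<^esub> x \<otimes>\<^bsub>G\<^esub> inv\<^bsub>G\<^esub> g \<otimes>\<^bsub>G\<^esub> inv\<^bsub>G\<^esub> x \<in> N}"

context group
begin

text \<open>This is the preimage of the centralizer of the coset of \<open>f\<close> in
  \<open>G/N\<close>. It allows a commutator condition to be checked on generators only.\<close>

lemma commutator_preimage_subgroup:
  assumes "normal N G" "f \<in> carrier G"
  shows "subgroup {x \<in> carrier G. f \<otimes> x \<otimes> inv f \<otimes> inv x \<in> N} G"
proof -
  interpret normal N G by fact
  show ?thesis
  proof (rule subgroupI)
    show "{x \<in> carrier G. f \<otimes> x \<otimes> inv f \<otimes> inv x \<in> N} \<noteq> {}"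
      using assms(2) by (auto intro!: exI[of _ \<one>])
  next
    fix a assume a: "a \<in> {x \<in> carrier G. f \<otimes> x \<otimes> inv f \<otimes> inv x \<in> N}"
    then have "inv a \<otimes> inv (f \<otimes> a \<otimes> inv f \<otimes> inv a) \<otimes> a \<in> N"
      by (intro inv_op_closed1) auto
    moreover have "inv a \<otimes> inv (f \<otimes> a \<otimes> inv f \<otimes> inv a) \<otimes> a = f \<otimes> inv a \<otimes> inv f \<otimes> inv (inv a)"
      using a assms(2) by (simp add: word_simps)
    ultimately show "inv a \<in> {x \<in> carrier G. f \<otimes> x \<otimes> inv f \<otimes> inv x \<in> N}" using a by simp
  next
    fix a b assume ab: "a \<in> {x \<in> carrier G. f \<otimes> x \<otimes> inv f \<otimes> inv x \<in> N}"
      "b \<in> {x \<in> carrier G. f \<otimes> x \<otimes> inv f \<otimes> inv x \<in> N}"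
    then have "a \<otimes> (f \<otimes> b \<otimes> inv f \<otimes> inv b) \<otimes> inv a \<in> N"
      by (intro inv_op_closed2) auto
    with ab have "(f \<otimes> a \<otimes> inv f \<otimes> inv a) \<otimes> (a \<otimes> (f \<otimes> b \<otimes> inv f \<otimes> inv b) \<otimes> inv a) \<in> N"
      by auto
    moreover have "(f \<otimes> a \<otimes> inv f \<otimes> inv a) \<otimes> (a \<otimes> (f \<otimes> b \<otimes> inv f \<otimes> inv b) \<otimes> inv a)
      = f \<otimes> (a \<otimes> b) \<otimes> inv f \<otimes> inv (a \<otimes> b)"
      using ab assms(2) by (simp add: word_simps)
    ultimately show "a \<otimes> b \<in> {x \<in> carrier G. f \<otimes> x \<otimes> inv f \<otimes> inv x \<in> N}"
      using ab by simp
  qed auto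
qed

lemma commutator_swap:
  assumes "subgroup N G" "a \<in> carrier G" "b \<in> carrier G" "a \<otimes> b \<otimes> inv a \<otimes> inv b \<in> N"
  shows "b \<otimes> a \<otimes> inv b \<otimes> inv a \<in> N"
proof -
  have "inv (a \<otimes> b \<otimes> inv a \<otimes> inv b) = b \<otimes> a \<otimes> inv b \<otimes> inv a"
    using assms(2,3) by (simp add: word_simps)
  then show ?thesis using subgroup.m_inv_closed[OF assms(1,4)] by simp
qed

lemma normal_if_commutators:
  assumes "subgroup N G"
    and "\<And>n x. n \<in> N \<Longrightarrow> x \<in> carrier G \<Longrightarrow> n \<otimes> x \<otimes> inv n \<otimes> inv x \<in> N"
  shows "N \<lhd> G"
proof (rule normal_invI[OF assms(1)])
  fix x h assume xh: "x \<in> carrier G" "h \<in> N"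
  then have h: "h \<in> carrier G" using subgroup.subset[OF assms(1)] by auto
  have "x \<otimes> h \<otimes> inv x \<otimes> inv h \<in> N"
    using commutator_swap[OF assms(1) h xh(1)] assms(2) xh by blast
  then have "x \<otimes> h \<otimes> inv x \<otimes> inv h \<otimes> h \<in> N"
    using subgroup.m_closed[OF assms(1)] xh by blast
  then show "x \<otimes> h \<otimes> inv x \<in> N" using xh h by (simp add: word_simps)
qed

lemma normal_commutator:
  assumes "N \<lhd> G" "n \<in> N" "x \<in> carrier G"
  shows "n \<otimes> x \<otimes> inv n \<otimes> inv x \<in> N"
proof -
  interpret normal N G by fact
  have "n \<otimes> (x \<otimes> inv n \<otimes> inv x) \<in> N"
    using assms by (intro m_closed inv_op_closed2) auto
  then show ?thesis using assms by (simp add: word_simps)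
qed

lemma subset_central_mod: "N \<lhd> G \<Longrightarrow> N \<subseteq> central_mod G N"
  using normal_commutator subgroup.subset[OF normal_imp_subgroup]
  by (fastforce simp: central_mod_def)

lemma central_mod_normal:
  assumes "N \<lhd> G"
  shows "central_mod G N \<lhd> G"
proof (rule normal_if_commutators)
  interpret normal N G by fact
  \<comment> \<open>Swapping the arguments of the commutator moves the varying element into the
    second slot, so that \<open>central_mod G N\<close> becomes an intersection of subgroups from
    \<open>commutator_preimage_subgroup\<close>.\<close>
  have mem: "g \<in> central_mod G N \<longleftrightarrow>
      g \<in> carrier G \<and> (\<forall>x\<in>carrier G. g \<in> {g \<in> carrier G. x \<otimes> g \<otimes> inv x \<otimes> inv g \<in> N})" for g
    using commutator_swap[OF subgroup_axioms] by (auto simp: central_mod_def)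
  note sub = commutator_preimage_subgroup[OF assms]
  show "subgroup (central_mod G N) G"
  proof (rule subgroup.intro)
    show "x \<otimes> y \<in> central_mod G N" if "x \<in> central_mod G N" "y \<in> central_mod G N" for x y
      using that subgroup.m_closed[OF sub] unfolding mem by blast
    show "inv x \<in> central_mod G N" if "x \<in> central_mod G N" for x
      using that subgroup.m_inv_closed[OF sub] unfolding mem by blast
    show "\<one> \<in> central_mod G N" using subset_central_mod[OF assms] one_closed by auto
  qed (auto simp: central_mod_def)
  show "n \<otimes> x \<otimes> inv n \<otimes> inv x \<in> central_mod G N" if "n \<in> central_mod G N" "x \<in> carrier G" for n x
    using that subset_central_mod[OF assms] by (auto simp: central_mod_def)
qed

lemma lcs_subset_carrier: "lower_central_series G n \<subseteq> carrier G"
proof (induction n)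
  case (Suc n)
  then show ?case
    unfolding lower_central_series.simps commutator_subgroup_def
    by (intro generate_incl) (fastforce intro!: m_closed inv_closed)
qed simp

text \<open>Taking commutators with \<open>G\<close> is adjoint to \<open>central_mod\<close>.
  Asking only for a subgroup \<open>W\<close> makes this available before the terms of the series
  are known to be normal.\<close>

lemma lcs_Suc_subset_iff:
  assumes "subgroup W G"
  shows "lower_central_series G (Suc n) \<subseteq> W \<longleftrightarrow> lower_central_series G n \<subseteq> central_mod G W"
proof
  assume *: "lower_central_series G (Suc n) \<subseteq> W"
  show "lower_central_series G n \<subseteq> central_mod G W"
  proof
    fix g assume g: "g \<in> lower_central_series G n"
    have "g \<otimes> x \<otimes> inv g \<otimes> inv x \<in> lower_central_series G (Suc n)" if "x \<in> carrier G" for x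
      unfolding lower_central_series.simps commutator_subgroup_def
      by (rule generate.incl) (use g that in blast)
    then show "g \<in> central_mod G W"
      using * g lcs_subset_carrier by (fastforce simp: central_mod_def)
  qed
next
  assume *: "lower_central_series G n \<subseteq> central_mod G W"
  show "lower_central_series G (Suc n) \<subseteq> W"
    unfolding lower_central_series.simps commutator_subgroup_def
    by (intro generate_subgroup_incl[OF _ assms]) (use * in \<open>auto simp: central_mod_def\<close>)
qed

text \<open>The two claims feed each other. An element of term \<open>n + 1\<close> lies in term
  \<open>n\<close>, so its commutators with \<open>G\<close> fall back into term
  \<open>n + 1\<close>, which gives normality; a normal subgroup lies in its own
  \<open>central_mod\<close>, which by adjunction gives the next inclusion.\<close>

lemma lcs_normal: "lower_central_series G n \<lhd> G"
  and lcs_decreasing: "lower_central_series G (Suc n) \<subseteq> lower_central_series G n"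
proof -
  have sub: "subgroup (lower_central_series G n) G" for n
  proof (cases n)
    case 0 then show ?thesis by (simp add: subgroup_self)
  next
    case (Suc m)
    then show ?thesis
      using lcs_subset_carrier[of m] unfolding Suc lower_central_series.simps commutator_subgroup_def
      by (intro generate_is_subgroup) (fastforce intro!: m_closed inv_closed)
  qed
  have comm: "g \<otimes> x \<otimes> inv g \<otimes> inv x \<in> lower_central_series G (Suc n)"
    if "g \<in> lower_central_series G n" "x \<in> carrier G" for g x n
    using lcs_Suc_subset_iff[OF sub, of n "Suc n"] that by (auto simp: central_mod_def)
  have *: "lower_central_series G n \<lhd> G \<and> lower_central_series G (Suc n) \<subseteq> lower_central_series G n" for n
  proof (induction n)
    case 0 then show ?case using lcs_subset_carrier[of "Suc 0"] normal_self by simp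
  next
    case (Suc n)
    then have n: "lower_central_series G (Suc n) \<lhd> G"
      using comm[of _ n] sub by (intro normal_if_commutators) blast+
    moreover have "lower_central_series G (Suc (Suc n)) \<subseteq> lower_central_series G (Suc n)"
      unfolding lcs_Suc_subset_iff[OF sub] by (rule subset_central_mod[OF n])
    ultimately show ?case by blast
  qed
  show "lower_central_series G n \<lhd> G" "lower_central_series G (Suc n) \<subseteq> lower_central_series G n"
    using * by auto
qed

lemma lcs_commutator:
  "g \<in> lower_central_series G n \<Longrightarrow> x \<in> carrier G \<Longrightarrow>
    g \<otimes> x \<otimes> inv g \<otimes> inv x \<in> lower_central_series G (Suc n)"
  using lcs_Suc_subset_iff[OF normal_imp_subgroup[OF lcs_normal], of n "Suc n"]
  by (auto simp: central_mod_def)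

text \<open>Trades \<open>k\<close> steps of the lower series for \<open>k\<close> steps of the
  upper series above \<open>N\<close>. With \<open>i = 0\<close> it compares the class of
  \<open>G/N\<close> with the number of steps in which the upper series reaches
  \<open>G\<close>.\<close>

lemma lcs_add_subset_iff:
  assumes "N \<lhd> G"
  shows "lower_central_series G (i + k) \<subseteq> N \<longleftrightarrow> lower_central_series G i \<subseteq> (central_mod G ^^ k) N"
  using assms
proof (induction k arbitrary: N)
  case (Suc k)
  have "lower_central_series G (i + Suc k) \<subseteq> N \<longleftrightarrow> lower_central_series G (i + k) \<subseteq> central_mod G N"
    using lcs_Suc_subset_iff[OF normal_imp_subgroup[OF Suc.prems], of "i + k"] by simp
  then show ?case
    using Suc.IH[OF central_mod_normal[OF Suc.prems]] by (simp add: funpow_swap1)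
qed simp

text \<open>Commutators of normal generators of term \<open>n\<close> with generators of
  \<open>G\<close> are normal generators of term \<open>n + 1\<close>: membership of a commutator in
  a normal \<open>N\<close> can be tested on generators in each argument separately.\<close>

lemma lcs_normal_closure_finite:
  assumes "finite S" "S \<subseteq> carrier G" "generate G S = carrier G"
  obtains F where "finite F" "F \<subseteq> lower_central_series G n"
    "\<And>N. N \<lhd> G \<Longrightarrow> F \<subseteq> N \<Longrightarrow> lower_central_series G n \<subseteq> N"
proof -
  have "\<exists>F. finite F \<and> F \<subseteq> lower_central_series G n \<and>
    (\<forall>N. N \<lhd> G \<longrightarrow> F \<subseteq> N \<longrightarrow> lower_central_series G n \<subseteq> N)"
  proof (induction n)
    case 0
    show ?case
    proof (intro exI conjI allI impI)
      fix N assume "N \<lhd> G" "S \<subseteq> N"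
      then have "generate G S \<subseteq> N" by (intro generate_subgroup_incl normal_imp_subgroup)
      then show "lower_central_series G 0 \<subseteq> N" by (simp only: assms(3) lower_central_series.simps)
    qed (use assms in simp_all)
  next
    case (Suc n)
    then obtain F where F: "finite F" "F \<subseteq> lower_central_series G n"
      "\<And>N. N \<lhd> G \<Longrightarrow> F \<subseteq> N \<Longrightarrow> lower_central_series G n \<subseteq> N" by blast
    define F' where "F' = (\<lambda>(f, s). f \<otimes> s \<otimes> inv f \<otimes> inv s) ` (F \<times> S)"
    have "lower_central_series G (Suc n) \<subseteq> N" if N: "N \<lhd> G" "F' \<subseteq> N" for N
    proof -
      have "f \<in> central_mod G N" if f: "f \<in> F" for f
      proof -
        have fc: "f \<in> carrier G" using f F(2) lcs_subset_carrier by blast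
        have "S \<subseteq> {x \<in> carrier G. f \<otimes> x \<otimes> inv f \<otimes> inv x \<in> N}"
          using f N(2) assms(2) by (force simp: F'_def)
        then have "carrier G \<subseteq> {x \<in> carrier G. f \<otimes> x \<otimes> inv f \<otimes> inv x \<in> N}"
          unfolding assms(3)[symmetric]
          by (rule generate_subgroup_incl[OF _ commutator_preimage_subgroup[OF N(1) fc, folded assms(3)]])
        then show ?thesis using fc by (auto simp: central_mod_def)
      qed
      then have "lower_central_series G n \<subseteq> central_mod G N"
        by (intro F(3) central_mod_normal N) auto
      then show ?thesis using lcs_Suc_subset_iff normal_imp_subgroup N(1) by blast
    qed
    moreover have "F' \<subseteq> lower_central_series G (Suc n)"
      using F(2) assms(2) lcs_commutator by (force simp: F'_def)
    moreover have "finite F'" using F assms by (simp add: F'_def)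
    ultimately show ?case by blast
  qed
  then show ?thesis using that by blast
qed

lemma lcs_quotient:
  assumes "N \<lhd> G"
  shows "lower_central_series (G Mod N) n = (\<lambda>x. N #> x) ` lower_central_series G n"
proof -
  interpret normal N G by fact
  interpret Q: group "G Mod N" by (rule factorgroup_is_group)
  interpret h: group_hom G "G Mod N" "\<lambda>x. N #> x"
    by unfold_locales (rule r_coset_hom_Mod)
  show ?thesis
  proof (induction n)
    case 0 show ?case by (auto simp: carrier_FactGroup)
  next
    case (Suc n)
    have "(\<Union>u\<in>lower_central_series (G Mod N) n. \<Union>l\<in>carrier (G Mod N).
        {u \<otimes>\<^bsub>G Mod N\<^esub> l \<otimes>\<^bsub>G Mod N\<^esub> inv\<^bsub>G Mod N\<^esub> u \<otimes>\<^bsub>G Mod N\<^esub> inv\<^bsub>G Mod N\<^esub> l})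
      = (\<lambda>x. N #> x) ` (\<Union>u\<in>lower_central_series G n. \<Union>l\<in>carrier G. {u \<otimes> l \<otimes> inv u \<otimes> inv l})"
      using lcs_subset_carrier[of n]
      by (auto simp: Suc.IH carrier_FactGroup image_UN subset_iff)
    then show ?case
      unfolding lower_central_series.simps commutator_subgroup_def
      by (subst h.generate_img[symmetric]) (use lcs_subset_carrier[of n] in \<open>auto simp: subset_iff\<close>)
  qed
qed

lemma nilpotent_quotient_iff:
  assumes "N \<lhd> G"
  shows "nilpotent_group (G Mod N) \<longleftrightarrow> (\<exists>n. lower_central_series G n \<subseteq> N)"
proof -
  interpret normal N G by fact
  have "(\<lambda>x. N #> x) ` lower_central_series G n = {N} \<longleftrightarrow> lower_central_series G n \<subseteq> N" for n
  proof
    assume eq: "(\<lambda>x. N #> x) ` lower_central_series G n = {N}"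
    show "lower_central_series G n \<subseteq> N"
    proof
      fix x assume x: "x \<in> lower_central_series G n"
      then have "x \<in> N #> x" by (intro rcos_self subgroup_axioms subsetD[OF lcs_subset_carrier])
      moreover have "N #> x = N" using eq x by blast
      ultimately show "x \<in> N" by simp
    qed
  next
    assume "lower_central_series G n \<subseteq> N"
    then have "N #> x = N" if "x \<in> lower_central_series G n" for x
      by (intro rcos_const[OF is_group]) (use that in auto)
    moreover have "\<one> \<in> lower_central_series G n"
      by (rule subgroup.one_closed[OF normal_imp_subgroup[OF lcs_normal]])
    ultimately show "(\<lambda>x. N #> x) ` lower_central_series G n = {N}" by blast
  qed
  then show ?thesis
    by (simp add: nilpotent_group_def lcs_quotient[OF assms] factorgroup_is_group)
qed

end

section \<open>Central series with cyclic factors\<close>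

text \<open>A central series going up from \<open>N\<close> with cyclic factors. For a finitely
  generated nilpotent \<open>G/N\<close> it plays the part of a polycyclic series, and induction
  over it reduces statements about \<open>G\<close> to a trivial action and a cyclic
  extension.\<close>

inductive polycentral :: "('a, 'b) monoid_scheme \<Rightarrow> 'a set \<Rightarrow> 'a set \<Rightarrow> bool" for G N where
  base: "polycentral G N N"
| step: "polycentral G N H \<Longrightarrow> x \<in> central_mod G H \<Longrightarrow> polycentral G N (generate G (insert x H))"

context group
begin

text \<open>Every subgroup between \<open>H\<close> and \<open>central_mod G H\<close> is normal,
  since its commutators with \<open>G\<close> already lie in \<open>H\<close>.\<close>

lemma normal_generate_insert_central:
  assumes "H \<lhd> G" "x \<in> central_mod G H"
  shows "generate G (insert x H) \<lhd> G"
proof (rule normal_if_commutators)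
  have c: "insert x H \<subseteq> carrier G"
    using assms subgroup.subset[OF normal_imp_subgroup] by (auto simp: central_mod_def)
  then show "subgroup (generate G (insert x H)) G" by (rule generate_is_subgroup)
  fix n g assume n: "n \<in> generate G (insert x H)" and g: "g \<in> carrier G"
  have "generate G (insert x H) \<subseteq> central_mod G H"
    using assms subset_central_mod[OF assms(1)]
    by (intro generate_subgroup_incl normal_imp_subgroup[OF central_mod_normal]) auto
  then have "n \<otimes> g \<otimes> inv n \<otimes> inv g \<in> H" using n g by (auto simp: central_mod_def)
  then show "n \<otimes> g \<otimes> inv n \<otimes> inv g \<in> generate G (insert x H)"
    by (rule generate.incl[OF insertI2])
qed

lemma polycentral_normal: "polycentral G N H \<Longrightarrow> N \<lhd> G \<Longrightarrow> H \<lhd> G"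
  by (induction rule: polycentral.induct) (auto intro: normal_generate_insert_central)

lemma polycentral_extend_finite:
  assumes "finite F" "polycentral G N H" "F \<subseteq> central_mod G H"
  obtains R where "polycentral G N R" "H \<union> F \<subseteq> R"
proof -
  have "\<exists>R. polycentral G N R \<and> H \<union> F \<subseteq> R"
    using assms
  proof (induction F rule: finite_induct)
    case (insert x F)
    then obtain R where R: "polycentral G N R" "H \<union> F \<subseteq> R" by auto
    \<comment> \<open>Being central modulo \<open>H\<close> implies being central modulo the larger
      \<open>R\<close>, so the elements of \<open>F\<close> may be adjoined in any order.\<close>
    have "x \<in> central_mod G R"
      using insert.prems R(2) by (fastforce simp: central_mod_def)
    then have "polycentral G N (generate G (insert x R))" by (rule polycentral.step[OF R(1)])
    moreover have "H \<union> insert x F \<subseteq> generate G (insert x R)"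
      using R(2) by (auto intro: generate.incl)
    ultimately show ?case by blast
  qed auto
  then show ?thesis using that by blast
qed

lemma polycentral_carrier:
  assumes "finite S" "S \<subseteq> carrier G" "generate G S = carrier G"
    and "N \<lhd> G" "lower_central_series G c \<subseteq> N"
  shows "polycentral G N (carrier G)"
proof -
  \<comment> \<open>The series is climbed from index \<open>c\<close> down to \<open>0\<close>. Term
    \<open>j\<close> is central modulo any normal subgroup containing term \<open>j + 1\<close>,
    hence its finitely many normal generators can be adjoined one by one.\<close>
  have "\<exists>R. polycentral G N R \<and> lower_central_series G (c - i) \<subseteq> R" if "i \<le> c" for i
    using that
  proof (induction i)
    case 0 then show ?case using polycentral.base assms(5) by auto
  next
    case (Suc i)
    define j where "j = c - Suc i"
    have "c - i = Suc j" using Suc.prems by (simp add: j_def)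
    then obtain R where R: "polycentral G N R" "lower_central_series G (Suc j) \<subseteq> R"
      using Suc by auto
    obtain F where F: "finite F" "F \<subseteq> lower_central_series G j"
      "\<And>N. N \<lhd> G \<Longrightarrow> F \<subseteq> N \<Longrightarrow> lower_central_series G j \<subseteq> N"
      using lcs_normal_closure_finite[OF assms(1-3)] by metis
    have "lower_central_series G j \<subseteq> central_mod G R"
      using R lcs_Suc_subset_iff polycentral_normal[OF R(1) assms(4)] normal_imp_subgroup by blast
    then obtain R' where R': "polycentral G N R'" "R \<union> F \<subseteq> R'"
      using polycentral_extend_finite[OF F(1) R(1)] F(2) by blast
    then have "lower_central_series G j \<subseteq> R'"
      using F(3) polycentral_normal[OF R'(1) assms(4)] by blast
    then show ?case using R' by (auto simp: j_def)
  qed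
  from this[of c] obtain R where R: "polycentral G N R" "carrier G \<subseteq> R" by auto
  moreover have "R \<subseteq> carrier G"
    using polycentral_normal[OF R(1) assms(4)] normal_imp_subgroup subgroup.subset by blast
  ultimately show ?thesis by (simp add: subset_antisym)
qed

end

section \<open>Ascending chain conditions\<close>

definition acc_on :: "('a set \<Rightarrow> bool) \<Rightarrow> bool" where
  "acc_on P \<longleftrightarrow> (\<forall>N :: nat \<Rightarrow> 'a set. (\<forall>i. P (N i)) \<longrightarrow> incseq N \<longrightarrow> (\<exists>n. \<forall>m\<ge>n. N m = N n))"

lemma acc_onD:
  assumes "acc_on P" "\<And>i. P (N i)" "incseq N"
  obtains n where "\<And>m. m \<ge> n \<Longrightarrow> N m = N n"
  using assms unfolding acc_on_def by blast

text \<open>The diagonal becomes constant at some \<open>n0\<close>, and every \<open>l n j\<close>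
  with \<open>n\<close> and \<open>j\<close> at least \<open>n0\<close> is squeezed between two
  diagonal terms. Only the finitely many rows below \<open>n0\<close> remain, each of which
  stabilizes by itself. Hilbert's argument needs the bound to be uniform in the degree
  \<open>n\<close>.\<close>

lemma acc_on_double_chain:
  fixes l :: "nat \<Rightarrow> nat \<Rightarrow> 'a set"
  assumes "acc_on P" "\<And>n i. P (l n i)"
    and mono: "\<And>n n' i i'. n \<le> n' \<Longrightarrow> i \<le> i' \<Longrightarrow> l n i \<subseteq> l n' i'"
  obtains i0 where "\<And>i n. i \<ge> i0 \<Longrightarrow> l n i = l n i0"
proof -
  have "incseq (\<lambda>n. l n n)" using mono by (auto simp: incseq_def)
  then obtain n0 where n0: "\<And>m. m \<ge> n0 \<Longrightarrow> l m m = l n0 n0"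
    using acc_onD[OF assms(1), of "\<lambda>n. l n n"] assms(2) by metis
  have "\<exists>k. \<forall>m\<ge>k. l n m = l n k" for n
    using assms(1,2) mono[OF order_refl] unfolding acc_on_def incseq_def by blast
  then obtain k where k: "\<And>n m. m \<ge> k n \<Longrightarrow> l n m = l n (k n)" by metis
  define i0 where "i0 = n0 + (\<Sum>n<n0. k n)"
  have "l n i = l n i0" if "i \<ge> i0" for i n
  proof (cases "n < n0")
    case True
    then have "k n \<le> i0" unfolding i0_def
      by (metis finite_lessThan lessThan_iff member_le_sum trans_le_add2 zero_le)
    then show ?thesis using k that by (metis order_trans)
  next
    case False
    have "l n j = l n0 n0" if "j \<ge> n0" for j
      using mono[of n0 n n0 j] mono[of n "max n j" j "max n j"] n0[of "max n j"] that False by force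
    then show ?thesis using that by (simp add: i0_def)
  qed
  then show ?thesis using that by blast
qed

definition ring_ideal :: "'r::comm_ring_1 set \<Rightarrow> bool" where
  "ring_ideal I \<longleftrightarrow> 0 \<in> I \<and> (\<forall>x\<in>I. \<forall>y\<in>I. x + y \<in> I) \<and> (\<forall>a. \<forall>x\<in>I. a * x \<in> I)"

lemma ring_idealD:
  assumes "ring_ideal I"
  shows "0 \<in> I" "x \<in> I \<Longrightarrow> y \<in> I \<Longrightarrow> x + y \<in> I" "x \<in> I \<Longrightarrow> a * x \<in> I" "x \<in> I \<Longrightarrow> x * a \<in> I"
    "x \<in> I \<Longrightarrow> - x \<in> I" "x \<in> I \<Longrightarrow> y \<in> I \<Longrightarrow> x - y \<in> I"
proof -
  note * = assms[unfolded ring_ideal_def]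
  show "0 \<in> I" "x \<in> I \<Longrightarrow> y \<in> I \<Longrightarrow> x + y \<in> I" "x \<in> I \<Longrightarrow> a * x \<in> I" using * by auto
  show "x \<in> I \<Longrightarrow> x * a \<in> I" using * by (simp add: mult.commute)
  have m: "- x \<in> I" if "x \<in> I" for x using * that by (metis mult_minus1)
  then show "x \<in> I \<Longrightarrow> - x \<in> I" .
  show "x \<in> I \<Longrightarrow> y \<in> I \<Longrightarrow> x - y \<in> I" using m * by (metis add_uminus_conv_diff)
qed

text \<open>Division with remainder by the least positive integer in the union of the chain shows
  that a member of the chain containing it already contains the whole union.\<close>

lemma acc_on_ring_ideal_int: "acc_on (ring_ideal :: int set \<Rightarrow> bool)"
  unfolding acc_on_def
proof (intro allI impI)
  fix N :: "nat \<Rightarrow> int set"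
  assume id: "\<forall>i. ring_ideal (N i)" and inc: "incseq N"
  show "\<exists>n. \<forall>m\<ge>n. N m = N n"
  proof (cases "\<exists>n. \<exists>x\<in>N n. x \<noteq> 0")
    case False
    then have "N m = {0}" for m using ring_idealD(1)[of "N m"] id by auto
    then show ?thesis by auto
  next
    case True
    define Q where "Q k \<longleftrightarrow> k > 0 \<and> (\<exists>n. int k \<in> N n)" for k
    obtain n x where x: "x \<in> N n" "x \<noteq> 0" using True by blast
    then have "\<bar>x\<bar> \<in> N n" using ring_idealD(5)[of "N n" x] id by (simp add: abs_if)
    then have "Q (nat \<bar>x\<bar>)" using x by (auto simp: Q_def)
    define d where "d = (LEAST k. Q k)"
    have "Q d" unfolding d_def by (rule LeastI) fact
    then obtain n where n: "int d \<in> N n" "d > 0" by (auto simp: Q_def)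
    have "x \<in> N n" if m: "m \<ge> n" and x: "x \<in> N m" for m x
    proof -
      have "int d \<in> N m" using n inc m by (auto simp: incseq_def)
      then have "x - (x div int d) * int d \<in> N m"
        using x id by (intro ring_idealD) auto
      then have "x mod int d \<in> N m" by (simp add: minus_div_mult_eq_mod)
      moreover have "x mod int d \<ge> 0" "x mod int d < int d" using n by auto
      moreover from this have "\<not> Q (nat (x mod int d))"
        unfolding d_def by (intro not_less_Least) (simp add: nat_less_iff flip: d_def)
      ultimately have "x mod int d = 0"
        unfolding Q_def by (metis int_nat_eq less_le zero_less_nat_eq)
      then have "x = (x div int d) * int d" by (simp add: mod_eq_0_iff_dvd)
      then show ?thesis using ring_idealD(3)[of "N n"] id n by metis
    qed
    then have "N m = N n" if "m \<ge> n" for m using incseqD[OF inc that] that by blast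
    then show ?thesis by blast
  qed
qed

text \<open>Hilbert's basis theorem: nested ideals coincide once their ideals of leading
  coefficients agree in every degree.\<close>

lemma acc_on_ring_ideal_poly:
  assumes "acc_on (ring_ideal :: 'r::comm_ring_1 set \<Rightarrow> bool)"
  shows "acc_on (ring_ideal :: 'r poly set \<Rightarrow> bool)"
  unfolding acc_on_def
proof (intro allI impI)
  fix N :: "nat \<Rightarrow> 'r poly set"
  assume "\<forall>i. ring_ideal (N i)" and inc: "incseq N"
  then have id: "ring_ideal (N i)" for i by auto
  note idD = ring_idealD[OF id]
  \<comment> \<open>The coefficients of degree \<open>n\<close> of those members of
    \<open>N i\<close> that have degree at most \<open>n\<close>. A vanishing top coefficient is
    allowed, which makes this an ideal.\<close>
  define l where "l n i = {c. \<exists>p\<in>N i. (\<forall>k>n. coeff p k = 0) \<and> coeff p n = c}" for n i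
  have "ring_ideal (l n i)" for n i
    unfolding ring_ideal_def
  proof (intro conjI ballI allI)
    show "0 \<in> l n i" using idD(1) by (auto simp: l_def intro!: bexI[of _ 0])
    fix x y assume "x \<in> l n i" "y \<in> l n i"
    then obtain p q where "p \<in> N i" "\<forall>k>n. coeff p k = 0" "coeff p n = x"
      "q \<in> N i" "\<forall>k>n. coeff q k = 0" "coeff q n = y" by (auto simp: l_def)
    then show "x + y \<in> l n i" using idD(2) by (auto simp: l_def intro!: bexI[of _ "p + q"])
  next
    fix a x assume "x \<in> l n i"
    then obtain p where "p \<in> N i" "\<forall>k>n. coeff p k = 0" "coeff p n = x" by (auto simp: l_def)
    then show "a * x \<in> l n i" using idD(3)[of p i "[:a:]"]
      by (auto simp: l_def intro!: bexI[of _ "smult a p"])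
  qed
  moreover have "l n i \<subseteq> l n' i'" if le: "n \<le> n'" "i \<le> i'" for n n' i i'
  proof
    fix x assume "x \<in> l n i"
    then obtain p where p: "p \<in> N i" "\<forall>k>n. coeff p k = 0" "coeff p n = x" by (auto simp: l_def)
    have "p \<in> N i'" using p(1) incseqD[OF inc le(2)] by auto
    then have "Polynomial.monom 1 (n' - n) * p \<in> N i'" by (rule idD(3))
    moreover have "coeff (Polynomial.monom 1 (n' - n) * p) n' = x"
      "\<forall>k>n'. coeff (Polynomial.monom 1 (n' - n) * p) k = 0"
      using p le by (auto simp: coeff_monom_mult)
    ultimately show "x \<in> l n' i'" by (auto simp: l_def)
  qed
  ultimately obtain i0 where i0: "\<And>i n. i \<ge> i0 \<Longrightarrow> l n i = l n i0"
    using acc_on_double_chain[OF assms, of l] by blast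
  \<comment> \<open>Descent on a degree bound: some \<open>q\<close> in \<open>N i0\<close> has the
    same top coefficient, and \<open>p - q\<close> obeys a smaller bound.\<close>
  have "p \<in> N i0" if "i \<ge> i0" "p \<in> N i" "\<forall>k\<ge>n. coeff p k = 0" for i p n
    using that(2,3)
  proof (induction n arbitrary: p)
    case 0 then have "p = 0" by (simp add: poly_eq_iff)
    then show ?case using idD(1) by simp
  next
    case (Suc n)
    then have "\<forall>k>n. coeff p k = 0" by simp
    then have "coeff p n \<in> l n i" using Suc.prems(1) by (auto simp: l_def)
    then have "coeff p n \<in> l n i0" using i0 that by metis
    then obtain q where q: "q \<in> N i0" "\<forall>k>n. coeff q k = 0" "coeff q n = coeff p n"
      by (auto simp: l_def)
    have "q \<in> N i" using q(1) incseqD[OF inc that(1)] by auto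
    then have "p - q \<in> N i" by (rule idD(6)[OF Suc.prems(1)])
    moreover have "coeff (p - q) k = 0" if "k \<ge> n" for k
      using that Suc.prems(2) q by (cases "k = n") auto
    ultimately have "p - q \<in> N i0" using Suc.IH by blast
    then show ?case using idD(2)[OF _ q(1)] by force
  qed
  then have "N i \<subseteq> N i0" if "i \<ge> i0" for i
    using that MOST_coeff_eq_0 le_degree
    by (metis coeff_eq_0 Suc_le_lessD subsetI)
  then have "N i = N i0" if "i \<ge> i0" for i using incseqD[OF inc that] that by blast
  then show "\<exists>n. \<forall>m\<ge>n. N m = N n" by blast
qed

section \<open>Generic reducedness of finitely generated modules\<close>

text \<open>The module of interest is \<open>V/L\<close>, represented by preimages in
  \<open>V\<close>; accordingly operators commute with scalars only modulo \<open>L\<close>. The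
  prime ideal \<open>P\<close> annihilates \<open>V/L\<close>, so the scalars really form a domain.
  Two instances occur later: integer polynomials modulo an annihilator, and the integers with
  \<open>P = {0}\<close>.\<close>

locale scalar_operators = Modules.module scale + group G
  for scale :: "'r::comm_ring_1 \<Rightarrow> 'v::ab_group_add \<Rightarrow> 'v" and G :: "('g, 'b) monoid_scheme" (structure) +
  fixes T :: "'g \<Rightarrow> 'v \<Rightarrow> 'v" and L :: "'v set" and P :: "'r set"
  assumes T_add: "g \<in> carrier G \<Longrightarrow> T g (v + w) = T g v + T g w"
    and T_mult: "g \<in> carrier G \<Longrightarrow> h \<in> carrier G \<Longrightarrow> T (g \<otimes> h) v = T g (T h v)"
    and T_one: "T \<one> v = v"
    and L_subspace: "subspace L"
    and T_L: "g \<in> carrier G \<Longrightarrow> v \<in> L \<Longrightarrow> T g v \<in> L"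
    and T_scale: "g \<in> carrier G \<Longrightarrow> T g (scale r v) - scale r (T g v) \<in> L"
    and P_ideal: "ring_ideal P" and P_one: "1 \<notin> P"
    and P_prime: "a * b \<in> P \<Longrightarrow> a \<in> P \<or> b \<in> P"
    and P_scale: "r \<in> P \<Longrightarrow> scale r v \<in> L"
    and acc_scalars: "acc_on (ring_ideal :: 'r set \<Rightarrow> bool)"
begin

lemma T_zero: "g \<in> carrier G \<Longrightarrow> T g 0 = 0"
  using T_add[of g 0 0] by simp

lemma T_minus: "g \<in> carrier G \<Longrightarrow> T g (- v) = - T g v"
  using T_add[of g v "- v"] T_zero[of g] by (metis add.right_inverse add_eq_0_iff)

lemma T_diff: "g \<in> carrier G \<Longrightarrow> T g (v - w) = T g v - T g w"
  using T_add[of g v "- w"] T_minus[of g w] by simp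

lemma T_inv: "g \<in> carrier G \<Longrightarrow> T (inv g) (T g v) = v" "g \<in> carrier G \<Longrightarrow> T g (T (inv g) v) = v"
  by (simp_all flip: T_mult add: T_one)

definition submod :: "'g set \<Rightarrow> 'v set \<Rightarrow> bool" where
  "submod H W \<longleftrightarrow> L \<subseteq> W \<and> subspace W \<and> (\<forall>h\<in>H. \<forall>w\<in>W. T h w \<in> W)"

lemma submodD:
  assumes "submod H W"
  shows "L \<subseteq> W" "subspace W" "h \<in> H \<Longrightarrow> w \<in> W \<Longrightarrow> T h w \<in> W"
  using assms by (auto simp: submod_def)

lemma submod_L: "H \<subseteq> carrier G \<Longrightarrow> submod H L"
  using L_subspace T_L by (auto simp: submod_def)

lemma submod_scale_iff:
  assumes "submod H W" "g \<in> carrier G"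
  shows "T g (scale r v) \<in> W \<longleftrightarrow> scale r (T g v) \<in> W"
proof -
  have "T g (scale r v) - scale r (T g v) \<in> W"
    using T_scale[OF assms(2)] submodD(1)[OF assms(1)] by auto
  then show ?thesis
    using subspace_diff[OF submodD(2)[OF assms(1)]] subspace_add[OF submodD(2)[OF assms(1)]]
    by (metis add_diff_cancel_left' diff_add_cancel)
qed

text \<open>\<open>U\<close> is kept apart from \<open>F\<close> because the hull is regarded as a
  finitely generated module modulo an arbitrary base \<open>U\<close>.\<close>

definition submod_hull :: "'g set \<Rightarrow> 'v set \<Rightarrow> 'v set \<Rightarrow> 'v set" where
  "submod_hull H U F = \<Inter>{W. submod H W \<and> U \<union> F \<subseteq> W}"

lemma submod_submod_hull: "submod H (submod_hull H U F)"
proof -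
  have "subspace (submod_hull H U F)"
    unfolding submod_hull_def by (rule subspace_Inter) (auto simp: submod_def)
  then show ?thesis by (auto simp: submod_def submod_hull_def)
qed

lemma hull_superset: "U \<subseteq> submod_hull H U F" "F \<subseteq> submod_hull H U F"
  by (auto simp: submod_hull_def)

lemma hull_minimal: "submod H W \<Longrightarrow> U \<subseteq> W \<Longrightarrow> F \<subseteq> W \<Longrightarrow> submod_hull H U F \<subseteq> W"
  by (auto simp: submod_hull_def)

text \<open>Lets a statement about hulls over an arbitrary base be applied to every submodule
  \<open>Z\<close> between \<open>U\<close> and the hull, with the same finite set
  \<open>F\<close>.\<close>

lemma hull_eqI:
  assumes "U \<subseteq> Z" "Z \<subseteq> submod_hull H U F"
  shows "submod_hull H Z F = submod_hull H U F"
proof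
  show "submod_hull H Z F \<subseteq> submod_hull H U F"
    by (rule hull_minimal[OF submod_submod_hull assms(2) hull_superset(2)])
  show "submod_hull H U F \<subseteq> submod_hull H Z F"
    using hull_superset(1)[of Z H F] assms(1) by (intro hull_minimal[OF submod_submod_hull _ hull_superset(2)]) auto
qed

lemma subspace_sum_set:
  assumes "subspace A" "subspace B"
  shows "subspace {v + w | v w. v \<in> A \<and> w \<in> B}" (is "subspace ?S")
proof (rule subspaceI)
  show "0 \<in> ?S" using subspace_0[OF assms(1)] subspace_0[OF assms(2)] by force
  fix x y assume "x \<in> ?S" "y \<in> ?S"
  then obtain v w v' w' where *: "x = v + w" "y = v' + w'" "v \<in> A" "v' \<in> A" "w \<in> B" "w' \<in> B" by blast
  then have "x + y = (v + v') + (w + w')" by (simp add: algebra_simps)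
  then show "x + y \<in> ?S" using * subspace_add[OF assms(1)] subspace_add[OF assms(2)] by blast
next
  fix r x assume "x \<in> ?S"
  then show "scale r x \<in> ?S"
    using scale_right_distrib subspace_scale[OF assms(1)] subspace_scale[OF assms(2)] by blast
qed

text \<open>Stability under \<open>H\<close> comes from normality:
  \<open>h y = y (y^-1 h y)\<close>, and the conjugate lies in \<open>H\<close>.\<close>

lemma submod_sum:
  assumes "H \<lhd> G" "y \<in> carrier G" "submod H Y" "submod H B"
  shows "submod H {v + T y b | v b. v \<in> Y \<and> b \<in> B}" (is "submod H ?S")
proof -
  interpret H: normal H G by fact
  note Y = submodD[OF assms(3)] and B = submodD[OF assms(4)]
  have Y_sub: "Y \<subseteq> ?S" using T_zero[OF assms(2)] subspace_0[OF B(2)] by force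
  have "subspace ?S"
  proof (rule subspaceI)
    show "0 \<in> ?S" using Y_sub subspace_0[OF Y(2)] by blast
    fix a c assume "a \<in> ?S" "c \<in> ?S"
    then obtain v b v' b' where vb: "a = v + T y b" "c = v' + T y b'" "v \<in> Y" "b \<in> B" "v' \<in> Y" "b' \<in> B"
      by blast
    then have "a + c = (v + v') + T y (b + b')" using T_add[OF assms(2)] by (simp add: algebra_simps)
    then show "a + c \<in> ?S" using vb subspace_add[OF Y(2)] subspace_add[OF B(2)] by blast
  next
    fix r a assume "a \<in> ?S"
    then obtain v b where vb: "a = v + T y b" "v \<in> Y" "b \<in> B" by blast
    \<comment> \<open>The failure of \<open>T y\<close> to commute with \<open>r\<close> lies in
      \<open>L\<close>, hence in \<open>Y\<close>, and is absorbed by the first summand.\<close>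
    have "scale r a = (scale r v - (T y (scale r b) - scale r (T y b))) + T y (scale r b)"
      using vb by (simp add: scale_right_distrib)
    moreover have "scale r v - (T y (scale r b) - scale r (T y b)) \<in> Y"
      by (rule subspace_diff[OF Y(2) subspace_scale[OF Y(2) vb(2)] subsetD[OF Y(1) T_scale[OF assms(2)]]])
    ultimately show "scale r a \<in> ?S" using subspace_scale[OF B(2) vb(3)] by blast
  qed
  moreover have "T h a \<in> ?S" if h: "h \<in> H" and a: "a \<in> ?S" for h a
  proof -
    obtain v b where vb: "a = v + T y b" "v \<in> Y" "b \<in> B" using a by blast
    have h': "inv y \<otimes> h \<otimes> y \<in> H" using assms(2) h by (rule H.inv_op_closed1)
    have "T h (T y b) = T y (T (inv y \<otimes> h \<otimes> y) b)"
      using assms(2) h by (simp add: word_simps flip: T_mult)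
    then have "T h a = T h v + T y (T (inv y \<otimes> h \<otimes> y) b)" using vb h T_add by simp
    then show ?thesis using Y(3)[OF h vb(2)] B(3)[OF h' vb(3)] by blast
  qed
  ultimately show ?thesis using Y_sub Y(1) unfolding submod_def by blast
qed

lemma submod_preimage:
  assumes "H \<lhd> G" "y \<in> carrier G" "submod H Y"
  shows "submod H {v. T y v \<in> Y}"
proof -
  interpret H: normal H G by fact
  note Y = submodD[OF assms(3)]
  have "subspace {v. T y v \<in> Y}"
    by (rule subspaceI)
      (auto simp: T_zero T_add assms(2) submod_scale_iff[OF assms(3,2)]
        subspace_0[OF Y(2)] subspace_add[OF Y(2)] subspace_scale[OF Y(2)])
  moreover have "T y (T h v) \<in> Y" if "h \<in> H" "T y v \<in> Y" for h v
  proof -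
    have "T y (T h v) = T (y \<otimes> h \<otimes> inv y) (T y v)"
      using assms(2) that by (simp add: word_simps flip: T_mult)
    then show ?thesis using Y(3)[OF H.inv_op_closed2[OF assms(2) that(1)] that(2)] by simp
  qed
  ultimately show ?thesis using Y(1) T_L[OF assms(2)] by (auto simp: submod_def)
qed

lemma submod_Int: "submod H A \<Longrightarrow> submod H B \<Longrightarrow> submod H (A \<inter> B)"
  by (auto simp: submod_def subspace_inter)

lemma submod_Union_incseq:
  assumes "\<And>n. submod H (Z n)" "incseq Z"
  shows "submod H (\<Union>n. Z n)"
proof -
  note Z = submodD[OF assms(1)]
  have "subspace (\<Union>n. Z n)"
  proof (rule subspaceI)
    show "0 \<in> (\<Union>n. Z n)" using subspace_0[OF Z(2)] by auto
    fix a b assume "a \<in> (\<Union>n. Z n)" "b \<in> (\<Union>n. Z n)"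
    then obtain m n where "a \<in> Z m" "b \<in> Z n" by auto
    then have "a \<in> Z (max m n)" "b \<in> Z (max m n)"
      using incseqD[OF assms(2), of _ "max m n"] by (meson max.cobounded1 max.cobounded2 subsetD)+
    then show "a + b \<in> (\<Union>n. Z n)" using subspace_add[OF Z(2)] by blast
  qed (use subspace_scale[OF Z(2)] in blast)
  then show ?thesis using Z by (fastforce simp: submod_def)
qed

subsection \<open>Admissible scalars\<close>

text \<open>Reducedness is what the argument retains of generic freeness: a quotient \<open>V/U\<close> that is free
  after inverting \<open>s\<close> has it, and it passes to extensions and unions without a choice of bases.\<close>

definition admissible :: "'r \<Rightarrow> 'r \<Rightarrow> bool" where
  "admissible s p \<longleftrightarrow> p \<notin> P \<and> (\<exists>a b. a * p + b * s - 1 \<in> P) \<and> (\<forall>a. a * p - 1 \<notin> P)"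

definition reduced :: "'r \<Rightarrow> 'v set \<Rightarrow> 'v set \<Rightarrow> bool" where
  "reduced s U V \<longleftrightarrow> (\<forall>p. admissible s p \<longrightarrow> (\<forall>v\<in>V. scale p v \<in> U \<longrightarrow> v \<in> U) \<and>
     ((\<forall>v\<in>V. \<exists>w\<in>V. v - scale p w \<in> U) \<longrightarrow> (\<forall>v\<in>V. \<exists>k. scale (s ^ k) v \<in> U)))"

text \<open>Comaximality with \<open>s * t\<close> implies comaximality with \<open>s\<close>, so a
  multiple of \<open>s\<close> admits fewer scalars, and it also weakens the torsion condition.
  Hence finitely many parameters may be replaced by their product.\<close>

lemma reduced_mono:
  assumes "subspace U" "reduced s U V"
  shows "reduced (s * t) U V"
  unfolding reduced_def
proof (intro allI impI)
  fix p assume p: "admissible (s * t) p"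
  then obtain a b where "a * p + (b * t) * s - 1 \<in> P" by (auto simp: admissible_def ac_simps)
  then have "admissible s p" using p unfolding admissible_def by blast
  moreover have "scale ((s * t) ^ k) v \<in> U" if "scale (s ^ k) v \<in> U" for k v
    using subspace_scale[OF assms(1) that, of "t ^ k"]
    by (simp add: power_mult_distrib mult.commute)
  ultimately show "(\<forall>v\<in>V. scale p v \<in> U \<longrightarrow> v \<in> U) \<and>
     ((\<forall>v\<in>V. \<exists>w\<in>V. v - scale p w \<in> U) \<longrightarrow> (\<forall>v\<in>V. \<exists>k. scale ((s * t) ^ k) v \<in> U))"
    using assms(2) unfolding reduced_def by blast
qed

lemma reduced_trans:
  assumes "subspace U" "subspace W" "U \<subseteq> W" "W \<subseteq> V" "reduced s U W" "reduced s W V"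
  shows "reduced s U V"
  unfolding reduced_def
proof (intro allI impI conjI ballI)
  fix p assume p: "admissible s p"
  have inj1: "w \<in> U" if "w \<in> W" "scale p w \<in> U" for w using assms(5) p that unfolding reduced_def by blast
  have inj2: "w \<in> W" if "w \<in> V" "scale p w \<in> W" for w using assms(6) p that unfolding reduced_def by blast
  show "v \<in> U" if "v \<in> V" "scale p v \<in> U" for v using inj1 inj2 that assms(3) by blast
  assume div: "\<forall>v\<in>V. \<exists>w\<in>V. v - scale p w \<in> U"
  fix v assume v: "v \<in> V"
  have "\<forall>v\<in>V. \<exists>w\<in>V. v - scale p w \<in> W" using div assms(3) by blast
  then obtain k where k: "scale (s ^ k) v \<in> W" using assms(6) p v unfolding reduced_def by blast
  \<comment> \<open>Divisibility descends from \<open>V\<close> to \<open>W\<close>: the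
    \<open>w\<close> found in \<open>V\<close> has \<open>p w\<close> in \<open>W\<close>, and
    injectivity of \<open>p\<close> on \<open>V/W\<close> brings it back into
    \<open>W\<close>.\<close>
  have "\<forall>v\<in>W. \<exists>w\<in>W. v - scale p w \<in> U"
  proof
    fix v assume vW: "v \<in> W"
    then obtain w where w: "w \<in> V" "v - scale p w \<in> U" using div assms(4) by blast
    then have "scale p w \<in> W" using subspace_diff[OF assms(2) vW, of "v - scale p w"] assms(3) by auto
    then show "\<exists>w\<in>W. v - scale p w \<in> U" using w inj2 by blast
  qed
  then obtain j where "scale (s ^ j) (scale (s ^ k) v) \<in> U"
    using assms(5) p k unfolding reduced_def by blast
  then have "scale (s ^ (j + k)) v \<in> U" by (simp add: power_add)
  then show "\<exists>k. scale (s ^ k) v \<in> U" by blast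
qed

text \<open>Injectivity on the factors makes divisibility hold in every \<open>Z n\<close>
  separately, and torsion is then pushed down one factor at a time. The exponent grows with
  \<open>n\<close>, which is why \<open>reduced\<close> lets it depend on the element.\<close>

lemma reduced_Union:
  assumes sub: "\<And>n. subspace (Z n)" and inc: "incseq Z"
    and red: "\<And>n. reduced s (Z n) (Z (Suc n))"
  shows "reduced s (Z 0) (\<Union>n. Z n)"
  unfolding reduced_def
proof (intro allI impI conjI ballI)
  fix p assume p: "admissible s p"
  have inj: "w \<in> Z m" if "w \<in> Z n" "scale p w \<in> Z m" for w m n
  proof (cases "n \<le> m")
    case True then show ?thesis using inc that by (auto simp: incseq_def)
  next
    case False
    then have "m \<le> n" by simp
    then show ?thesis using that(1)
    proof (induction n rule: dec_induct)
      case (step n)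
      then have "scale p w \<in> Z n" using that(2) inc by (auto simp: incseq_def)
      then show ?case using red[of n] p step unfolding reduced_def by blast
    qed
  qed
  show "v \<in> Z 0" if "v \<in> (\<Union>n. Z n)" "scale p v \<in> Z 0" for v using inj that by blast
  assume div: "\<forall>v\<in>\<Union>n. Z n. \<exists>w\<in>\<Union>n. Z n. v - scale p w \<in> Z 0"
  have div': "\<exists>w\<in>Z n. v - scale p w \<in> Z 0" if v: "v \<in> Z n" for v n
  proof -
    obtain w m where w: "w \<in> Z m" "v - scale p w \<in> Z 0" using div v by blast
    then have "v - scale p w \<in> Z n" using inc by (auto simp: incseq_def)
    then have "scale p w \<in> Z n" using subspace_diff[OF sub v] by force
    then show ?thesis using inj w by blast
  qed
  have "\<exists>k. scale (s ^ k) v \<in> Z 0" if "v \<in> Z n" for v n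
    using that
  proof (induction n arbitrary: v)
    case 0 then show ?case by (auto intro!: exI[of _ 0])
  next
    case (Suc n)
    have "Z 0 \<subseteq> Z n" using inc by (simp add: incseq_def)
    then have "\<forall>v\<in>Z (Suc n). \<exists>w\<in>Z (Suc n). v - scale p w \<in> Z n" using div' by blast
    then obtain k where "scale (s ^ k) v \<in> Z n" using red[of n] p Suc.prems unfolding reduced_def by blast
    then obtain j where "scale (s ^ j) (scale (s ^ k) v) \<in> Z 0" using Suc.IH by blast
    then have "scale (s ^ (j + k)) v \<in> Z 0" by (simp add: power_add)
    then show ?case by blast
  qed
  then show "\<exists>k. scale (s ^ k) v \<in> Z 0" if "v \<in> (\<Union>n. Z n)" for v using that by blast
qed

text \<open>Modulo \<open>L\<close> the operator \<open>T y\<close> is linear over the scalars and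
  induces an isomorphism from \<open>B\<close> modulo the part that it sends into \<open>Y\<close>
  onto the factor \<open>?S/Y\<close>. Reducedness is transported along it.\<close>

lemma reduced_sum:
  assumes "H \<lhd> G" "y \<in> carrier G" "submod H Y" "submod H B"
    and red: "reduced s {b \<in> B. T y b \<in> Y} B"
  shows "reduced s Y {v + T y b | v b. v \<in> Y \<and> b \<in> B}" (is "reduced s Y ?S")
  unfolding reduced_def
proof (intro allI impI conjI ballI)
  note Y = submodD[OF assms(3)] and B = submodD[OF assms(4)]
  note sc = submod_scale_iff[OF assms(3,2)]
  have add_iff: "a + c \<in> Y \<longleftrightarrow> c \<in> Y" if "a \<in> Y" for a c
    using that subspace_add[OF Y(2)] subspace_diff[OF Y(2)] by (metis add_diff_cancel_left')
  fix p assume p: "admissible s p"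
  show "v \<in> Y" if v: "v \<in> ?S" "scale p v \<in> Y" for v
  proof -
    obtain u b where ub: "v = u + T y b" "u \<in> Y" "b \<in> B" using v(1) by blast
    then have "scale p (T y b) \<in> Y"
      using v(2) add_iff[OF subspace_scale[OF Y(2) ub(2)]] by (simp add: scale_right_distrib)
    then have "scale p b \<in> {b \<in> B. T y b \<in> Y}" using sc subspace_scale[OF B(2) ub(3)] by simp
    then have "T y b \<in> Y" using red p ub(3) unfolding reduced_def by blast
    then show ?thesis using ub subspace_add[OF Y(2)] by simp
  qed
  assume div: "\<forall>v\<in>?S. \<exists>w\<in>?S. v - scale p w \<in> Y"
  have "\<forall>b\<in>B. \<exists>c\<in>B. b - scale p c \<in> {b \<in> B. T y b \<in> Y}"
  proof
    fix b assume b: "b \<in> B"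
    have "T y b \<in> ?S" using b subspace_0[OF Y(2)] by force
    then obtain u c where uc: "u \<in> Y" "c \<in> B" "T y b - scale p (u + T y c) \<in> Y" using div by blast
    have "T y b - T y (scale p c) \<in> Y"
    proof -
      have "T y b - T y (scale p c) = (T y b - scale p (u + T y c)) + scale p u
          - (T y (scale p c) - scale p (T y c))"
        by (simp add: scale_right_distrib)
      then show ?thesis
        using uc(3) subspace_scale[OF Y(2) uc(1)] T_scale[OF assms(2)] Y(1)
        by (metis subspace_add[OF Y(2)] subspace_diff[OF Y(2)] subsetD)
    qed
    then have "b - scale p c \<in> {b \<in> B. T y b \<in> Y}"
      using b uc(2) subspace_diff[OF B(2)] subspace_scale[OF B(2)] T_diff[OF assms(2)] by auto
    then show "\<exists>c\<in>B. b - scale p c \<in> {b \<in> B. T y b \<in> Y}" using uc(2) by blast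
  qed
  then have tors: "\<exists>k. scale (s ^ k) b \<in> {b \<in> B. T y b \<in> Y}" if "b \<in> B" for b
    using red p that unfolding reduced_def by blast
  fix v assume "v \<in> ?S"
  then obtain u b where ub: "v = u + T y b" "u \<in> Y" "b \<in> B" by blast
  then obtain k where "scale (s ^ k) b \<in> {b \<in> B. T y b \<in> Y}" using tors by blast
  then have "scale (s ^ k) (T y b) \<in> Y" using sc by simp
  then have "scale (s ^ k) v \<in> Y"
    using ub subspace_scale[OF Y(2) ub(2)] subspace_add[OF Y(2)] by (simp add: scale_right_distrib)
  then show "\<exists>k. scale (s ^ k) v \<in> Y" by blast
qed

text \<open>Stated relative to a base and a finite set because a module that is finitely generated
  over \<open>G\<close> is in general not finitely generated over the smaller groups
  \<open>H\<close> of the induction.\<close>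

definition noetherian_over :: "'g set \<Rightarrow> bool" where
  "noetherian_over H \<longleftrightarrow> (\<forall>U F. submod H U \<longrightarrow> finite F \<longrightarrow>
     acc_on (\<lambda>W. submod H W \<and> U \<subseteq> W \<and> W \<subseteq> submod_hull H U F))"

definition generically_reduced :: "'g set \<Rightarrow> bool" where
  "generically_reduced H \<longleftrightarrow> (\<forall>U F. submod H U \<longrightarrow> finite F \<longrightarrow>
     (\<exists>s. s \<notin> P \<and> reduced s U (submod_hull H U F)))"

subsection \<open>Trivial action\<close>

context
  fixes H
  assumes H: "H \<subseteq> carrier G" and H_trivial: "\<And>h v. h \<in> H \<Longrightarrow> T h v - v \<in> L"
begin

lemma submod_trivial_iff: "submod H W \<longleftrightarrow> L \<subseteq> W \<and> subspace W"
proof -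
  have "T h w \<in> W" if "L \<subseteq> W" "subspace W" "h \<in> H" "w \<in> W" for h w
    using subspace_add[OF that(2), of "T h w - w" w] H_trivial[OF that(3)] that by auto
  then show ?thesis by (auto simp: submod_def)
qed

lemma submod_hull_empty: "submod H U \<Longrightarrow> submod_hull H U {} = U"
  by (auto simp: submod_hull_def)

lemma submod_hull_insert_trivial:
  assumes "submod H U"
  shows "submod_hull H U (insert b F) = {w + scale r b | w r. w \<in> submod_hull H U F}" (is "_ = ?S")
proof
  let ?W = "submod_hull H U F"
  note W = submodD[OF submod_submod_hull[of H U F]]
  have "subspace ?S"
  proof (rule subspaceI)
    show "0 \<in> ?S" using subspace_0[OF W(2)] by (auto intro!: exI[of _ 0])
    fix x y assume "x \<in> ?S" "y \<in> ?S"
    then obtain w r w' r' where "x = w + scale r b" "y = w' + scale r' b" "w \<in> ?W" "w' \<in> ?W" by blast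
    then have "x + y = (w + w') + scale (r + r') b" "w + w' \<in> ?W"
      using subspace_add[OF W(2)] by (simp_all add: scale_left_distrib)
    then show "x + y \<in> ?S" by blast
  next
    fix c x assume "x \<in> ?S"
    then obtain w r where "x = w + scale r b" "w \<in> ?W" by blast
    then have "scale c x = scale c w + scale (c * r) b" "scale c w \<in> ?W"
      using subspace_scale[OF W(2)] by (simp_all add: scale_right_distrib)
    then show "scale c x \<in> ?S" by blast
  qed
  moreover have WS: "?W \<subseteq> ?S"
  proof
    fix w assume "w \<in> ?W"
    moreover have "w = w + scale 0 b" by simp
    ultimately show "w \<in> ?S" by blast
  qed
  ultimately have "submod H ?S" using W(1) by (simp add: submod_trivial_iff)
  moreover have "0 + scale 1 b \<in> ?S" using subspace_0[OF W(2)] by blast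
  then have "b \<in> ?S" by simp
  ultimately show "submod_hull H U (insert b F) \<subseteq> ?S"
    using WS hull_superset(1)[of U H F] hull_superset(2)[of F H U]
    by (intro hull_minimal) (auto simp del: mem_Collect_eq)
  note V = submodD[OF submod_submod_hull[of H U "insert b F"]]
  have "?W \<subseteq> submod_hull H U (insert b F)"
    using hull_superset[of U H "insert b F"] hull_superset(2)[of "insert b F" H U]
    by (intro hull_minimal submod_submod_hull) auto
  moreover have "b \<in> submod_hull H U (insert b F)"
    using hull_superset(2)[of "insert b F" H U] by auto
  ultimately show "?S \<subseteq> submod_hull H U (insert b F)"
    using subspace_add[OF V(2)] subspace_scale[OF V(2)] by blast
qed

lemma ring_ideal_transporter:
  assumes "subspace W"
  shows "ring_ideal {r. scale r b \<in> W}"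
  using subspace_0[OF assms] subspace_add[OF assms] subspace_scale[OF assms]
  by (simp add: ring_ideal_def scale_left_distrib flip: scale_scale)

text \<open>Submodules are plain subspaces here, so this is the usual induction on generators: a
  chain is controlled by its intersection with the hull of fewer generators and by the ideal of
  coefficients of the new generator \<open>b\<close>.\<close>

lemma noetherian_over_trivial: "noetherian_over H"
  unfolding noetherian_over_def
proof (intro allI impI)
  fix U F :: "'v set" assume U: "submod H U" and "finite F"
  from \<open>finite F\<close> show "acc_on (\<lambda>W. submod H W \<and> U \<subseteq> W \<and> W \<subseteq> submod_hull H U F)"
  proof (induction F rule: finite_induct)
    case empty
    have "N i = U" if "\<forall>i. submod H (N i) \<and> U \<subseteq> N i \<and> N i \<subseteq> submod_hull H U {}" for N :: "nat \<Rightarrow> 'v set" and i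
      using that submod_hull_empty[OF U] by auto
    then show ?case unfolding acc_on_def by metis
  next
    case (insert b F)
    let ?W = "submod_hull H U F"
    show ?case unfolding acc_on_def
    proof (intro allI impI)
      fix N :: "nat \<Rightarrow> 'v set"
      assume *: "\<forall>i. submod H (N i) \<and> U \<subseteq> N i \<and> N i \<subseteq> submod_hull H U (insert b F)" and inc: "incseq N"
      then have N: "submod H (N i)" "U \<subseteq> N i" "N i \<subseteq> submod_hull H U (insert b F)" for i by auto
      have "submod H (N i \<inter> ?W) \<and> U \<subseteq> N i \<inter> ?W \<and> N i \<inter> ?W \<subseteq> ?W" for i
        using N hull_superset(1) by (auto intro: submod_Int submod_submod_hull)
      moreover have "incseq (\<lambda>i. N i \<inter> ?W)" using inc by (auto simp: incseq_def)
      ultimately obtain n1 where n1: "\<And>m. m \<ge> n1 \<Longrightarrow> N m \<inter> ?W = N n1 \<inter> ?W"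
        using acc_onD[OF insert.IH, of "\<lambda>i. N i \<inter> ?W"] by blast
      define S where "S i = {v + T \<one> w | v w. v \<in> N i \<and> w \<in> ?W}" for i
      have S: "subspace (S i)" for i
        unfolding S_def T_one by (rule subspace_sum_set[OF submodD(2)[OF N(1)] submodD(2)[OF submod_submod_hull]])
      define I where "I i = {r. scale r b \<in> S i}" for i
      have "incseq I" using inc by (fastforce simp: I_def S_def incseq_def)
      then obtain n2 where n2: "\<And>m. m \<ge> n2 \<Longrightarrow> I m = I n2"
        using acc_onD[OF acc_scalars, of I] ring_ideal_transporter[OF S] unfolding I_def by metis
      define n where "n = max n1 n2"
      have "N m \<subseteq> N n" if m: "m \<ge> n" for m
      proof
        fix x assume x: "x \<in> N m"
        then obtain w r where wr: "x = w + scale r b" "w \<in> ?W"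
          using N(3)[of m] submod_hull_insert_trivial[OF U] by blast
        have "- w \<in> ?W" using subspace_neg[OF submodD(2)[OF submod_submod_hull] wr(2)] .
        then have "x + T \<one> (- w) \<in> S m" using x unfolding S_def by blast
        then have "r \<in> I m" using wr by (simp add: I_def T_one)
        then have "r \<in> I n" using n2[of m] n2[of n] m by (simp add: n_def)
        then obtain v w' where v: "scale r b = v + w'" "v \<in> N n" "w' \<in> ?W"
          by (auto simp: I_def S_def T_one)
        have vm: "v \<in> N m" using v(2) incseqD[OF inc m] by auto
        have "x - v = w + w'" using v(1) wr(1) by simp
        then have "x - v \<in> N m \<inter> ?W"
          using subspace_diff[OF submodD(2)[OF N(1)] x vm]
            subspace_add[OF submodD(2)[OF submod_submod_hull] wr(2) v(3)] by simp
        then have "x - v \<in> N n" using n1[of m] n1[of n] m by (auto simp: n_def)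
        then show "x \<in> N n" using subspace_add[OF submodD(2)[OF N(1)] _ v(2)] by force
      qed
      then have "N m = N n" if "m \<ge> n" for m using that incseqD[OF inc that] by auto
      then show "\<exists>n. \<forall>m\<ge>n. N m = N n" by blast
    qed
  qed
qed

text \<open>Adjoining one generator \<open>b\<close> adds a factor isomorphic to the scalars modulo
  \<open>I\<close>, where \<open>I\<close> transports \<open>b\<close> into the smaller hull. Either
  this is the domain modulo \<open>P\<close> itself, or one scalar outside \<open>P\<close> kills
  it.\<close>

lemma generically_reduced_trivial: "generically_reduced H"
  unfolding generically_reduced_def
proof (intro allI impI)
  fix U F :: "'v set" assume U: "submod H U" and "finite F"
  from \<open>finite F\<close> show "\<exists>s. s \<notin> P \<and> reduced s U (submod_hull H U F)"
  proof (induction F rule: finite_induct)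
    case empty
    have "\<exists>k. scale (1 ^ k) v \<in> U" if "v \<in> U" for v using that by simp
    then have "reduced 1 U (submod_hull H U {})"
      unfolding submod_hull_empty[OF U] reduced_def by blast
    then show ?case using P_one by blast
  next
    case (insert b F)
    let ?W = "submod_hull H U F"
    let ?V = "submod_hull H U (insert b F)"
    note W = submodD[OF submod_submod_hull[of H U F]]
    note V_eq = submod_hull_insert_trivial[OF U]
    define I where "I = {r. scale r b \<in> ?W}"
    have I: "ring_ideal I" unfolding I_def by (rule ring_ideal_transporter[OF W(2)])
    have mem_iff: "w + scale r b \<in> ?W \<longleftrightarrow> r \<in> I" if "w \<in> ?W" for w r
      using that subspace_add[OF W(2)] subspace_diff[OF W(2)] unfolding I_def
      by (metis add_diff_cancel_left' mem_Collect_eq)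
    have "\<exists>t. t \<notin> P \<and> reduced t ?W ?V"
    proof (cases "I \<subseteq> P")
      \<comment> \<open>Since \<open>P\<close> kills everything modulo \<open>L\<close>, here
        \<open>I = P\<close>. Then \<open>s = 1\<close> works: \<open>p\<close> is nonzero in a
        domain, hence injective, and surjectivity would make it a unit, which admissibility
        excludes.\<close>
      case True
      have "reduced 1 ?W ?V"
        unfolding reduced_def
      proof (intro allI impI conjI ballI)
        fix p assume p: "admissible 1 p"
        show "v \<in> ?W" if v: "v \<in> ?V" "scale p v \<in> ?W" for v
        proof -
          obtain w r where wr: "v = w + scale r b" "w \<in> ?W" using v(1) V_eq by blast
          then have "scale p w + scale (p * r) b \<in> ?W" using v(2) by (simp add: scale_right_distrib)
          then have "p * r \<in> P" using mem_iff[OF subspace_scale[OF W(2) wr(2)]] True by blast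
          then have "r \<in> P" using P_prime p by (auto simp: admissible_def)
          then have "scale r b \<in> ?W" using P_scale W(1) by blast
          then show ?thesis using wr subspace_add[OF W(2)] by simp
        qed
        assume div: "\<forall>v\<in>?V. \<exists>w\<in>?V. v - scale p w \<in> ?W"
        have "0 + scale 1 b \<in> ?V" unfolding V_eq using subspace_0[OF W(2)] by blast
        then obtain v where v: "v \<in> ?V" "scale 1 b - scale p v \<in> ?W" using div by fastforce
        then obtain w r where wr: "v = w + scale r b" "w \<in> ?W" using V_eq by blast
        then have "scale 1 b - scale p v = - scale p w + scale (1 - r * p) b"
          by (simp add: scale_right_distrib scale_left_diff_distrib mult.commute)
        then have "1 - r * p \<in> I"
          using v(2) mem_iff[OF subspace_neg[OF W(2) subspace_scale[OF W(2) wr(2)]]] by metis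
        then have "- (1 - r * p) \<in> P" using ring_idealD(5)[OF I] True by blast
        then have "r * p - 1 \<in> P" by simp
        then show "\<exists>k. scale (1 ^ k) x \<in> ?W" for x using p by (auto simp: admissible_def)
      qed
      then show ?thesis using P_one by blast
    next
      case False
      then obtain t where t: "t \<in> I" "t \<notin> P" by blast
      \<comment> \<open>As \<open>t\<close> kills the factor, the torsion condition holds with
        exponent \<open>1\<close>, and comaximality with \<open>t\<close> makes \<open>p\<close>
        injective on it.\<close>
      have "reduced t ?W ?V"
        unfolding reduced_def
      proof (intro allI impI conjI ballI)
        fix p assume p: "admissible t p"
        show "v \<in> ?W" if v: "v \<in> ?V" "scale p v \<in> ?W" for v
        proof -
          obtain w r where wr: "v = w + scale r b" "w \<in> ?W" using v(1) V_eq by blast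
          then have "scale p w + scale (p * r) b \<in> ?W" using v(2) by (simp add: scale_right_distrib)
          then have pr: "p * r \<in> I" using mem_iff[OF subspace_scale[OF W(2) wr(2)]] by blast
          obtain a c where ac: "a * p + c * t - 1 \<in> P" using p by (auto simp: admissible_def)
          have "(a * p + c * t - 1) * r \<in> I"
            using P_scale[of "(a * p + c * t - 1) * r" b] ring_idealD(4)[OF P_ideal ac] W(1)
            by (auto simp: I_def)
          then have "a * (p * r) + (c * r) * t - (a * p + c * t - 1) * r \<in> I"
            by (rule ring_idealD(6)[OF I ring_idealD(2)[OF I ring_idealD(3)[OF I pr] ring_idealD(3)[OF I t(1)]]])
          then have "r \<in> I" by (simp add: algebra_simps)
          then show ?thesis using wr mem_iff by blast
        qed
        fix v assume "v \<in> ?V"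
        then obtain w r where wr: "v = w + scale r b" "w \<in> ?W" using V_eq by blast
        then have "scale (t ^ 1) v = scale t w + scale (t * r) b" by (simp add: scale_right_distrib)
        then have "scale (t ^ 1) v \<in> ?W"
          using mem_iff[OF subspace_scale[OF W(2) wr(2)]] ring_idealD(4)[OF I t(1)] by metis
        then show "\<exists>k. scale (t ^ k) v \<in> ?W" by blast
      qed
      then show ?thesis using t by blast
    qed
    then obtain t where t: "t \<notin> P" "reduced t ?W ?V" by blast
    obtain s where s: "s \<notin> P" "reduced s U ?W" using insert.IH by blast
    have U': "subspace U" "U \<subseteq> ?W" using submodD(2)[OF U] hull_superset(1) by auto
    have "?W \<subseteq> ?V"
      using hull_superset(1)[of U H "insert b F"] hull_superset(2)[of "insert b F" H U]
      by (intro hull_minimal submod_submod_hull) auto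
    then have "reduced (s * t) U ?V"
      using reduced_trans[OF U'(1) W(2) U'(2) _ reduced_mono[OF U'(1) s(2)]]
        reduced_mono[OF W(2) t(2), of s] mult.commute[of t s] by simp
    then show ?case using P_prime s t by blast
  qed
qed

end

subsection \<open>Cyclic extensions\<close>

context
  fixes H H' x
  assumes H: "H \<lhd> G" and x: "x \<in> carrier G" and H'_eq: "H' = generate G (insert x H)"
begin

lemma H_subset: "H \<subseteq> carrier G"
  using subgroup.subset[OF normal_imp_subgroup[OF H]] .

lemma submod_generate_iff:
  "submod H' W \<longleftrightarrow> submod H W \<and> (\<forall>w\<in>W. T x w \<in> W \<and> T (inv x) w \<in> W)"
proof
  assume W: "submod H' W"
  have "h \<in> H'" if "h \<in> H" for h using that unfolding H'_eq by (auto intro: generate.incl)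
  moreover have "x \<in> H'" "inv x \<in> H'" unfolding H'_eq by (auto intro: generate.incl generate.inv)
  ultimately show "submod H W \<and> (\<forall>w\<in>W. T x w \<in> W \<and> T (inv x) w \<in> W)"
    using W by (simp add: submod_def)
next
  assume W: "submod H W \<and> (\<forall>w\<in>W. T x w \<in> W \<and> T (inv x) w \<in> W)"
  have "h \<in> carrier G \<and> (\<forall>w\<in>W. T h w \<in> W)" if "h \<in> H'" for h
    using that unfolding H'_eq
  proof (induction rule: generate.induct)
    case (inv h)
    then show ?case
      using W x H_subset subgroup.m_inv_closed[OF normal_imp_subgroup[OF H]] by (auto simp: submod_def)
  qed (use W x H_subset in \<open>auto simp: T_one T_mult submod_def\<close>)
  then show "submod H' W" using W by (auto simp: submod_def)
qed

text \<open>As for Laurent polynomials in Hilbert's basis theorem, the submodule generated over \<open>H'\<close> is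
  filtered by first adjoining the positive powers of \<open>x\<close> to \<open>B\<close> one at a time, then the negative ones.\<close>

context
  fixes U F B :: "'v set"
  assumes U: "submod H' U" and F: "finite F" and B_eq: "B = submod_hull H U F"
begin

primrec positive_part :: "nat \<Rightarrow> 'v set" where
  "positive_part 0 = U"
| "positive_part (Suc n) = {v + T (x [^] n) b | v b. v \<in> positive_part n \<and> b \<in> B}"

definition V_plus :: "'v set" where
  "V_plus = (\<Union>n. positive_part n)"

text \<open>The translate of \<open>V_plus\<close> by the inverse of \<open>x [^] k\<close>, written
  as a preimage.\<close>

definition shifted :: "nat \<Rightarrow> 'v set" where
  "shifted k = {v. T (x [^] k) v \<in> V_plus}"

lemma B_submod: "submod H B" "U \<subseteq> B" "F \<subseteq> B"
  unfolding B_eq by (rule submod_submod_hull hull_superset)+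

lemma positive_part_subset_V_plus: "positive_part n \<subseteq> V_plus"
  by (auto simp: V_plus_def)

lemma U_H: "submod H U"
  using U by (simp add: submod_generate_iff)

lemma T_pow_Suc: "T (x [^] Suc n) v = T x (T (x [^] n) v)" "T (x [^] Suc n) v = T (x [^] n) (T x v)"
proof -
  show "T (x [^] Suc n) v = T (x [^] n) (T x v)" using x by (simp add: T_mult)
  have "x [^] Suc n = x \<otimes> x [^] n" using x by (rule nat_pow_Suc2)
  then show "T (x [^] Suc n) v = T x (T (x [^] n) v)" using x by (simp add: T_mult del: nat_pow_Suc)
qed

lemma T_pow_invariant:
  assumes "submod H' W" "w \<in> W"
  shows "T (x [^] (n::nat)) w \<in> W"
proof (induction n)
  case (Suc n)
  then show ?case using assms(1) unfolding T_pow_Suc by (simp add: submod_generate_iff)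
qed (use assms in \<open>simp add: T_one\<close>)

lemma T_inv_pow_invariant:
  assumes "submod H' W" "T (x [^] (n::nat)) w \<in> W"
  shows "w \<in> W"
  using assms(2)
proof (induction n)
  case (Suc n)
  then have "T (inv x) (T x (T (x [^] n) w)) \<in> W"
    using assms(1) unfolding T_pow_Suc by (simp add: submod_generate_iff)
  then show ?case using Suc.IH x by (simp add: T_inv)
qed (use assms in \<open>simp add: T_one\<close>)

lemma positive_part_submod: "submod H (positive_part n)"
proof (induction n)
  case (Suc n)
  have "submod H {v + T (x [^] n) b | v b. v \<in> positive_part n \<and> b \<in> B}"
    by (rule submod_sum[OF H _ Suc B_submod(1)]) (use x in simp)
  then show ?case by simp
qed (simp add: U_H)

lemma positive_part_SucI:
  "v \<in> positive_part n \<Longrightarrow> b \<in> B \<Longrightarrow> v + T (x [^] n) b \<in> positive_part (Suc n)"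
  by auto

lemma positive_part_incseq: "incseq positive_part"
proof (rule incseq_SucI)
  fix n
  have "v + T (x [^] n) 0 \<in> positive_part (Suc n)" if "v \<in> positive_part n" for v
    using that subspace_0[OF submodD(2)[OF B_submod(1)]] by auto
  then show "positive_part n \<subseteq> positive_part (Suc n)" using x by (auto simp: T_zero)
qed

lemma V_plus_submod: "submod H V_plus"
  unfolding V_plus_def using positive_part_submod positive_part_incseq by (rule submod_Union_incseq)

lemma B_subset_V_plus: "B \<subseteq> V_plus"
proof
  fix b assume "b \<in> B"
  moreover have "0 \<in> positive_part 0" using subspace_0[OF submodD(2)[OF U_H]] by simp
  ultimately have "0 + T (x [^] (0::nat)) b \<in> positive_part (Suc 0)" by (rule positive_part_SucI[rotated])
  then show "b \<in> V_plus" using positive_part_subset_V_plus by (auto simp: T_one simp del: positive_part.simps)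
qed

lemma T_positive_part: "v \<in> positive_part n \<Longrightarrow> T x v \<in> positive_part (Suc n)"
proof (induction n arbitrary: v)
  case 0
  then have "T x v \<in> U" using U by (simp add: submod_generate_iff)
  then have "T x v \<in> positive_part 0" by simp
  then show ?case using incseqD[OF positive_part_incseq, of 0 "Suc 0"] by blast
next
  case (Suc n)
  then obtain u b where ub: "v = u + T (x [^] n) b" "u \<in> positive_part n" "b \<in> B" by auto
  then have "T x v = T x u + T (x [^] Suc n) b" unfolding T_pow_Suc using x by (simp add: T_add)
  then show ?case using Suc.IH[OF ub(2)] ub(3) unfolding positive_part.simps(2)[of "Suc n"] by blast
qed

lemma T_V_plus: "v \<in> V_plus \<Longrightarrow> T x v \<in> V_plus"
  using T_positive_part unfolding V_plus_def by blast

text \<open>Splitting off the constant term gives \<open>V_plus = B + x V_plus\<close>. This is what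
  makes \<open>shifted (Suc k)\<close> arise from \<open>shifted k\<close> by adjoining a single
  translate of \<open>B\<close>.\<close>

lemma V_plus_decompose:
  assumes "v \<in> V_plus"
  obtains b w where "v = b + T x w" "b \<in> B" "w \<in> V_plus"
proof -
  note B = submodD[OF B_submod(1)] and Vp = submodD[OF V_plus_submod]
  have "\<exists>b\<in>B. \<exists>w\<in>V_plus. v = b + T x w" if "v \<in> positive_part n" for n
    using that
  proof (induction n arbitrary: v)
    case 0
    then have "v \<in> B" "v = v + T x 0" using B_submod(2) x by (auto simp: T_zero)
    then show ?case using subspace_0[OF Vp(2)] by blast
  next
    case (Suc n)
    then obtain u c where uc: "v = u + T (x [^] n) c" "u \<in> positive_part n" "c \<in> B" by auto
    then obtain b w where bw: "b \<in> B" "w \<in> V_plus" "u = b + T x w" using Suc.IH by blast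
    \<comment> \<open>For \<open>n = 0\<close> the new summand is itself a constant term; otherwise
      one factor \<open>x\<close> is moved out of \<open>x [^] n\<close>.\<close>
    show ?case
    proof (cases n)
      case 0
      then have "v = (b + c) + T x w" using uc bw by (simp add: T_one algebra_simps)
      then show ?thesis using bw subspace_add[OF B(2) bw(1) uc(3)] by blast
    next
      case (Suc m)
      have "0 + T (x [^] m) c \<in> positive_part (Suc m)"
        by (intro positive_part_SucI uc(3) subspace_0[OF submodD(2)[OF positive_part_submod]])
      then have c: "T (x [^] m) c \<in> V_plus"
        using positive_part_subset_V_plus by (auto simp del: positive_part.simps)
      have "v = b + T x (w + T (x [^] m) c)"
        using uc bw x unfolding Suc T_pow_Suc by (simp add: T_add algebra_simps)
      then show ?thesis using bw(1) subspace_add[OF Vp(2) bw(2) c] by blast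
    qed
  qed
  then show ?thesis using assms that unfolding V_plus_def by blast
qed

lemma shifted_submod: "submod H (shifted k)"
  unfolding shifted_def by (rule submod_preimage[OF H _ V_plus_submod]) (use x in simp)

lemma shifted_incseq: "incseq shifted"
  using T_V_plus unfolding incseq_Suc_iff shifted_def T_pow_Suc by blast

lemma shifted_Suc:
  "shifted (Suc k) = {v + T (inv (x [^] Suc k)) b | v b. v \<in> shifted k \<and> b \<in> B}" (is "_ = ?S")
proof
  note Vp = submodD[OF V_plus_submod]
  have c: "x [^] Suc k \<in> carrier G" "x [^] k \<in> carrier G" using x by auto
  show "shifted (Suc k) \<subseteq> ?S"
  proof
    fix v assume "v \<in> shifted (Suc k)"
    then obtain b w where bw: "T (x [^] Suc k) v = b + T x w" "b \<in> B" "w \<in> V_plus"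
      using V_plus_decompose unfolding shifted_def by blast
    define u where "u = v - T (inv (x [^] Suc k)) b"
    have "T (x [^] Suc k) u = T x w"
      unfolding u_def using bw(1) c by (simp add: T_diff T_inv del: nat_pow_Suc)
    then have "T (inv x) (T x (T (x [^] k) u)) = T (inv x) (T x w)" unfolding T_pow_Suc by simp
    then have "T (x [^] k) u = w" using x by (simp add: T_inv)
    then have "u \<in> shifted k" using bw by (simp add: shifted_def)
    moreover have "v = u + T (inv (x [^] Suc k)) b" by (simp add: u_def)
    ultimately show "v \<in> ?S" using bw(2) by blast
  qed
  show "?S \<subseteq> shifted (Suc k)"
  proof
    fix v assume "v \<in> ?S"
    then obtain u b where ub: "v = u + T (inv (x [^] Suc k)) b" "u \<in> shifted k" "b \<in> B" by blast
    then have "T (x [^] Suc k) v = T x (T (x [^] k) u) + b"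
      using c by (simp add: T_add T_inv T_pow_Suc(1)[symmetric] del: nat_pow_Suc)
    moreover have "T x (T (x [^] k) u) + b \<in> V_plus"
      using ub T_V_plus B_subset_V_plus subspace_add[OF Vp(2)] unfolding shifted_def by blast
    ultimately show "v \<in> shifted (Suc k)" by (simp add: shifted_def del: nat_pow_Suc)
  qed
qed

text \<open>Each translate is stable under \<open>x\<close>, and the inverse of \<open>x\<close>
  raises the index by one, so the union is stable under all of \<open>H'\<close>.\<close>

lemma Union_shifted: "(\<Union>k. shifted k) = submod_hull H' U F"
proof
  note hl = submod_submod_hull[of H' U F]
  have hl_H: "submod H (submod_hull H' U F)" using hl by (simp add: submod_generate_iff)
  have B_hull: "B \<subseteq> submod_hull H' U F"
    unfolding B_eq by (rule hull_minimal[OF hl_H hull_superset])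
  have "positive_part n \<subseteq> submod_hull H' U F" for n
  proof (induction n)
    case (Suc n)
    have "v + T (x [^] n) b \<in> submod_hull H' U F" if "v \<in> positive_part n" "b \<in> B" for v b
      using that B_hull Suc T_pow_invariant[OF hl] subspace_add[OF submodD(2)[OF hl]] by blast
    then show ?case by auto
  qed (auto simp: hull_superset)
  then show "(\<Union>k. shifted k) \<subseteq> submod_hull H' U F"
    using T_inv_pow_invariant[OF hl] unfolding shifted_def V_plus_def by blast
  have "T x v \<in> shifted k" if "v \<in> shifted k" for v k
    using that T_V_plus unfolding shifted_def mem_Collect_eq T_pow_Suc(2)[symmetric] T_pow_Suc(1) by blast
  moreover have "T (inv x) v \<in> shifted (Suc k)" if "v \<in> shifted k" for v k
    using that x unfolding shifted_def mem_Collect_eq T_pow_Suc(2) by (simp add: T_inv)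
  ultimately have "submod H' (\<Union>k. shifted k)"
    unfolding submod_generate_iff
    using submod_Union_incseq[OF shifted_submod shifted_incseq] by blast
  moreover have "B \<subseteq> shifted 0" using B_subset_V_plus by (auto simp: shifted_def T_one)
  ultimately show "submod_hull H' U F \<subseteq> (\<Union>k. shifted k)"
    using B_submod by (intro hull_minimal) blast+
qed

text \<open>Here \<open>l n i\<close> collects the leading coefficients, taken in \<open>B\<close>,
  of the elements of \<open>N i\<close> of degree \<open>n\<close> in \<open>x\<close>. These are
  submodules over \<open>H\<close> and grow in both indices.\<close>

lemma acc_cyclic_extension:
  assumes "noetherian_over H"
  shows "acc_on (\<lambda>W. submod H' W \<and> U \<subseteq> W \<and> W \<subseteq> submod_hull H' U F)"
  unfolding acc_on_def
proof (intro allI impI)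
  fix N :: "nat \<Rightarrow> 'v set"
  assume *: "\<forall>i. submod H' (N i) \<and> U \<subseteq> N i \<and> N i \<subseteq> submod_hull H' U F" and inc: "incseq N"
  then have N: "submod H' (N i)" "U \<subseteq> N i" "N i \<subseteq> submod_hull H' U F" for i by auto
  have N_H: "submod H (N i)" for i using N(1) by (simp add: submod_generate_iff)
  \<comment> \<open>Writing the second summand with \<open>T \<one>\<close> makes this an instance
    of \<open>submod_sum\<close>.\<close>
  define S where "S n i = {c + T \<one> w | c w. c \<in> N i \<and> w \<in> positive_part n}" for n i
  have S: "submod H (S n i)" for n i
    unfolding S_def by (rule submod_sum[OF H one_closed N_H positive_part_submod])
  have N_S: "N i \<subseteq> S n i" for n i
  proof
    fix c assume "c \<in> N i"
    then have "c + T \<one> 0 \<in> S n i"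
      unfolding S_def using subspace_0[OF submodD(2)[OF positive_part_submod]] by blast
    then show "c \<in> S n i" by (simp add: T_one)
  qed
  define l where "l n i = B \<inter> {b. T (x [^] n) b \<in> S n i}" for n i
  have l: "submod H (l n i) \<and> U \<subseteq> l n i \<and> l n i \<subseteq> B" for n i
  proof -
    have "U \<subseteq> {b. T (x [^] n) b \<in> S n i}" using T_pow_invariant[OF U] N(2) N_S by blast
    then show ?thesis
      unfolding l_def using x B_submod
      by (auto intro!: submod_Int submod_preimage[OF H _ S])
  qed
  have l_Suc: "l n i \<subseteq> l (Suc n) i" for n i
  proof
    fix b assume b: "b \<in> l n i"
    then obtain c w where cw: "T (x [^] n) b = c + T \<one> w" "c \<in> N i" "w \<in> positive_part n"
      unfolding l_def S_def by blast
    then have "T (x [^] Suc n) b = T x c + T \<one> (T x w)" unfolding T_pow_Suc using x by (simp add: T_add T_one)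
    moreover have "T x c \<in> N i" using N(1) cw(2) by (simp add: submod_generate_iff)
    ultimately have "T (x [^] Suc n) b \<in> S (Suc n) i"
      unfolding S_def using T_positive_part[OF cw(3)] by blast
    then show "b \<in> l (Suc n) i" using b by (simp add: l_def)
  qed
  have "l n i \<subseteq> l n' i'" if "n \<le> n'" "i \<le> i'" for n n' i i'
  proof -
    have "S n i \<subseteq> S n i'" unfolding S_def using incseqD[OF inc that(2)] by blast
    then have "l n i \<subseteq> l n i'" unfolding l_def by blast
    also have "\<dots> \<subseteq> l n' i'" using lift_Suc_mono_le[of "\<lambda>n. l n i'", OF l_Suc that(1)] .
    finally show ?thesis .
  qed
  moreover have "acc_on (\<lambda>W. submod H W \<and> U \<subseteq> W \<and> W \<subseteq> B)"
    using assms U_H F unfolding noetherian_over_def B_eq by blast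
  ultimately obtain i0 where i0: "\<And>i n. i \<ge> i0 \<Longrightarrow> l n i = l n i0"
    using l acc_on_double_chain[of _ l] by (metis (mono_tags, lifting))
  have step: "v \<in> N i0" if "i \<ge> i0" "v \<in> N i" "v \<in> positive_part n" for i v n
    using that(2,3)
  proof (induction n arbitrary: v)
    case 0 then show ?case using N(2) by auto
  next
    case (Suc n)
    note Ni = subspace_diff[OF submodD(2)[OF N(1)]]
    obtain w b where wb: "v = w + T (x [^] n) b" "w \<in> positive_part n" "b \<in> B" using Suc.prems(2) by auto
    have "- w \<in> positive_part n" using subspace_neg[OF submodD(2)[OF positive_part_submod] wb(2)] .
    then have "v + T \<one> (- w) \<in> S n i" using Suc.prems(1) unfolding S_def by blast
    then have "b \<in> l n i" using wb by (simp add: l_def T_one)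
    then have "b \<in> l n i0" using i0[OF that(1)] by blast
    then obtain c w' where cw: "T (x [^] n) b = c + w'" "c \<in> N i0" "w' \<in> positive_part n"
      unfolding l_def S_def T_one by blast
    have "c \<in> N i" using cw(2) incseqD[OF inc that(1)] by blast
    then have "v - c \<in> N i" by (rule Ni[OF Suc.prems(1)])
    moreover have "v - c = w + w'" using wb cw by simp
    then have "v - c \<in> positive_part n"
      using subspace_add[OF submodD(2)[OF positive_part_submod] wb(2) cw(3)] by simp
    ultimately have "v - c \<in> N i0" by (rule Suc.IH)
    then show ?case using subspace_add[OF submodD(2)[OF N(1)] _ cw(2)] by force
  qed
  \<comment> \<open>Negative powers are cleared first: some \<open>x [^] k\<close> moves
    \<open>v\<close> into \<open>V_plus\<close>, where descent on the degree applies, and submodules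
    over \<open>H'\<close> are stable under its inverse.\<close>
  have "N i \<subseteq> N i0" if i: "i \<ge> i0" for i
  proof
    fix v assume v: "v \<in> N i"
    then have "v \<in> (\<Union>k. shifted k)" unfolding Union_shifted using N(3) by blast
    then obtain k :: nat where "T (x [^] k) v \<in> V_plus" unfolding shifted_def by blast
    then obtain n where "T (x [^] k) v \<in> positive_part n" unfolding V_plus_def by blast
    then have "T (x [^] k) v \<in> N i0" using step[OF i T_pow_invariant[OF N(1) v]] by blast
    then show "v \<in> N i0" by (rule T_inv_pow_invariant[OF N(1)])
  qed
  then have "N i = N i0" if "i \<ge> i0" for i using that incseqD[OF inc that] by blast
  then show "\<exists>n. \<forall>m\<ge>n. N m = N n" by blast
qed

text \<open>The factors of the ascending filtration of \<open>V_plus\<close> are isomorphic to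
  \<open>B/l n\<close>. The Noetherian property makes the chain \<open>l n\<close> stationary, so
  only finitely many of them differ and the product of their parameters serves all.\<close>

lemma reduced_cyclic_extension:
  assumes "noetherian_over H" "generically_reduced H"
  shows "\<exists>s. s \<notin> P \<and> reduced s U (submod_hull H' U F)"
proof -
  have red: "\<exists>s. s \<notin> P \<and> reduced s W B" if W: "submod H W" "U \<subseteq> W" "W \<subseteq> B" for W
    using assms(2) W(1) F hull_eqI[OF W(2) W(3)[unfolded B_eq]] unfolding generically_reduced_def B_eq by metis
  define l where "l n = {b \<in> B. T (x [^] n) b \<in> positive_part n}" for n
  have l: "submod H (l n) \<and> U \<subseteq> l n \<and> l n \<subseteq> B" for n
  proof -
    have "U \<subseteq> positive_part n" using incseqD[OF positive_part_incseq, of 0 n] by simp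
    then have "U \<subseteq> {b. T (x [^] n) b \<in> positive_part n}" using T_pow_invariant[OF U] by blast
    moreover have "l n = B \<inter> {b. T (x [^] n) b \<in> positive_part n}" by (auto simp: l_def)
    ultimately show ?thesis
      using x B_submod by (auto intro!: submod_Int submod_preimage[OF H _ positive_part_submod])
  qed
  have "incseq l"
    unfolding incseq_Suc_iff l_def T_pow_Suc(1) using T_positive_part by blast
  moreover have "acc_on (\<lambda>W. submod H W \<and> U \<subseteq> W \<and> W \<subseteq> B)"
    using assms(1) U_H F unfolding noetherian_over_def B_eq by blast
  ultimately obtain n0 where n0: "\<And>n. n \<ge> n0 \<Longrightarrow> l n = l n0"
    using acc_onD[of _ l] l by (metis (mono_tags, lifting))
  have "\<forall>n. \<exists>s. s \<notin> P \<and> reduced s (l n) B" using red l by blast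
  then obtain s where s: "\<And>n. s n \<notin> P" "\<And>n. reduced (s n) (l n) B" by metis
  define t where "t = (\<Prod>n\<le>n0. s n)"
  have "prod s A \<notin> P" if "finite A" for A
    using that by (induction A rule: finite_induct) (use P_one P_prime s in auto)
  then have t: "t \<notin> P" by (simp add: t_def)
  have t_red: "reduced t (l n) B" for n
  proof -
    define m where "m = min n n0"
    have "l n = l m" using n0[of n] by (auto simp: m_def min_def)
    moreover have "t = s m * prod s ({..n0} - {m})"
      unfolding t_def by (rule prod.remove) (auto simp: m_def)
    moreover have "subspace (l m)" using l submodD(2) by blast
    ultimately show ?thesis using reduced_mono[OF _ s(2)] by simp
  qed
  have sub_V: "subspace (positive_part n)" for n using submodD(2)[OF positive_part_submod] .
  have "reduced t (positive_part n) (positive_part (Suc n))" for n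
    unfolding positive_part.simps(2)
    by (rule reduced_sum[OF H _ positive_part_submod B_submod(1) t_red[unfolded l_def]]) (use x in simp)
  then have "reduced t (positive_part 0) V_plus"
    unfolding V_plus_def by (rule reduced_Union[OF sub_V positive_part_incseq])
  then have red1: "reduced t U V_plus" by simp
  \<comment> \<open>Every step from \<open>shifted k\<close> to \<open>shifted (Suc k)\<close> has a
    factor isomorphic to \<open>B/l'\<close>, independently of \<open>k\<close>, so a single
    parameter \<open>s'\<close> serves all negative powers.\<close>
  define l' where "l' = {b \<in> B. T (inv x) b \<in> V_plus}"
  have l'_eq: "{b \<in> B. T (inv (x [^] Suc k)) b \<in> shifted k} = l'" for k
  proof -
    have "x [^] k \<otimes> inv (x [^] Suc k) = inv x"
      unfolding nat_pow_Suc2[OF x] using x by (simp add: word_simps)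
    then have "T (x [^] k) (T (inv (x [^] Suc k)) b) = T (inv x) b" for b
      using x by (metis T_mult inv_closed nat_pow_closed)
    then show ?thesis by (simp add: l'_def shifted_def del: nat_pow_Suc)
  qed
  have "l' = B \<inter> {b. T (inv x) b \<in> V_plus}" by (auto simp: l'_def)
  then have "submod H l'"
    using x by (simp add: submod_Int B_submod submod_preimage[OF H _ V_plus_submod])
  moreover have "U \<subseteq> l'"
  proof -
    have "T (inv x) u \<in> positive_part 0" if "u \<in> U" for u
      using U that by (simp add: submod_generate_iff)
    then show ?thesis using B_submod(2) positive_part_subset_V_plus unfolding l'_def by blast
  qed
  ultimately obtain s' where s': "s' \<notin> P" "reduced s' l' B" using red[of l'] unfolding l'_def by blast
  have "reduced s' (shifted k) (shifted (Suc k))" for k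
    unfolding shifted_Suc
    by (rule reduced_sum[OF H _ shifted_submod B_submod(1)]) (use x s' l'_eq in auto)
  then have "reduced s' (shifted 0) (\<Union>k. shifted k)"
    by (intro reduced_Union[OF submodD(2)[OF shifted_submod] shifted_incseq])
  then have red2: "reduced s' V_plus (submod_hull H' U F)"
    unfolding Union_shifted by (simp add: shifted_def T_one)
  have sub: "subspace U" "subspace V_plus" using submodD(2)[OF U_H] submodD(2)[OF V_plus_submod] .
  have "V_plus = shifted 0" by (simp add: shifted_def T_one)
  then have incl: "V_plus \<subseteq> submod_hull H' U F" unfolding Union_shifted[symmetric] by blast
  have "U \<subseteq> V_plus" using positive_part_subset_V_plus[of 0] by simp
  then have "reduced (t * s') U (submod_hull H' U F)"
    using reduced_trans[OF sub _ incl] reduced_mono[OF sub(1) red1] reduced_mono[OF sub(2) red2, of t]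
    by (simp add: mult.commute)
  then show ?thesis using P_prime t s'(1) by blast
qed

end

lemma noetherian_over_cyclic_extension:
  "noetherian_over H \<Longrightarrow> noetherian_over H'"
  using acc_cyclic_extension[OF _ _ refl] unfolding noetherian_over_def[of H'] by blast

lemma generically_reduced_cyclic_extension:
  "noetherian_over H \<Longrightarrow> generically_reduced H \<Longrightarrow> generically_reduced H'"
  using reduced_cyclic_extension[OF _ _ refl] unfolding generically_reduced_def[of H'] by blast

end

text \<open>The Noetherian property is carried along because each cyclic step uses it to bound the
  number of different factors. The induction starts at \<open>K\<close>, which acts trivially modulo
  \<open>L\<close>.\<close>

theorem generically_reduced_polycentral:
  assumes "polycentral G K H" "K \<lhd> G" "\<And>k v. k \<in> K \<Longrightarrow> T k v - v \<in> L"
  shows "noetherian_over H \<and> generically_reduced H"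
  using assms(1)
proof (induction rule: polycentral.induct)
  case base
  have "K \<subseteq> carrier G" using subgroup.subset[OF normal_imp_subgroup[OF assms(2)]] .
  then show ?case using noetherian_over_trivial generically_reduced_trivial assms(3) by blast
next
  case (step H x)
  then have "x \<in> carrier G" "H \<lhd> G"
    using polycentral_normal[OF _ assms(2)] by (auto simp: central_mod_def)
  then show ?case
    using step.IH noetherian_over_cyclic_extension[OF _ _ refl] generically_reduced_cyclic_extension[OF _ _ refl] by blast
qed

end

section \<open>Prime ideals of integer polynomials\<close>

lemma ring_ideal_sum: "ring_ideal I \<Longrightarrow> (\<And>x. x \<in> A \<Longrightarrow> f x \<in> I) \<Longrightarrow> sum f A \<in> I"
  by (induction A rule: infinite_finite_induct) (auto intro: ring_idealD)

lemma comaximal_power: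
  assumes "ring_ideal P" "a * p + c * y - 1 \<in> P"
  shows "\<exists>a' c'. a' * p + c' * y ^ k - 1 \<in> P"
proof (induction k)
  case 0
  have "0 * p + 1 * y ^ 0 - 1 \<in> P" using ring_idealD(1)[OF assms(1)] by simp
  then show ?case by blast
next
  case (Suc k)
  then obtain a' c' where *: "a' * p + c' * y ^ k - 1 \<in> P" by blast
  have "(a' + c' * y ^ k * a) * p + (c' * c) * y ^ Suc k - 1
      = (a' * p + c' * y ^ k - 1) + c' * y ^ k * (a * p + c * y - 1)"
    by (simp add: algebra_simps)
  then show ?case
    using ring_idealD(2)[OF assms(1) * ring_idealD(3)[OF assms(1) assms(2)]] by metis
qed

lemma top_coeff_exists:
  fixes f :: "'r::comm_ring_1 poly"
  assumes "ring_ideal c" "coeff f i \<notin> c"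
  obtains d where "coeff f d \<notin> c" "\<And>j. j > d \<Longrightarrow> coeff f j \<in> c"
proof -
  let ?S = "{i. coeff f i \<notin> c}"
  have "?S \<subseteq> {..degree f}"
    using ring_idealD(1)[OF assms(1)] by (auto intro!: le_degree)
  then have fin: "finite ?S" by (rule finite_subset) simp
  moreover have "?S \<noteq> {}" using assms(2) by blast
  ultimately have "Max ?S \<in> ?S" by (rule Max_in)
  moreover have "coeff f j \<in> c" if "j > Max ?S" for j
    using Max_ge[OF fin, of j] that by force
  ultimately show ?thesis using that by blast
qed

text \<open>The polynomial ring over the domain modulo \<open>c\<close> is again a domain, so
  degrees modulo \<open>c\<close> add.\<close>

lemma top_coeff_mult:
  fixes f g :: "'r::comm_ring_1 poly"
  assumes c: "ring_ideal c" and prime: "\<And>a b. a * b \<in> c \<Longrightarrow> a \<in> c \<or> b \<in> c"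
    and f: "coeff f d \<notin> c" "\<And>j. j > d \<Longrightarrow> coeff f j \<in> c"
    and g: "coeff g e \<notin> c" "\<And>j. j > e \<Longrightarrow> coeff g j \<in> c"
  shows "coeff (f * g) (d + e) \<notin> c"
proof
  assume *: "coeff (f * g) (d + e) \<in> c"
  have "coeff (f * g) (d + e) = coeff f d * coeff g e + (\<Sum>i\<in>{..d + e} - {d}. coeff f i * coeff g (d + e - i))"
    unfolding coeff_mult by (subst sum.remove[of _ d]) auto
  moreover have "(\<Sum>i\<in>{..d + e} - {d}. coeff f i * coeff g (d + e - i)) \<in> c"
  proof (rule ring_ideal_sum[OF c])
    fix i assume "i \<in> {..d + e} - {d}"
    then have "i > d \<or> d + e - i > e" by auto
    then show "coeff f i * coeff g (d + e - i) \<in> c" using f(2) g(2) ring_idealD(3,4)[OF c] by blast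
  qed
  ultimately have "coeff f d * coeff g e \<in> c" using ring_idealD(6)[OF c *] by force
  then show False using prime f(1) g(1) by blast
qed

lemma const_poly_mult: "[:a:] * [:b:] = [:a * b :: 'r::comm_ring_1:]"
  by (simp add: mult.commute)

lemma ring_ideal_constants:
  assumes "ring_ideal P"
  shows "ring_ideal {n. [:n:] \<in> P}"
proof -
  have "[:x + y:] \<in> P" if "[:x:] \<in> P" "[:y:] \<in> P" for x y
    using ring_idealD(2)[OF assms that] by simp
  moreover have "[:a * x:] \<in> P" if "[:x:] \<in> P" for a x
    using ring_idealD(3)[OF assms that, of "[:a:]"] by (simp only: const_poly_mult)
  ultimately show ?thesis using ring_idealD(1)[OF assms] by (simp add: ring_ideal_def)
qed

text \<open>If all coefficients of members of \<open>P\<close> were again in \<open>P\<close>, the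
  residue ring would be a polynomial ring over a domain, whose units are constants.\<close>

lemma not_extended_ideal:
  fixes P :: "'r::comm_ring_1 poly set"
  assumes P: "ring_ideal P" "1 \<notin> P" and prime: "\<And>a b. a * b \<in> P \<Longrightarrow> a \<in> P \<or> b \<in> P"
    and s: "s \<notin> P"
    and units: "\<And>p a b. p \<notin> P \<Longrightarrow> a * p + b * s - 1 \<in> P \<Longrightarrow> \<exists>a. a * p - 1 \<in> P"
  shows "\<exists>f\<in>P. \<exists>i. [:coeff f i:] \<notin> P"
proof (rule ccontr)
  assume neg: "\<not> ?thesis"
  define c where "c = {n. [:n:] \<in> P}"
  have c: "ring_ideal c" unfolding c_def by (rule ring_ideal_constants[OF P(1)])
  have c_prime: "a \<in> c \<or> b \<in> c" if "a * b \<in> c" for a b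
    using that prime[of "[:a:]" "[:b:]"] unfolding c_def const_poly_mult by blast
  have mem: "f \<in> P \<longleftrightarrow> (\<forall>i. coeff f i \<in> c)" for f
  proof
    assume "\<forall>i. coeff f i \<in> c"
    then show "f \<in> P"
    proof (induction f)
      case 0 then show ?case using ring_idealD(1)[OF P(1)] by simp
    next
      case (pCons a f)
      have "coeff f i \<in> c" for i using spec[OF pCons.prems, of "Suc i"] by simp
      then have "[:0, 1:] * f \<in> P" using pCons.IH ring_idealD(3)[OF P(1)] by blast
      moreover have "[:a:] \<in> P" using spec[OF pCons.prems, of 0] by (simp add: c_def)
      ultimately have "[:a:] + [:0, 1:] * f \<in> P" by (intro ring_idealD(2)[OF P(1)])
      then show ?case by simp
    qed
  qed (use neg in \<open>auto simp: c_def\<close>)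
  obtain i where "coeff s i \<notin> c" using s mem by blast
  then obtain d where d: "coeff s d \<notin> c" "\<And>j. j > d \<Longrightarrow> coeff s j \<in> c"
    using top_coeff_exists[OF c] by metis
  \<comment> \<open>\<open>p = 1 + x s\<close> is comaximal with \<open>s\<close> by construction,
    and its degree modulo \<open>c\<close> is positive whatever the degree of \<open>s\<close>, so
    it cannot be a unit.\<close>
  define p where "p = 1 + pCons 0 s"
  have p: "coeff p (Suc d) \<notin> c" "\<And>j. j > Suc d \<Longrightarrow> coeff p j \<in> c"
  proof -
    show "coeff p (Suc d) \<notin> c" using d(1) by (simp add: p_def)
    fix j assume "j > Suc d"
    then show "coeff p j \<in> c" using d(2)[of "j - 1"] by (cases j) (simp_all add: p_def)
  qed
  have "1 * p + (- [:0, 1:]) * s - 1 = 0" by (simp add: p_def)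
  then have "1 * p + (- [:0, 1:]) * s - 1 \<in> P" using ring_idealD(1)[OF P(1)] by simp
  moreover have "p \<notin> P" using p(1) mem by blast
  ultimately obtain a where a: "a * p - 1 \<in> P" using units by blast
  have "a \<notin> P"
  proof
    assume "a \<in> P"
    then have "a * p - (a * p - 1) \<in> P" using a ring_idealD(4,6)[OF P(1)] by blast
    then show False using P(2) by simp
  qed
  then obtain i where "coeff a i \<notin> c" using mem by blast
  then obtain e where e: "coeff a e \<notin> c" "\<And>j. j > e \<Longrightarrow> coeff a j \<in> c"
    using top_coeff_exists[OF c] by metis
  have "coeff (a * p) (e + Suc d) \<notin> c" by (rule top_coeff_mult[OF c c_prime e p])
  moreover have "coeff (a * p - 1) (e + Suc d) \<in> c" using a mem by blast
  ultimately show False by simp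
qed

lemma prime_ideal_int_contains_prime:
  assumes "ring_ideal c" "(1::int) \<notin> c" "n \<in> c" "n \<noteq> 0" "\<And>a b. a * b \<in> c \<Longrightarrow> a \<in> c \<or> b \<in> c"
  obtains p where "Factorial_Ring.prime p" "p \<in> c" "\<And>m. m \<in> c \<Longrightarrow> p dvd m"
proof -
  have "\<exists>p. Factorial_Ring.prime p \<and> p \<in> c"
    using assms(3,4)
  proof (induction n rule: prime_divisors_induct)
    case (unit x)
    then have "x * (1 div x) = 1" by (simp add: dvd_mult_div_cancel)
    then show ?case using ring_idealD(4)[OF assms(1) unit(2)] assms(2) by metis
  next
    case (factor q x)
    then show ?case using assms(5)[of q x] by auto
  qed auto
  then obtain p where p: "Factorial_Ring.prime p" "p \<in> c" by blast
  moreover have "p dvd m" if "m \<in> c" for m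
  proof (rule ccontr)
    assume "\<not> p dvd m"
    with p(1) have "coprime p m" by (rule prime_imp_coprime)
    then obtain a b where "a * p + b * m = 1" using bezout_int[of p m] by (auto simp: coprime_iff_gcd_eq_1)
    then show False using ring_idealD(2)[OF assms(1) ring_idealD(3)[OF assms(1) p(2)] ring_idealD(3)[OF assms(1) that]] assms(2)
      by metis
  qed
  ultimately show ?thesis using that by blast
qed

lemma finite_bounded_polys: "finite {r :: int poly. \<forall>i. coeff r i \<in> {0..p} \<and> (i \<ge> d \<longrightarrow> coeff r i = 0)}"
proof (rule finite_subset)
  show "finite (Poly ` {xs. set xs \<subseteq> {0..p} \<and> length xs = d})"
    by (intro finite_imageI finite_lists_length_eq) simp
  show "{r :: int poly. \<forall>i. coeff r i \<in> {0..p} \<and> (i \<ge> d \<longrightarrow> coeff r i = 0)}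
      \<subseteq> Poly ` {xs. set xs \<subseteq> {0..p} \<and> length xs = d}"
  proof
    fix r :: "int poly"
    assume r: "r \<in> {r. \<forall>i. coeff r i \<in> {0..p} \<and> (i \<ge> d \<longrightarrow> coeff r i = 0)}"
    have "r = Poly (map (coeff r) [0..<d])"
      using r by (auto simp: poly_eq_iff coeff_Poly_eq nth_default_def)
    moreover have "map (coeff r) [0..<d] \<in> {xs. set xs \<subseteq> {0..p} \<and> length xs = d}"
      using r by auto
    ultimately show "r \<in> Poly ` {xs. set xs \<subseteq> {0..p} \<and> length xs = d}" by blast
  qed
qed

text \<open>The residue ring is a finite domain, so the powers of each nonzero element are eventually
  periodic and hence return to 1.\<close>

lemma power_eq_one_mod_prime_ideal:
  fixes P :: "int poly set"
  assumes P: "ring_ideal P" "1 \<notin> P" and prime: "\<And>a b. a * b \<in> P \<Longrightarrow> a \<in> P \<or> b \<in> P"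
    and p: "Factorial_Ring.prime p" "[:p:] \<in> P" and f: "f \<in> P" "\<not> p dvd coeff f i" and g: "g \<notin> P"
  obtains n where "n > 0" "g ^ n - 1 \<in> P"
proof -
  note id = ring_idealD[OF P(1)]
  have dvd_P: "h \<in> P" if "\<And>i. p dvd coeff h i" for h
  proof -
    have "[:p:] dvd h" using that by (simp add: const_poly_dvd_iff)
    then show ?thesis using id(4)[OF p(2)] by (auto simp: dvd_def)
  qed
  have "ring_ideal {m. p dvd m}" by (auto simp: ring_ideal_def)
  then obtain d where d: "\<not> p dvd coeff f d" "\<And>j. j > d \<Longrightarrow> p dvd coeff f j"
    using top_coeff_exists[of "{m. p dvd m}" f i] f(2) by auto
  have "coprime p (coeff f d)" using p(1) d(1) by (rule prime_imp_coprime)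
  then obtain a u where au: "a * p + u * coeff f d = 1"
    using bezout_int[of p "coeff f d"] by (auto simp: coprime_iff_gcd_eq_1)
  \<comment> \<open>A monic polynomial of degree \<open>d\<close> congruent to
    \<open>smult u f\<close> modulo \<open>p\<close>, where \<open>u\<close> inverts the top
    coefficient of \<open>f\<close> modulo \<open>p\<close>. The coefficient of degree
    \<open>d\<close> is set to \<open>1\<close>, and higher ones, all divisible by \<open>p\<close>,
    are cut off.\<close>
  define m where "m = Polynomial.monom 1 d + poly_cutoff d (smult u f)"
  have m_coeff: "coeff m i = (if i < d then u * coeff f i else if i = d then 1 else 0)" for i
    by (simp add: m_def coeff_poly_cutoff)
  have "1 = p * a + u * coeff f d" using au by (simp add: mult.commute)
  then have "p dvd u * coeff f d - 1" by (metis dvd_triv_left dvd_minus_iff minus_diff_eq add_diff_cancel_right')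
  then have "smult u f - m \<in> P"
    using d(2) by (intro dvd_P) (auto simp: m_coeff not_less le_less)
  then have m_P: "m \<in> P" using id(6)[OF id(3)[OF f(1), of "[:u:]"], of "smult u f - m"] by simp
  define R where "R = {r :: int poly. \<forall>i. coeff r i \<in> {0..p} \<and> (i \<ge> d \<longrightarrow> coeff r i = 0)}"
  have "\<exists>r\<in>R. h - r \<in> P" for h
  proof (induction h)
    case 0
    have "0 \<in> R" using prime_gt_0_int[OF p(1)] by (simp add: R_def)
    then show ?case using id(1) by force
  next
    case (pCons a h)
    then obtain r where r: "r \<in> R" "h - r \<in> P" by blast
    \<comment> \<open>One step of division by \<open>m\<close>: after multiplication by
      \<open>x\<close> the coefficient of degree \<open>d\<close> is cancelled; reduction of all
      coefficients modulo \<open>p\<close> follows in \<open>r'\<close>.\<close>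
    define h' where "h' = pCons a r - smult (coeff (pCons a r) d) m"
    have h': "coeff h' i = 0" if "i \<ge> d" for i
      using that r(1) by (cases i) (auto simp: h'_def m_coeff R_def)
    define r' where "r' = map_poly (\<lambda>c. c mod p) h'"
    have "r' \<in> R" using h' prime_gt_0_int[OF p(1)]
      by (auto simp: R_def r'_def coeff_map_poly less_imp_le)
    moreover have "pCons a h - r' \<in> P"
    proof -
      have "h' - r' \<in> P" by (rule dvd_P) (simp add: r'_def coeff_map_poly minus_mod_eq_mult_div)
      moreover have "[:0, 1:] * (h - r) \<in> P" by (rule id(3)[OF r(2)])
      moreover have "[:coeff (pCons a r) d:] * m \<in> P" by (rule id(3)[OF m_P])
      ultimately have "(h' - r') + [:0, 1:] * (h - r) + [:coeff (pCons a r) d:] * m \<in> P"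
        by (intro id(2))
      moreover have "(h' - r') + [:0, 1:] * (h - r) + [:coeff (pCons a r) d:] * m = pCons a h - r'"
        by (simp add: h'_def)
      ultimately show ?thesis by (simp only:)
    qed
    ultimately show ?case by blast
  qed
  then obtain r where r: "\<And>h. r h \<in> R" "\<And>h. h - r h \<in> P" by metis
  have "finite R" unfolding R_def by (rule finite_bounded_polys)
  moreover have "range (\<lambda>n. r (g ^ n)) \<subseteq> R" using r(1) by auto
  ultimately have "\<not> inj (\<lambda>n. r (g ^ n))"
    using finite_imageD[of "\<lambda>n. r (g ^ n)" UNIV] by (meson finite_subset infinite_UNIV_nat)
  then obtain j k where jk: "j < k" "r (g ^ j) = r (g ^ k)"
    unfolding inj_def by (metis linorder_neqE_nat)
  have "g ^ k - g ^ j \<in> P"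
    using id(6)[OF r(2)[of "g ^ k"] r(2)[of "g ^ j"]] jk(2) by simp
  moreover have "g ^ k - g ^ j = g ^ j * (g ^ (k - j) - 1)"
    using jk(1) by (simp add: right_diff_distrib flip: power_add)
  ultimately have "g ^ j \<in> P \<or> g ^ (k - j) - 1 \<in> P" using prime by metis
  moreover have "g ^ n \<notin> P" for n
    by (induction n) (use P(2) prime g in auto)
  ultimately show ?thesis using that[of "k - j"] jk(1) by auto
qed

section \<open>Just non-nilpotent operator groups\<close>

lemma additive_frag_cmul:
  assumes "\<And>v w. f (v + w) = f v + f w"
  shows "f (frag_cmul c v) = frag_cmul c (f v)"
proof -
  have f0: "f 0 = 0" using assms[of 0 0] by simp
  have fm: "f (v - w) = f v - f w" for v w using assms[of "v - w" w] by simp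
  show ?thesis
    by (induction c rule: int_induct[of _ 0])
      (simp_all add: f0 fm assms frag_cmul_distrib frag_cmul_diff_distrib)
qed

lemma frag_cmul_closed:
  assumes "0 \<in> W" "\<And>a b. a \<in> W \<Longrightarrow> b \<in> W \<Longrightarrow> a - b \<in> W" "v \<in> W"
  shows "frag_cmul c v \<in> W"
proof -
  have "- v \<in> W" using assms(2)[OF assms(1,3)] by simp
  have "a + v \<in> W" if "a \<in> W" for a using assms(2)[OF that \<open>- v \<in> W\<close>] by simp
  then show ?thesis
    by (induction c rule: int_induct[of _ 0])
      (use assms in \<open>simp_all add: frag_cmul_distrib frag_cmul_diff_distrib\<close>)
qed

interpretation frag_module: Modules.module frag_cmul
  by unfold_locales (simp_all add: frag_cmul_distrib frag_cmul_distrib2)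

text \<open>The module is presented as the quotient of the free abelian group \<open>'m \<Rightarrow>\<^sub>0 int\<close> by \<open>L\<close>, so that
  polynomials in an operator act by total functions on a type.\<close>

locale frag_operators = group G for G :: "('g, 'b) monoid_scheme" (structure) +
  fixes T :: "'g \<Rightarrow> ('m \<Rightarrow>\<^sub>0 int) \<Rightarrow> ('m \<Rightarrow>\<^sub>0 int)" and L :: "('m \<Rightarrow>\<^sub>0 int) set"
  assumes T_add: "g \<in> carrier G \<Longrightarrow> T g (v + w) = T g v + T g w"
    and T_mult: "g \<in> carrier G \<Longrightarrow> h \<in> carrier G \<Longrightarrow> T (g \<otimes> h) v = T g (T h v)"
    and T_one: "T \<one> v = v"
    and L_zero: "0 \<in> L" and L_diff: "v \<in> L \<Longrightarrow> w \<in> L \<Longrightarrow> v - w \<in> L"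
    and T_L: "g \<in> carrier G \<Longrightarrow> v \<in> L \<Longrightarrow> T g v \<in> L"
begin

definition opsub :: "('m \<Rightarrow>\<^sub>0 int) set \<Rightarrow> bool" where
  "opsub W \<longleftrightarrow> L \<subseteq> W \<and> (\<forall>a\<in>W. \<forall>b\<in>W. a - b \<in> W) \<and> (\<forall>g\<in>carrier G. \<forall>w\<in>W. T g w \<in> W)"

text \<open>The preimage of the elements of the quotient by \<open>W\<close> that are fixed by
  \<open>G\<close>. Iterated from \<open>L\<close>, it gives the upper central series of the
  action.\<close>

definition inv_mod :: "('m \<Rightarrow>\<^sub>0 int) set \<Rightarrow> ('m \<Rightarrow>\<^sub>0 int) set" where
  "inv_mod W = {v. \<forall>g\<in>carrier G. T g v - v \<in> W}"

lemma opsubD: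
  assumes "opsub W"
  shows "L \<subseteq> W" "0 \<in> W" "a \<in> W \<Longrightarrow> b \<in> W \<Longrightarrow> a - b \<in> W" "a \<in> W \<Longrightarrow> - a \<in> W"
    "a \<in> W \<Longrightarrow> b \<in> W \<Longrightarrow> a + b \<in> W" "g \<in> carrier G \<Longrightarrow> a \<in> W \<Longrightarrow> T g a \<in> W"
    "a \<in> W \<Longrightarrow> frag_cmul c a \<in> W"
proof -
  show "L \<subseteq> W" and d: "\<And>a b. a \<in> W \<Longrightarrow> b \<in> W \<Longrightarrow> a - b \<in> W"
    and "g \<in> carrier G \<Longrightarrow> a \<in> W \<Longrightarrow> T g a \<in> W"
    using assms by (auto simp: opsub_def)
  then show z: "0 \<in> W" using L_zero by auto
  show m: "\<And>a. a \<in> W \<Longrightarrow> - a \<in> W" using d[OF z] by simp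
  show "a \<in> W \<Longrightarrow> b \<in> W \<Longrightarrow> a + b \<in> W" using d[of a "- b"] m by simp
  show "a \<in> W \<Longrightarrow> frag_cmul c a \<in> W" by (rule frag_cmul_closed[OF z d])
qed

lemma T_zero: "g \<in> carrier G \<Longrightarrow> T g 0 = 0"
  using T_add[of g 0 0] by simp

lemma T_diff: "g \<in> carrier G \<Longrightarrow> T g (v - w) = T g v - T g w"
  using T_add[of g "v - w" w] by simp

lemma T_cmul: "g \<in> carrier G \<Longrightarrow> T g (frag_cmul c v) = frag_cmul c (T g v)"
  using additive_frag_cmul T_add by blast

lemma opsub_L: "opsub L"
  using L_diff T_L by (auto simp: opsub_def)

lemma opsub_inv_mod:
  assumes "opsub W"
  shows "opsub (inv_mod W)" "W \<subseteq> inv_mod W"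
proof -
  note W = opsubD[OF assms]
  show sub: "W \<subseteq> inv_mod W" using W by (auto simp: inv_mod_def)
  have "T g (T h v) - T h v \<in> W" if "v \<in> inv_mod W" "h \<in> carrier G" "g \<in> carrier G" for g h v
  proof -
    have "T h (T (inv h \<otimes> g \<otimes> h) v - v) \<in> W"
      using that W by (auto simp: inv_mod_def)
    moreover have "T h (T (inv h \<otimes> g \<otimes> h) v) = T g (T h v)"
      using that by (simp add: word_simps flip: T_mult)
    ultimately show ?thesis using that by (simp add: T_diff)
  qed
  moreover have "T g (a - b) - (a - b) \<in> W" if "a \<in> inv_mod W" "b \<in> inv_mod W" "g \<in> carrier G" for g a b
  proof -
    have "(T g a - a) - (T g b - b) \<in> W" using that W(3) by (auto simp: inv_mod_def)
    then show ?thesis using that by (simp add: T_diff algebra_simps)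
  qed
  ultimately show "opsub (inv_mod W)"
    using sub W(1) unfolding opsub_def by (auto simp: inv_mod_def)
qed

lemma opsub_inv_mod_funpow: "opsub W \<Longrightarrow> opsub ((inv_mod ^^ k) W)"
  by (induction k) (auto intro: opsub_inv_mod)

lemma inv_mod_funpow_Suc_iff:
  "v \<in> (inv_mod ^^ Suc k) W \<longleftrightarrow> (\<forall>g\<in>carrier G. T g v - v \<in> (inv_mod ^^ k) W)"
  unfolding funpow.simps comp_apply inv_mod_def[of "(inv_mod ^^ k) W"] by blast

lemma inv_mod_funpow_mono: "A \<subseteq> B \<Longrightarrow> (inv_mod ^^ k) A \<subseteq> (inv_mod ^^ k) B"
  by (induction k) (auto simp: inv_mod_def)

end

text \<open>An action counts as nilpotent if iterated fixed points exhaust the module. As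
  \<open>opsub W\<close> includes \<open>L \<subseteq> W\<close>, the condition
  \<open>W \<noteq> L\<close> singles out the proper quotients of the module presented by
  \<open>L\<close>.\<close>

locale just_non_nilpotent = frag_operators G T L
  for G :: "('g, 'b) monoid_scheme" (structure)
    and T :: "'g \<Rightarrow> ('m \<Rightarrow>\<^sub>0 int) \<Rightarrow> ('m \<Rightarrow>\<^sub>0 int)" and L :: "('m \<Rightarrow>\<^sub>0 int) set" +
  assumes not_nilpotent: "(inv_mod ^^ k) L \<noteq> UNIV"
    and proper_nilpotent: "opsub W \<Longrightarrow> W \<noteq> L \<Longrightarrow> \<exists>k. (inv_mod ^^ k) W = UNIV"
    and finitely_generated: "\<exists>F. finite F \<and> (\<forall>W. opsub W \<longrightarrow> F \<subseteq> W \<longrightarrow> W = UNIV)"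
    and polycentral: "\<exists>K. K \<lhd> G \<and> polycentral G K (carrier G) \<and> (\<forall>k\<in>K. \<forall>v. T k v - v \<in> L)"
begin

lemma L_neq_UNIV: "L \<noteq> UNIV"
  using not_nilpotent[of 0] by simp

end

section \<open>Polynomials in a central operator\<close>

locale central_element = just_non_nilpotent G T L
  for G :: "('g, 'b) monoid_scheme" (structure)
    and T :: "'g \<Rightarrow> ('m \<Rightarrow>\<^sub>0 int) \<Rightarrow> ('m \<Rightarrow>\<^sub>0 int)" and L :: "('m \<Rightarrow>\<^sub>0 int) set" +
  fixes z
  assumes z: "z \<in> carrier G" and z_central: "\<And>g v. g \<in> carrier G \<Longrightarrow> T g (T z v) - T z (T g v) \<in> L"
    and z_nontrivial: "\<exists>v. T z v - v \<notin> L"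
begin

text \<open>Horner's scheme for \<open>f(z) v\<close>. As \<open>T z\<close> is additive on the
  whole free abelian group, this is a genuine module structure there, while compatibility with the
  other operators holds only modulo \<open>L\<close>.\<close>

definition scale :: "int poly \<Rightarrow> ('m \<Rightarrow>\<^sub>0 int) \<Rightarrow> ('m \<Rightarrow>\<^sub>0 int)" where
  "scale f v = fold_coeffs (\<lambda>a w. frag_cmul a v + T z w) f 0"

lemma scale_0: "scale 0 v = 0"
  by (simp add: scale_def)

lemma scale_pCons: "scale (pCons a f) v = frag_cmul a v + T z (scale f v)"
  using z by (cases "a = 0 \<and> f = 0") (auto simp: scale_def T_zero)

lemma scale_const: "scale [:a:] v = frag_cmul a v"
  using z by (simp add: scale_pCons scale_0 T_zero)

lemma scale_add_right: "scale f (v + w) = scale f v + scale f w"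
  using z by (induction f) (simp_all add: scale_0 scale_pCons frag_cmul_distrib2 T_add algebra_simps)

lemma scale_add_left: "scale (f + g) v = scale f v + scale g v"
proof (induction f arbitrary: g)
  case (pCons a f)
  show ?case
    using z pCons.IH by (cases g) (simp add: scale_pCons frag_cmul_distrib T_add algebra_simps)
qed (simp add: scale_0)

lemma scale_smult: "scale (smult c f) v = frag_cmul c (scale f v)"
  using z by (induction f) (simp_all add: scale_0 scale_pCons frag_cmul_distrib2 T_cmul)

lemma scale_mult: "scale (f * g) v = scale f (scale g v)"
  using z by (induction f) (simp_all add: scale_0 scale_pCons scale_add_left scale_smult)

sublocale poly_module: Modules.module scale
  by unfold_locales
    (simp_all add: scale_add_right scale_add_left scale_mult one_pCons scale_const)

lemma scale_diff_right: "scale f (v - w) = scale f v - scale f w"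
  by (rule poly_module.scale_right_diff_distrib)

lemma scale_monom: "scale ([:0, 1:] ^ n) v = T (z [^] n) v"
proof (induction n)
  case (Suc n)
  have "scale ([:0, 1:] ^ Suc n) v = T z (T (z [^] n) v)"
    by (simp only: power_Suc scale_mult Suc scale_pCons scale_0) (simp add: T_zero z)
  moreover have "z [^] Suc n = z \<otimes> z [^] n" using z by (rule nat_pow_Suc2)
  ultimately show ?case using z by (simp add: T_mult del: nat_pow_Suc)
qed (simp add: one_pCons scale_const T_one)

lemma scale_T: "g \<in> carrier G \<Longrightarrow> T g (scale f v) - scale f (T g v) \<in> L"
proof (induction f)
  case 0 then show ?case by (simp add: scale_0 T_zero L_zero)
next
  case (pCons a f)
  note L = opsubD[OF opsub_L]
  have "T z (T g (scale f v) - scale f (T g v)) \<in> L" using pCons z T_L by blast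
  then have "(T g (T z (scale f v)) - T z (T g (scale f v))) + T z (T g (scale f v) - scale f (T g v)) \<in> L"
    using L(5) z_central[OF pCons.prems] by blast
  then show ?case using pCons.prems z by (simp add: scale_pCons T_add T_cmul T_diff algebra_simps)
qed

lemma opsub_scale: "opsub W \<Longrightarrow> w \<in> W \<Longrightarrow> scale f w \<in> W"
  by (induction f) (use z in \<open>auto simp: scale_0 scale_pCons opsubD\<close>)

lemma scale_T_iff:
  assumes "opsub W" "g \<in> carrier G"
  shows "scale f (T g v) \<in> W \<longleftrightarrow> T g (scale f v) \<in> W"
proof -
  note W = opsubD[OF assms(1)]
  have *: "T g (scale f v) - scale f (T g v) \<in> W" using scale_T[OF assms(2)] W(1) by blast
  show ?thesis using W(5)[OF *] W(3)[OF _ *] by fastforce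
qed

definition annihilator :: "int poly set" where
  "annihilator = {f. \<forall>v. scale f v \<in> L}"

lemma opsub_image:
  shows "opsub {l + scale f v | l v. l \<in> L}" (is "opsub ?S")
proof -
  note L = opsubD[OF opsub_L]
  have "L \<subseteq> ?S"
  proof
    fix l assume "l \<in> L"
    moreover have "l = l + scale f 0" by (simp add: poly_module.scale_zero_right)
    ultimately show "l \<in> ?S" by blast
  qed
  moreover have "a - b \<in> ?S" if ab: "a \<in> ?S" "b \<in> ?S" for a b
  proof -
    obtain l v l' v' where "a = l + scale f v" "b = l' + scale f v'" "l \<in> L" "l' \<in> L" using ab by blast
    then have "a - b = (l - l') + scale f (v - v')" "l - l' \<in> L"
      using L(3) by (simp_all add: scale_diff_right)
    then show ?thesis by blast
  qed
  moreover have "T g a \<in> ?S" if a: "a \<in> ?S" and g: "g \<in> carrier G" for a g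
  proof -
    obtain l v where lv: "a = l + scale f v" "l \<in> L" using a by blast
    then have "T g a = (T g l + (T g (scale f v) - scale f (T g v))) + scale f (T g v)"
      using g by (simp add: T_add)
    moreover have "T g l + (T g (scale f v) - scale f (T g v)) \<in> L"
      using L(5)[OF L(6)[OF g lv(2)] scale_T[OF g]] .
    ultimately show ?thesis by blast
  qed
  ultimately show ?thesis unfolding opsub_def by blast
qed

lemma image_neq_L:
  assumes "f \<notin> annihilator"
  shows "{l + scale f v | l v. l \<in> L} \<noteq> L"
proof
  assume *: "{l + scale f v | l v. l \<in> L} = L"
  have "0 + scale f v \<in> L" for v using L_zero * by blast
  then show False using assms by (simp add: annihilator_def)
qed

text \<open>Otherwise kernel and image of \<open>f\<close> are both nonzero. The image is isomorphic
  to the quotient by the kernel, hence nilpotent, and the quotient by the image is nilpotent as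
  well; so the whole module would be nilpotent.\<close>

lemma scale_injective:
  assumes f: "f \<notin> annihilator" and v: "scale f v \<in> L"
  shows "v \<in> L"
proof (rule ccontr)
  assume "v \<notin> L"
  define C where "C = {v. scale f v \<in> L}"
  note L = opsubD[OF opsub_L]
  have "opsub C"
    unfolding opsub_def C_def using L(3) T_L opsub_scale[OF opsub_L] scale_T_iff[OF opsub_L]
    by (auto simp: scale_diff_right)
  moreover have "C \<noteq> L" using v \<open>v \<notin> L\<close> by (auto simp: C_def)
  ultimately obtain k where k: "(inv_mod ^^ k) C = UNIV" using proper_nilpotent by blast
  \<comment> \<open>Applying \<open>f\<close> carries iterated fixed points modulo the kernel
    \<open>C\<close> to iterated fixed points modulo \<open>L\<close>.\<close>
  have "scale f w \<in> (inv_mod ^^ j) L" if "w \<in> (inv_mod ^^ j) C" for w j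
    using that
  proof (induction j arbitrary: w)
    case 0 then show ?case by (simp add: C_def)
  next
    case (Suc j)
    note E = opsubD[OF opsub_inv_mod_funpow[OF opsub_L, of j]]
    have "T g (scale f w) - scale f w \<in> (inv_mod ^^ j) L" if g: "g \<in> carrier G" for g
    proof -
      have "T g w - w \<in> (inv_mod ^^ j) C" using Suc.prems g by (simp only: inv_mod_funpow_Suc_iff)
      then have "scale f (T g w) - scale f w \<in> (inv_mod ^^ j) L" using Suc.IH scale_diff_right by metis
      moreover have "T g (scale f w) - scale f (T g w) \<in> (inv_mod ^^ j) L" using scale_T[OF g] E(1) by blast
      ultimately have "(T g (scale f w) - scale f (T g w)) + (scale f (T g w) - scale f w) \<in> (inv_mod ^^ j) L"
        using E(5) by blast
      then show ?thesis by simp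
    qed
    then show ?case unfolding inv_mod_funpow_Suc_iff by blast
  qed
  then have im: "scale f w \<in> (inv_mod ^^ k) L" for w using k by blast
  note Ek = opsubD[OF opsub_inv_mod_funpow[OF opsub_L, of k]]
  have "{l + scale f v | l v. l \<in> L} \<subseteq> (inv_mod ^^ k) L" using Ek(1,5) im by blast
  moreover obtain m where "(inv_mod ^^ m) {l + scale f v | l v. l \<in> L} = UNIV"
    using proper_nilpotent[OF opsub_image image_neq_L[OF f]] by blast
  ultimately have "(inv_mod ^^ m) ((inv_mod ^^ k) L) = UNIV"
    using inv_mod_funpow_mono by blast
  then have "(inv_mod ^^ (m + k)) L = UNIV" by (simp add: funpow_add)
  then show False using not_nilpotent by blast
qed

abbreviation (input) "zm1 \<equiv> [:-1, 1:] :: int poly"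

lemma scale_zm1: "scale zm1 v = T z v - v"
  using z by (simp add: scale_pCons scale_0 T_add T_zero T_cmul)

text \<open>Each application of \<open>z - 1\<close> lowers the index in the series of iterated
  fixed points.\<close>

lemma proper_unipotent:
  assumes "opsub W" "W \<noteq> L"
  shows "\<exists>k. \<forall>v. scale (zm1 ^ k) v \<in> W"
proof -
  obtain k where k: "(inv_mod ^^ k) W = UNIV" using proper_nilpotent assms by blast
  have "scale (zm1 ^ j) v \<in> W" if "v \<in> (inv_mod ^^ j) W" for v j
    using that
  proof (induction j arbitrary: v)
    case (Suc j)
    then have "scale zm1 v \<in> (inv_mod ^^ j) W" using z by (simp only: scale_zm1 inv_mod_funpow_Suc_iff)
    then show ?case using Suc.IH by (simp only: power_Suc2 scale_mult)
  qed (simp add: one_pCons scale_const)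
  then show ?thesis using k by blast
qed

lemma annihilator_ideal: "ring_ideal annihilator"
  unfolding ring_ideal_def
proof (intro conjI ballI allI)
  show "0 \<in> annihilator" by (simp add: annihilator_def scale_0 L_zero)
  show "f + g \<in> annihilator" if "f \<in> annihilator" "g \<in> annihilator" for f g
    using that opsubD(5)[OF opsub_L] by (simp add: annihilator_def scale_add_left)
  show "f * g \<in> annihilator" if "g \<in> annihilator" for f g
  proof -
    have "scale f (scale g v) \<in> L" for v
      by (rule opsub_scale[OF opsub_L]) (use that in \<open>simp add: annihilator_def\<close>)
    then show ?thesis by (simp add: annihilator_def)
  qed
qed

lemma annihilator_one: "1 \<notin> annihilator"
proof
  assume "1 \<in> annihilator"
  then have "v \<in> L" for v unfolding annihilator_def mem_Collect_eq poly_module.scale_one by blast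
  then show False using L_neq_UNIV by blast
qed

lemma annihilator_prime:
  assumes "f * g \<in> annihilator"
  shows "f \<in> annihilator \<or> g \<in> annihilator"
proof (rule disjCI)
  assume "g \<notin> annihilator"
  have "scale (g * f) v \<in> L" for v using assms by (simp add: annihilator_def mult.commute)
  then have "scale f v \<in> L" for v
    using scale_injective[OF \<open>g \<notin> annihilator\<close>] unfolding scale_mult by blast
  then show "f \<in> annihilator" by (simp add: annihilator_def)
qed

lemma annihilator_power:
  assumes "f \<notin> annihilator"
  shows "f ^ n \<notin> annihilator"
proof (induction n)
  case (Suc n)
  then show ?case using assms annihilator_prime unfolding power_Suc by blast
qed (simp add: annihilator_one)

lemma zm1_notin_annihilator: "zm1 \<notin> annihilator"
  using z_nontrivial by (auto simp: annihilator_def scale_zm1)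

lemma subspace_opsub: "opsub W \<Longrightarrow> poly_module.subspace W" "opsub W \<Longrightarrow> frag_module.subspace W"
  by (rule poly_module.subspaceI frag_module.subspaceI; rule opsubD(2,5,7) opsub_scale; assumption)+

end

context central_element
begin

lemma scale_in_image: "scale f v \<in> {l + scale f v | l v. l \<in> L}"
proof -
  have "0 + scale f v \<in> {l + scale f v | l v. l \<in> L}" using L_zero by blast
  then show ?thesis by simp
qed

lemma image_remainder:
  assumes "v \<in> {l + scale f v | l v. l \<in> L}"
  shows "\<exists>w. v - scale f w \<in> L"
proof -
  obtain l w where "v = l + scale f w" "l \<in> L" using assms by blast
  then have "v - scale f w \<in> L" by simp
  then show ?thesis by blast
qed

lemma scalar_operators_scale: "scalar_operators scale G T L annihilator"
proof (rule scalar_operators.intro[OF _ _ scalar_operators_axioms.intro])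
  show "Modules.module scale" by (rule poly_module.module_axioms)
  show "group G" by (rule group_axioms)
  show "ring_ideal annihilator" by (rule annihilator_ideal)
  show "1 \<notin> annihilator" by (rule annihilator_one)
  show "poly_module.subspace L" by (rule subspace_opsub(1)[OF opsub_L])
  show "acc_on (ring_ideal :: int poly set \<Rightarrow> bool)"
    by (rule acc_on_ring_ideal_poly[OF acc_on_ring_ideal_int])
  show "f * g \<in> annihilator \<Longrightarrow> f \<in> annihilator \<or> g \<in> annihilator" for f g
    by (rule annihilator_prime)
  show "f \<in> annihilator \<Longrightarrow> scale f v \<in> L" for f v by (simp add: annihilator_def)
  show "T g (v + w) = T g v + T g w" if "g \<in> carrier G" for g v w using that by (rule T_add)
  show "T (g \<otimes> h) v = T g (T h v)" if "g \<in> carrier G" "h \<in> carrier G" for g h v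
    using that by (rule T_mult)
  show "T \<one> v = v" for v by (rule T_one)
  show "T g v \<in> L" if "g \<in> carrier G" "v \<in> L" for g v using that by (rule T_L)
  show "T g (scale f v) - scale f (T g v) \<in> L" if "g \<in> carrier G" for g f v using that by (rule scale_T)
qed

text \<open>The same module over the integers with the zero ideal; this instance serves to exclude
  characteristic zero.\<close>

lemma scalar_operators_frag_cmul: "scalar_operators frag_cmul G T L {0}"
proof (rule scalar_operators.intro[OF _ _ scalar_operators_axioms.intro])
  show "Modules.module (frag_cmul :: int \<Rightarrow> ('m \<Rightarrow>\<^sub>0 int) \<Rightarrow> _)" by (rule frag_module.module_axioms)
  show "group G" by (rule group_axioms)
  show "frag_module.subspace L" by (rule subspace_opsub(2)[OF opsub_L])
  show "ring_ideal {0::int}" by (simp add: ring_ideal_def)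
  show "acc_on (ring_ideal :: int set \<Rightarrow> bool)" by (rule acc_on_ring_ideal_int)
  show "T g (frag_cmul r v) - frag_cmul r (T g v) \<in> L" if "g \<in> carrier G" for g r v
    using that L_zero by (simp add: T_cmul)
  show "frag_cmul r v \<in> L" if "r \<in> {0}" for r v using that L_zero by simp
  show "T g (v + w) = T g v + T g w" if "g \<in> carrier G" for g v w using that by (rule T_add)
  show "T (g \<otimes> h) v = T g (T h v)" if "g \<in> carrier G" "h \<in> carrier G" for g h v
    using that by (rule T_mult)
  show "T \<one> v = v" for v by (rule T_one)
  show "T g v \<in> L" if "g \<in> carrier G" "v \<in> L" for g v using that by (rule T_L)
qed simp_all

interpretation ops: scalar_operators scale G T L annihilator
  by (rule scalar_operators_scale)

interpretation int_ops: scalar_operators frag_cmul G T L "{0}"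
  by (rule scalar_operators_frag_cmul)

lemma opsub_if_submod:
  assumes "ops.submod (carrier G) W \<or> int_ops.submod (carrier G) W"
  shows "opsub W"
  using assms
proof
  assume "ops.submod (carrier G) W"
  then show "opsub W"
    using poly_module.subspace_diff[of W] ops.submodD[of "carrier G" W] by (auto simp: opsub_def)
next
  assume "int_ops.submod (carrier G) W"
  then show "opsub W"
    using frag_module.subspace_diff[of W] int_ops.submodD[of "carrier G" W] by (auto simp: opsub_def)
qed

text \<open>Over all of \<open>G\<close> the module is generated by a finite set, so the hull in
  generic reducedness is everything.\<close>

lemma obtain_generic_scalars:
  obtains s t where "s \<notin> annihilator" "ops.reduced s L UNIV" "t \<noteq> 0" "int_ops.reduced t L UNIV"
proof -
  obtain F where F: "finite F" "\<And>W. opsub W \<Longrightarrow> F \<subseteq> W \<Longrightarrow> W = UNIV"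
    using finitely_generated by blast
  obtain K where K: "K \<lhd> G" "polycentral G K (carrier G)" "\<And>k v. k \<in> K \<Longrightarrow> T k v - v \<in> L"
    using polycentral by blast
  have "ops.submod_hull (carrier G) L F = UNIV" "int_ops.submod_hull (carrier G) L F = UNIV"
    using F(2)[OF opsub_if_submod[OF disjI1[OF ops.submod_submod_hull]] ops.hull_superset(2)]
      F(2)[OF opsub_if_submod[OF disjI2[OF int_ops.submod_submod_hull]] int_ops.hull_superset(2)] .
  moreover have "ops.generically_reduced (carrier G)" "int_ops.generically_reduced (carrier G)"
    using ops.generically_reduced_polycentral[OF K(2,1) K(3)]
      int_ops.generically_reduced_polycentral[OF K(2,1) K(3)] by auto
  ultimately show ?thesis
    using that ops.submod_L[of "carrier G"] int_ops.submod_L[of "carrier G"] F(1)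
    unfolding ops.generically_reduced_def int_ops.generically_reduced_def by (metis order_refl singletonI)
qed

lemma units_mod_annihilator:
  obtains s where "s \<notin> annihilator"
    "\<And>p a b. p \<notin> annihilator \<Longrightarrow> a * p + b * s - 1 \<in> annihilator \<Longrightarrow> \<exists>a. a * p - 1 \<in> annihilator"
proof -
  obtain s where s: "s \<notin> annihilator" "ops.reduced s L UNIV" using obtain_generic_scalars by metis
  \<comment> \<open>Comaximality with the product \<open>s * zm1\<close> gives comaximality with
    both factors: with \<open>s\<close> for admissibility, with \<open>zm1\<close> for
    surjectivity.\<close>
  have "\<exists>a. a * p - 1 \<in> annihilator"
    if p: "p \<notin> annihilator" and ab: "a * p + b * (s * zm1) - 1 \<in> annihilator" for p a b
  proof (rule ccontr)
    assume non_unit: "\<nexists>a. a * p - 1 \<in> annihilator"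
    have "a * p + (b * zm1) * s - 1 \<in> annihilator" using ab by (simp only: ac_simps)
    then have adm: "ops.admissible s p" unfolding ops.admissible_def using p non_unit by blast
    let ?W = "{l + scale p v | l v. l \<in> L}"
    note W = opsubD[OF opsub_image[of p]]
    obtain k where "\<forall>v. scale (zm1 ^ k) v \<in> ?W"
      using proper_unipotent[OF opsub_image image_neq_L[OF p]] by (rule exE)
    note k = this[THEN spec]
    have "a * p + (b * s) * zm1 - 1 \<in> annihilator" using ab by (simp only: ac_simps)
    then obtain a' c' where ac: "a' * p + c' * zm1 ^ k - 1 \<in> annihilator"
      using comaximal_power[OF annihilator_ideal] by metis
    \<comment> \<open>Modulo the annihilator \<open>1\<close> is a combination of \<open>p\<close>
      and \<open>zm1 ^ k\<close>, and both map into \<open>?W\<close>.\<close>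
    have "v \<in> ?W" for v
    proof -
      have "scale (a' * p + c' * zm1 ^ k - 1) v \<in> ?W" using ac W(1) by (auto simp: annihilator_def)
      moreover have "scale (c' * zm1 ^ k) v \<in> ?W"
        unfolding scale_mult by (rule opsub_scale[OF opsub_image k])
      moreover have "scale (p * a') v \<in> ?W"
        unfolding scale_mult by (rule scale_in_image)
      ultimately have "scale (p * a') v + scale (c' * zm1 ^ k) v - scale (a' * p + c' * zm1 ^ k - 1) v \<in> ?W"
        by (intro W(3,5))
      then have "scale (p * a' + c' * zm1 ^ k - (a' * p + c' * zm1 ^ k - 1)) v \<in> ?W"
        by (simp only: scale_add_left poly_module.scale_left_diff_distrib)
      moreover have "p * a' + c' * zm1 ^ k - (a' * p + c' * zm1 ^ k - 1) = 1" by (simp add: mult.commute)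
      ultimately show ?thesis by (simp only: poly_module.scale_one)
    qed
    then have "\<exists>w. v - scale p w \<in> L" for v
      by (rule image_remainder)
    then have "\<exists>k. scale (s ^ k) v \<in> L" for v
      using s(2) adm unfolding ops.reduced_def by blast
    then have "v \<in> L" for v using scale_injective[OF annihilator_power[OF s(1)]] by blast
    then show False using L_neq_UNIV by blast
  qed
  moreover have "s * zm1 \<notin> annihilator" using s(1) zm1_notin_annihilator annihilator_prime by blast
  ultimately show ?thesis using that by blast
qed

text \<open>In characteristic zero a large prime \<open>q\<close> would act surjectively: modulo
  \<open>q\<close> the operator \<open>z - 1\<close> is nilpotent, while a relation in the
  annihilator makes a fixed integer \<open>m\<close> divisible by \<open>z - 1\<close>. Generic
  reducedness over the integers then makes the module torsion, although nonzero integers act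
  injectively.\<close>

lemma annihilator_int_nonzero:
  assumes "f \<in> annihilator" "f \<noteq> 0"
  shows "\<exists>n. n \<noteq> 0 \<and> [:n:] \<in> annihilator"
proof (rule ccontr)
  assume neg: "\<not> ?thesis"
  note P = ring_idealD[OF annihilator_ideal]
  obtain t where t: "t \<noteq> 0" "int_ops.reduced t L UNIV" using obtain_generic_scalars by metis
  \<comment> \<open>Least degree ensures that \<open>zm1\<close> does not divide \<open>f0\<close>:
    by primality the cofactor would be a relation of smaller degree. Hence the value of
    \<open>f0\<close> at \<open>1\<close> is nonzero.\<close>
  define f0 where "f0 = arg_min degree (\<lambda>f. f \<in> annihilator \<and> f \<noteq> 0)"
  have f0: "f0 \<in> annihilator" "f0 \<noteq> 0"
    using arg_min_natI[of "\<lambda>f. f \<in> annihilator \<and> f \<noteq> 0" f degree] assms by (auto simp: f0_def)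
  have f0_min: "degree f0 \<le> degree h" if "h \<in> annihilator" "h \<noteq> 0" for h
    using arg_min_nat_le[of "\<lambda>f. f \<in> annihilator \<and> f \<noteq> 0" h degree] that by (auto simp: f0_def)
  define m where "m = poly f0 1"
  have "poly (f0 - [:m:]) 1 = 0" by (simp add: m_def)
  then have "zm1 dvd f0 - [:m:]" by (simp only: poly_eq_0_iff_dvd)
  then obtain h where h: "f0 - [:m:] = zm1 * h" by (rule dvdE)
  have m0: "m \<noteq> 0"
  proof
    assume "m = 0"
    then have "[:m:] = 0" by simp
    with h have fh: "f0 = zm1 * h" by (simp only: diff_zero)
    then have "h \<noteq> 0" using f0(2) by auto
    moreover have "h \<in> annihilator"
      using annihilator_prime[of zm1 h] f0(1)[unfolded fh] zm1_notin_annihilator by blast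
    moreover have "degree f0 = Suc (degree h)"
      unfolding fh using \<open>h \<noteq> 0\<close> by (subst degree_mult_eq) auto
    ultimately show False using f0_min[of h] by simp
  qed
  \<comment> \<open>Too large to divide \<open>t * m\<close>: being prime to \<open>t\<close> makes
    \<open>q\<close> admissible, being prime to \<open>m\<close> allows the Bezout argument.\<close>
  obtain q :: nat where q: "Factorial_Ring.prime q" "q > nat (\<bar>t * m\<bar>)" using bigger_prime by blast
  have tm: "t * m \<noteq> 0" using t m0 by simp
  have "\<not> int q dvd t * m"
  proof
    assume "int q dvd t * m"
    then have "\<bar>int q\<bar> \<le> \<bar>t * m\<bar>" using tm by (rule dvd_imp_le_int[rotated])
    then show False using q(2) by linarith
  qed
  then have cop: "coprime (int q) (t * m)" using q(1) by (intro prime_imp_coprime) auto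
  then have "coprime (int q) t" and qm: "coprime (int q) m" by (simp_all add: coprime_mult_right_iff)
  then obtain a b where ab: "a * int q + b * t = 1"
    using bezout_int[of "int q" t] by (metis coprime_imp_gcd_eq_1)
  have "\<not> int q dvd 1" using q(1) by (simp add: prime_nat_iff)
  then have "a * int q - 1 \<noteq> 0" for a by (metis dvd_triv_right eq_iff_diff_eq_0)
  moreover have "a * int q + b * t - 1 \<in> {0}" using ab by simp
  moreover have "int q \<notin> {0}" using prime_gt_0_nat[OF q(1)] by simp
  ultimately have adm: "int_ops.admissible t (int q)"
    unfolding int_ops.admissible_def by blast
  have q_P: "[:int q:] \<notin> annihilator" using neg q(1) by (metis not_prime_0 of_nat_eq_0_iff)
  let ?W = "{l + scale [:int q:] v | l v. l \<in> L}"
  note W = opsubD[OF opsub_image[of "[:int q:]"]]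
  obtain k where "\<forall>v. scale (zm1 ^ k) v \<in> ?W"
    using proper_unipotent[OF opsub_image image_neq_L[OF q_P]] by (rule exE)
  note k = this[THEN spec]
  have "coprime (int q) (m ^ k)" using qm by simp
  then obtain a b where ab: "a * int q + b * m ^ k = 1"
    using bezout_int[of "int q" "m ^ k"] by (metis coprime_imp_gcd_eq_1)
  \<comment> \<open>Modulo \<open>f0\<close> the constant \<open>m\<close> equals
    \<open>- h * zm1\<close>, so \<open>m ^ k\<close> maps the module into \<open>?W\<close> along
    with \<open>zm1 ^ k\<close>.\<close>
  have "[:m:] ^ k - (- h * zm1) ^ k \<in> annihilator"
  proof -
    have "f0 = [:m:] + zm1 * h" using h by (metis add.commute diff_add_cancel)
    then have "[:m:] - (- h * zm1) = f0"
      by (simp only: minus_mult_left[symmetric] diff_minus_eq_add mult.commute)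
    moreover have "[:m:] - (- h * zm1) dvd [:m:] ^ k - (- h * zm1) ^ k"
      unfolding power_diff_sumr2 by (rule dvd_triv_left)
    ultimately show ?thesis using P(4)[OF f0(1)] by (metis dvdE)
  qed
  then have mk: "[:m ^ k:] - (- h) ^ k * zm1 ^ k \<in> annihilator"
    by (simp only: power_mult_distrib poly_const_pow)
  have in_W: "v \<in> ?W" for v
  proof -
    have "scale ([:m ^ k:] - (- h) ^ k * zm1 ^ k) v + scale ((- h) ^ k) (scale (zm1 ^ k) v) \<in> ?W"
      using mk W(1) opsub_scale[OF opsub_image k] by (intro W(5)) (auto simp: annihilator_def)
    then have mW: "frag_cmul (m ^ k) v \<in> ?W"
      by (simp only: poly_module.scale_left_diff_distrib scale_mult diff_add_cancel scale_const)
    have "frag_cmul (int q) v \<in> ?W" unfolding scale_const[symmetric] by (rule scale_in_image)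
    from W(5)[OF W(7)[OF this] W(7)[OF mW]]
    have "frag_cmul a (frag_cmul (int q) v) + frag_cmul b (frag_cmul (m ^ k) v) \<in> ?W" .
    then have "frag_cmul (a * int q + b * m ^ k) v \<in> ?W" by (simp add: frag_cmul_distrib)
    then show ?thesis using ab by simp
  qed
  then have "\<exists>w. v - frag_cmul (int q) w \<in> L" for v
    unfolding scale_const[symmetric] by (rule image_remainder)
  then have tor: "\<exists>k. frag_cmul (t ^ k) v \<in> L" for v
    using t(2) adm unfolding int_ops.reduced_def by blast
  have "v \<in> L" for v
  proof -
    obtain k where "scale [:t ^ k:] v \<in> L" using tor scale_const by metis
    moreover have "t ^ k \<noteq> 0" using t(1) by simp
    then have "[:t ^ k:] \<notin> annihilator" using neg by blast
    ultimately show ?thesis using scale_injective by blast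
  qed
  then show False using L_neq_UNIV by blast
qed

theorem central_element_structure:
  obtains p n where "Factorial_Ring.prime p" "\<And>v. frag_cmul p v \<in> L"
    "n > 0" "\<And>v. T (z [^] (n::nat)) v - v \<in> L" "\<And>W. opsub W \<Longrightarrow> W \<noteq> L \<Longrightarrow> W = UNIV"
proof -
  note P = annihilator_ideal annihilator_one annihilator_prime
  note id = ring_idealD[OF annihilator_ideal]
  obtain f i where f: "f \<in> annihilator" "[:coeff f i:] \<notin> annihilator"
    using units_mod_annihilator not_extended_ideal[OF P] by metis
  then have "f \<noteq> 0" using id(1) by auto
  then obtain n where n: "n \<noteq> 0" "[:n:] \<in> annihilator" using annihilator_int_nonzero f(1) by blast
  define c where "c = {n. [:n:] \<in> annihilator}"
  have c: "ring_ideal c" unfolding c_def by (rule ring_ideal_constants[OF annihilator_ideal])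
  have one_c: "1 \<notin> c" using annihilator_one by (simp add: c_def one_pCons)
  have prime_c: "a \<in> c \<or> b \<in> c" if "a * b \<in> c" for a b
    using that annihilator_prime[of "[:a:]" "[:b:]"] unfolding c_def const_poly_mult by blast
  have "n \<in> c" using n(2) by (simp add: c_def)
  then obtain p where p: "Factorial_Ring.prime p" "p \<in> c"
    using prime_ideal_int_contains_prime[OF c one_c _ n(1) prime_c] by blast
  have pP: "[:p:] \<in> annihilator" using p by (simp add: c_def)
  have "\<not> p dvd coeff f i"
    using f(2) ring_idealD(4)[OF c p(2)] by (auto simp: c_def dvd_def)
  note period = power_eq_one_mod_prime_ideal[OF P p(1) pP f(1) this]
  \<comment> \<open>The indeterminate acts as the invertible operator \<open>T z\<close>, so it is
    nonzero in the residue ring and some positive power of it is \<open>1\<close> there.\<close>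
  have "[:0, 1:] \<notin> annihilator"
  proof
    assume "[:0, 1:] \<in> annihilator"
    then have "T z v \<in> L" for v using scale_monom[of 1] z by (auto simp: annihilator_def)
    then have "T (inv z) (T z v) \<in> L" for v using T_L[OF inv_closed[OF z]] by blast
    moreover have "T (inv z) (T z v) = v" for v using z by (simp add: T_one T_mult[symmetric])
    ultimately have "v \<in> L" for v by metis
    then show False using L_neq_UNIV by blast
  qed
  then obtain n where n: "n > 0" "[:0, 1:] ^ n - 1 \<in> annihilator" using period by metis
  \<comment> \<open>The period of \<open>zm1\<close> yields irreducibility: on a proper quotient
    \<open>z - 1\<close> is nilpotent, but its \<open>j\<close>-th power is the identity.\<close>
  obtain j where j: "j > 0" "zm1 ^ j - 1 \<in> annihilator" using period zm1_notin_annihilator by metis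
  have z_n: "T (z [^] n) v - v \<in> L" for v
    using n(2) by (simp add: annihilator_def poly_module.scale_left_diff_distrib scale_monom)
  have p_L: "frag_cmul p v \<in> L" for v using pP by (simp add: annihilator_def scale_const)
  have "W = UNIV" if W: "opsub W" "W \<noteq> L" for W
  proof -
    obtain k where "\<forall>v. scale (zm1 ^ k) v \<in> W" using proper_unipotent[OF W] by (rule exE)
    note k = this[THEN spec]
    have "v \<in> W" for v
    proof -
      have "k \<le> j * k" using j by simp
      then have "scale (zm1 ^ (j * k)) v = scale (zm1 ^ (j * k - k)) (scale (zm1 ^ k) v)"
        by (simp only: scale_mult[symmetric] power_add[symmetric] le_add_diff_inverse2)
      then have 1: "scale (zm1 ^ (j * k)) v \<in> W" using opsub_scale[OF W(1) k] by simp
      have "zm1 ^ j - 1 dvd (zm1 ^ j) ^ k - 1 ^ k"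
        unfolding power_diff_sumr2 by (rule dvd_triv_left)
      then have "(zm1 ^ j) ^ k - 1 \<in> annihilator" using id(4)[OF j(2)] by (metis dvdE power_one)
      then have "scale (zm1 ^ (j * k)) v - v \<in> L"
        by (simp add: annihilator_def poly_module.scale_left_diff_distrib power_mult)
      then have "scale (zm1 ^ (j * k)) v - (scale (zm1 ^ (j * k)) v - v) \<in> W"
        using opsubD(1,3)[OF W(1)] 1 by blast
      then show ?thesis by simp
    qed
    then show ?thesis by blast
  qed
  then show ?thesis using that p(1) p_L n(1) z_n by blast
qed

end

section \<open>Abelian operator groups\<close>

locale operator_group = group G + A: comm_group A
  for G :: "('g, 'b) monoid_scheme" (structure) and A :: "('m, 'c) monoid_scheme" +
  fixes \<alpha> :: "'g \<Rightarrow> 'm \<Rightarrow> 'm"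
  assumes action_hom: "g \<in> carrier G \<Longrightarrow> \<alpha> g \<in> hom A A"
    and action_mult: "g \<in> carrier G \<Longrightarrow> h \<in> carrier G \<Longrightarrow> a \<in> carrier A \<Longrightarrow> \<alpha> (g \<otimes> h) a = \<alpha> g (\<alpha> h a)"
    and action_one: "a \<in> carrier A \<Longrightarrow> \<alpha> \<one> a = a"
begin

lemma action_closed: "g \<in> carrier G \<Longrightarrow> a \<in> carrier A \<Longrightarrow> \<alpha> g a \<in> carrier A"
  using action_hom by (auto simp: hom_def)

lemma action_distrib:
  "g \<in> carrier G \<Longrightarrow> a \<in> carrier A \<Longrightarrow> b \<in> carrier A \<Longrightarrow> \<alpha> g (a \<otimes>\<^bsub>A\<^esub> b) = \<alpha> g a \<otimes>\<^bsub>A\<^esub> \<alpha> g b"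
  using action_hom by (auto simp: hom_def)

lemma action_group_hom: "g \<in> carrier G \<Longrightarrow> group_hom A A (\<alpha> g)"
  using action_hom by unfold_locales

lemma action_unit: "g \<in> carrier G \<Longrightarrow> \<alpha> g \<one>\<^bsub>A\<^esub> = \<one>\<^bsub>A\<^esub>"
  using group_hom.hom_one[OF action_group_hom] .

lemma action_inv: "g \<in> carrier G \<Longrightarrow> a \<in> carrier A \<Longrightarrow> \<alpha> g (inv\<^bsub>A\<^esub> a) = inv\<^bsub>A\<^esub> (\<alpha> g a)"
  using group_hom.hom_inv[OF action_group_hom] .

definition invariant_subgroup :: "'m set \<Rightarrow> bool" where
  "invariant_subgroup B \<longleftrightarrow> subgroup B A \<and> (\<forall>g\<in>carrier G. \<forall>b\<in>B. \<alpha> g b \<in> B)"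

definition fixed_mod :: "'m set \<Rightarrow> 'm set" where
  "fixed_mod B = {a \<in> carrier A. \<forall>g\<in>carrier G. \<alpha> g a \<otimes>\<^bsub>A\<^esub> inv\<^bsub>A\<^esub> a \<in> B}"

definition action_kernel :: "'g set" where
  "action_kernel = {g \<in> carrier G. \<forall>a\<in>carrier A. \<alpha> g a = a}"

lemma action_kernel_normal: "action_kernel \<lhd> G"
proof (rule normal_invI)
  show "subgroup action_kernel G"
  proof (rule subgroup.intro)
    show "inv x \<in> action_kernel" if x: "x \<in> action_kernel" for x
    proof -
      have "\<alpha> (inv x) a = a" if "a \<in> carrier A" for a
      proof -
        have "\<alpha> (inv x) (\<alpha> x a) = \<alpha> (inv x \<otimes> x) a"
          using x that by (intro action_mult[symmetric]) (auto simp: action_kernel_def)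
        then show ?thesis using x that by (simp add: action_kernel_def action_one)
      qed
      then show ?thesis using x by (simp add: action_kernel_def)
    qed
  qed (auto simp: action_kernel_def action_mult action_one)
  show "x \<otimes> h \<otimes> inv x \<in> action_kernel" if x: "x \<in> carrier G" and h: "h \<in> action_kernel" for x h
  proof -
    have hc: "h \<in> carrier G" using h by (simp add: action_kernel_def)
    have "\<alpha> (x \<otimes> h \<otimes> inv x) a = a" if a: "a \<in> carrier A" for a
    proof -
      have "\<alpha> (x \<otimes> h \<otimes> inv x) a = \<alpha> x (\<alpha> h (\<alpha> (inv x) a))"
        using x hc a by (simp add: action_mult action_closed)
      also have "\<dots> = \<alpha> x (\<alpha> (inv x) a)"
        using h x a action_closed[of "inv x" a] by (simp add: action_kernel_def)
      also have "\<dots> = a" using x a by (simp add: action_one flip: action_mult)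
      finally show ?thesis .
    qed
    then show ?thesis using x hc by (simp add: action_kernel_def)
  qed
qed

lemma action_cong_coset:
  assumes "g \<in> carrier G" "h \<in> carrier G" "action_kernel #> g = action_kernel #> h" "a \<in> carrier A"
  shows "\<alpha> g a = \<alpha> h a"
proof -
  have "g \<in> action_kernel #> h"
    using rcos_self[OF assms(1) normal_imp_subgroup[OF action_kernel_normal]] assms(3) by simp
  then obtain k where k: "k \<in> action_kernel" "g = k \<otimes> h" by (auto simp: r_coset_def)
  then show ?thesis using assms(2,4) by (simp add: action_kernel_def action_mult action_closed)
qed

lemma commuting_action_if_commutator:
  assumes "z \<in> carrier G" "g \<in> carrier G" "z \<otimes> g \<otimes> inv z \<otimes> inv g \<in> action_kernel" "a \<in> carrier A"
  shows "\<alpha> g (\<alpha> z a) = \<alpha> z (\<alpha> g a)"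
proof -
  have "z \<otimes> g = (z \<otimes> g \<otimes> inv z \<otimes> inv g) \<otimes> (g \<otimes> z)"
    using assms(1,2) by (simp add: word_simps)
  then have "\<alpha> (z \<otimes> g) a = \<alpha> (z \<otimes> g \<otimes> inv z \<otimes> inv g) (\<alpha> (g \<otimes> z) a)"
    using assms by (metis action_mult inv_closed m_closed)
  also have "\<dots> = \<alpha> (g \<otimes> z) a"
    using assms action_closed[of "g \<otimes> z" a] by (simp add: action_kernel_def)
  finally show ?thesis using assms by (simp add: action_mult)
qed

text \<open>Elements off the carrier are fixed, so that \<open>T \<one>\<close> is the identity on
  the whole free group; \<open>retract\<close> sends their generators to the unit, so they vanish in
  the quotient.\<close>

definition extended_action :: "'g \<Rightarrow> 'm \<Rightarrow> 'm" where
  "extended_action g k = (if k \<in> carrier A then \<alpha> g k else k)"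

definition T :: "'g \<Rightarrow> ('m \<Rightarrow>\<^sub>0 int) \<Rightarrow> ('m \<Rightarrow>\<^sub>0 int)" where
  "T g = frag_extend (frag_of \<circ> extended_action g)"

definition retract :: "'m \<Rightarrow> 'm" where
  "retract k = (if k \<in> carrier A then k else \<one>\<^bsub>A\<^esub>)"

text \<open>The canonical epimorphism from the free abelian group onto \<open>A\<close>, which
  connects the multiplicative \<open>A\<close> with the additive presentation.\<close>

definition ev :: "('m \<Rightarrow>\<^sub>0 int) \<Rightarrow> 'm" where
  "ev u = (\<Otimes>\<^bsub>A\<^esub>k\<in>Poly_Mapping.keys u. retract k [^]\<^bsub>A\<^esub> Poly_Mapping.lookup u k)"

lemma retract_closed: "retract k \<in> carrier A"
  by (simp add: retract_def)

lemma ev_superset: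
  assumes "finite S" "Poly_Mapping.keys u \<subseteq> S"
  shows "ev u = (\<Otimes>\<^bsub>A\<^esub>k\<in>S. retract k [^]\<^bsub>A\<^esub> Poly_Mapping.lookup u k)"
  unfolding ev_def
  by (rule A.finprod_mono_neutral_cong_left) (use assms retract_closed in \<open>auto simp: in_keys_iff\<close>)

lemma ev_closed: "ev u \<in> carrier A"
  unfolding ev_def by (rule A.finprod_closed) (auto simp: retract_closed)

lemma ev_add: "ev (u + v) = ev u \<otimes>\<^bsub>A\<^esub> ev v"
proof -
  let ?S = "Poly_Mapping.keys u \<union> Poly_Mapping.keys v"
  have "ev (u + v) = (\<Otimes>\<^bsub>A\<^esub>k\<in>?S. retract k [^]\<^bsub>A\<^esub> Poly_Mapping.lookup (u + v) k)"
    by (rule ev_superset) (use keys_add[of u v] in auto)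
  also have "\<dots> = (\<Otimes>\<^bsub>A\<^esub>k\<in>?S. retract k [^]\<^bsub>A\<^esub> Poly_Mapping.lookup u k \<otimes>\<^bsub>A\<^esub> retract k [^]\<^bsub>A\<^esub> Poly_Mapping.lookup v k)"
    by (rule A.finprod_cong') (auto simp: retract_closed lookup_add A.int_pow_mult)
  also have "\<dots> = ev u \<otimes>\<^bsub>A\<^esub> ev v"
    by (subst A.finprod_multf) (auto simp: retract_closed ev_superset[of ?S u] ev_superset[of ?S v])
  finally show ?thesis .
qed

lemma ev_zero: "ev 0 = \<one>\<^bsub>A\<^esub>"
  by (simp add: ev_def)

lemma ev_frag_of: "ev (frag_of k) = retract k"
  using retract_closed[of k] by (simp add: ev_def A.int_pow_1)

lemma ev_diff: "ev (u - v) = ev u \<otimes>\<^bsub>A\<^esub> inv\<^bsub>A\<^esub> ev v"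
proof -
  have "ev (u - v) \<otimes>\<^bsub>A\<^esub> ev v = ev u" using ev_add[of "u - v" v] by simp
  then show ?thesis using ev_closed A.inv_solve_right by metis
qed

lemma ev_T:
  assumes "g \<in> carrier G"
  shows "ev (T g u) = \<alpha> g (ev u)"
proof -
  have "Poly_Mapping.keys u \<subseteq> UNIV" by simp
  then show ?thesis
  proof (induction u rule: frag_induction)
    case zero
    then show ?case by (simp add: T_def ev_zero action_unit assms)
  next
    case (one k)
    then show ?case
      using assms by (simp add: T_def ev_frag_of retract_def extended_action_def action_unit action_closed)
  next
    case (diff u v)
    have "ev (T g (u - v)) = ev (T g u) \<otimes>\<^bsub>A\<^esub> inv\<^bsub>A\<^esub> ev (T g v)"
      unfolding T_def frag_extend_diff by (rule ev_diff)
    then show ?case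
      using diff assms by (simp add: ev_diff action_distrib action_inv ev_closed)
  qed
qed

lemma ev_cmul: "ev (frag_cmul c u) = ev u [^]\<^bsub>A\<^esub> c"
proof (induction c rule: int_induct[of _ 0])
  case (step1 i)
  then show ?case by (simp add: frag_cmul_distrib ev_add A.int_pow_mult ev_closed A.int_pow_1)
next
  case (step2 i)
  then show ?case by (simp add: frag_cmul_diff_distrib ev_diff A.int_pow_diff ev_closed A.int_pow_1)
qed (simp add: ev_zero)

abbreviation L :: "('m \<Rightarrow>\<^sub>0 int) set" where
  "L \<equiv> {u. ev u = \<one>\<^bsub>A\<^esub>}"

lemma diff_mem_L_iff: "u - v \<in> L \<longleftrightarrow> ev u = ev v"
  using ev_closed by (simp add: ev_diff A.inv_solve_right')

sublocale frag_operators G T L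
proof unfold_locales
  show "T g (u + v) = T g u + T g v" for g u v by (simp add: T_def frag_extend_add)
  show "T (g \<otimes> h) u = T g (T h u)" if "g \<in> carrier G" "h \<in> carrier G" for g h u
  proof -
    have "extended_action (g \<otimes> h) = extended_action g \<circ> extended_action h"
      using that by (auto simp: extended_action_def action_mult action_closed)
    then show ?thesis unfolding T_def frag_extend_compose by (simp add: comp_assoc)
  qed
  show "T \<one> u = u" for u
  proof -
    have "frag_of \<circ> extended_action \<one> = frag_of" by (auto simp: extended_action_def action_one)
    then show ?thesis by (simp add: T_def flip: frag_expansion)
  qed
qed (auto simp: ev_zero ev_diff ev_T action_unit)

lemma ev_surj:
  assumes "a \<in> carrier A"
  obtains u where "ev u = a"
  using that[of "frag_of a"] assms by (simp add: ev_frag_of retract_def)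

definition preimage :: "'m set \<Rightarrow> ('m \<Rightarrow>\<^sub>0 int) set" where
  "preimage B = {u. ev u \<in> B}"

lemma preimage_inject:
  assumes "B \<subseteq> carrier A" "C \<subseteq> carrier A" "preimage B = preimage C"
  shows "B = C"
proof -
  have "B \<subseteq> C" if BC: "preimage B = preimage C" "B \<subseteq> carrier A" for B C
  proof
    fix b assume b: "b \<in> B"
    then have "b \<in> carrier A" using BC(2) by blast
    then obtain u where u: "ev u = b" by (rule ev_surj)
    then have "u \<in> preimage B" using b by (simp add: preimage_def)
    then show "b \<in> C" using u unfolding BC(1) by (simp add: preimage_def)
  qed
  then show ?thesis using assms(1,2) assms(3)[symmetric] assms(3) by (intro subset_antisym)
qed

lemma inv_mod_preimage: "inv_mod (preimage B) = preimage (fixed_mod B)"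
  by (auto simp: inv_mod_def preimage_def fixed_mod_def ev_diff ev_T ev_closed)

lemma inv_mod_funpow_preimage: "(inv_mod ^^ k) (preimage B) = preimage ((fixed_mod ^^ k) B)"
  by (induction k) (simp_all add: inv_mod_preimage)

lemma opsub_preimage:
  assumes "invariant_subgroup B"
  shows "opsub (preimage B)"
proof -
  have B: "subgroup B A" using assms by (simp add: invariant_subgroup_def)
  have "ev u \<otimes>\<^bsub>A\<^esub> inv\<^bsub>A\<^esub> ev v \<in> B" if "ev u \<in> B" "ev v \<in> B" for u v
    using subgroup.m_closed[OF B] subgroup.m_inv_closed[OF B] that by blast
  then show ?thesis
    using assms subgroup.one_closed[OF B]
    by (auto simp: opsub_def preimage_def ev_diff ev_T invariant_subgroup_def)
qed

text \<open>Correspondence theorem for \<open>ev\<close>: a set with \<open>opsub W\<close> contains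
  the kernel \<open>L\<close>, so it is saturated.\<close>

lemma opsub_eq_preimage:
  assumes "opsub W"
  shows "invariant_subgroup (ev ` W)" "W = preimage (ev ` W)"
proof -
  note W = opsubD[OF assms]
  show "W = preimage (ev ` W)"
  proof
    show "preimage (ev ` W) \<subseteq> W"
    proof
      fix u assume "u \<in> preimage (ev ` W)"
      then obtain w where w: "w \<in> W" "ev u = ev w" by (auto simp: preimage_def)
      then have "u - w \<in> W" using diff_mem_L_iff[of u w] W(1) by blast
      then show "u \<in> W" using W(5)[OF _ w(1)] by force
    qed
  qed (auto simp: preimage_def)
  have "subgroup (ev ` W) A"
  proof (rule subgroup.intro)
    show "\<one>\<^bsub>A\<^esub> \<in> ev ` W" using W(2) ev_zero by force
    show "x \<otimes>\<^bsub>A\<^esub> y \<in> ev ` W" if xy: "x \<in> ev ` W" "y \<in> ev ` W" for x y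
    proof -
      obtain v w where vw: "v \<in> W" "x = ev v" "w \<in> W" "y = ev w" using xy by blast
      then have "x \<otimes>\<^bsub>A\<^esub> y = ev (v + w)" by (simp only: ev_add)
      then show ?thesis using W(5)[OF vw(1,3)] by (rule image_eqI)
    qed
    show "inv\<^bsub>A\<^esub> x \<in> ev ` W" if x: "x \<in> ev ` W" for x
    proof -
      obtain w where w: "w \<in> W" "x = ev w" using x by blast
      have "ev (0 - w) = inv\<^bsub>A\<^esub> x" unfolding ev_diff ev_zero w(2) by (simp add: ev_closed)
      moreover have "0 - w \<in> W" by (rule W(3)[OF W(2) w(1)])
      ultimately show ?thesis by (metis image_eqI)
    qed
  qed (auto simp: ev_closed)
  moreover have "\<alpha> g b \<in> ev ` W" if g: "g \<in> carrier G" and b: "b \<in> ev ` W" for g b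
  proof -
    obtain w where "w \<in> W" "b = ev w" using b by blast
    then show ?thesis using W(6)[OF g] ev_T[OF g, symmetric] by simp
  qed
  ultimately show "invariant_subgroup (ev ` W)" by (simp add: invariant_subgroup_def)
qed

lemma invariant_subgroup_subset: "invariant_subgroup B \<Longrightarrow> B \<subseteq> carrier A"
  by (simp add: invariant_subgroup_def subgroup.subset)

lemma fixed_mod_funpow_subset: "B \<subseteq> carrier A \<Longrightarrow> (fixed_mod ^^ k) B \<subseteq> carrier A"
  by (cases k) (auto simp: fixed_mod_def)

lemma preimage_carrier: "preimage (carrier A) = UNIV"
  by (simp add: preimage_def ev_closed)

lemma preimage_trivial: "preimage {\<one>\<^bsub>A\<^esub>} = L"
  by (simp add: preimage_def)

end

section \<open>Finiteness of the acting group and of the module\<close>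

lemma (in comm_group) finite_generate_torsion:
  assumes "finite S" "S \<subseteq> carrier G" "p > 0" "\<And>s. s \<in> S \<Longrightarrow> s [^] (p::nat) = \<one>"
  shows "finite (generate G S)"
  using assms(1,2,4)
proof (induction S rule: finite_induct)
  case empty then show ?case by (simp add: generate_empty)
next
  case (insert s S)
  have s: "s \<in> carrier G" and sp: "s [^] p = \<one>" and S: "S \<subseteq> carrier G" using insert.prems by auto
  note gen = generate_in_carrier[OF S]
  \<comment> \<open>Commutativity collects the powers of \<open>s\<close> in front; natural
    exponents suffice because \<open>s [^] (p - 1)\<close> inverts \<open>s\<close>.\<close>
  let ?D = "{s [^] (i::nat) \<otimes> t | i t. t \<in> generate G S}"
  have D: "g \<in> ?D" if "g \<in> generate G (insert s S)" for g
    using that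
  proof (induction rule: generate.induct)
    case one
    have "\<one> = s [^] (0::nat) \<otimes> \<one>" by simp
    then show ?case using generate.one by blast
  next
    case (incl h)
    show ?case
    proof (cases "h = s")
      case True
      then have "h = s [^] (1::nat) \<otimes> \<one>" using s by simp
      then show ?thesis using generate.one by blast
    next
      case False
      then have "h \<in> generate G S" using incl by (auto intro: generate.incl)
      moreover from this have "h = s [^] (0::nat) \<otimes> h" using gen by simp
      ultimately show ?thesis by blast
    qed
  next
    case (inv h)
    show ?case
    proof (cases "h = s")
      case True
      have "s [^] (p - 1) \<otimes> s = s [^] Suc (p - 1)" by simp
      then have "s [^] (p - 1) \<otimes> s = \<one>" using sp assms(3) by simp
      then have "inv h = s [^] (p - 1) \<otimes> \<one>" using True s by (simp add: inv_equality)
      then show ?thesis using generate.one by blast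
    next
      case False
      then have "inv h \<in> generate G S" using inv by (auto intro: generate.inv)
      moreover from this have "inv h = s [^] (0::nat) \<otimes> inv h" using gen[of "inv h"] by simp
      ultimately show ?thesis by blast
    qed
  next
    case (eng h1 h2)
    then obtain i1 t1 i2 t2 where *: "h1 = s [^] (i1::nat) \<otimes> t1" "t1 \<in> generate G S"
      "h2 = s [^] (i2::nat) \<otimes> t2" "t2 \<in> generate G S" by blast
    then have "h1 \<otimes> h2 = s [^] (i1 + i2) \<otimes> (t1 \<otimes> t2)"
      using s gen by (simp add: nat_pow_mult[symmetric] m_ac)
    then show ?case using generate.eng[OF *(2,4)] by blast
  qed
  have mod_p: "s [^] i = s [^] (i mod p)" for i :: nat
  proof -
    have "s [^] (p * (i div p) + i mod p) = s [^] (i mod p)"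
      using s sp by (simp only: nat_pow_mult[symmetric] nat_pow_pow[symmetric] nat_pow_one l_one nat_pow_closed)
    then show ?thesis by simp
  qed
  have "generate G (insert s S) \<subseteq> (\<lambda>(i, t). s [^] i \<otimes> t) ` ({..<p} \<times> generate G S)"
  proof
    fix g assume "g \<in> generate G (insert s S)"
    then obtain i t where it: "g = s [^] (i::nat) \<otimes> t" "t \<in> generate G S" using D by blast
    then have "g = s [^] (i mod p) \<otimes> t" by (simp only: mod_p[of i])
    then show "g \<in> (\<lambda>(i, t). s [^] i \<otimes> t) ` ({..<p} \<times> generate G S)"
      using assms(3) it(2) by (intro image_eqI[where x = "(i mod p, t)"]) auto
  qed
  then show ?case by (rule finite_subset) (use insert in auto)
qed

locale just_non_nilpotent_group = operator_group G A \<alpha>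
  for G :: "('g, 'b) monoid_scheme" (structure) and A :: "('m, 'c) monoid_scheme" and \<alpha> +
  assumes action_not_nilpotent: "(fixed_mod ^^ k) {\<one>\<^bsub>A\<^esub>} \<noteq> carrier A"
    and action_proper_nilpotent: "invariant_subgroup B \<Longrightarrow> B \<noteq> {\<one>\<^bsub>A\<^esub>} \<Longrightarrow> \<exists>k. (fixed_mod ^^ k) B = carrier A"
    and operator_finitely_generated:
      "\<exists>F. finite F \<and> F \<subseteq> carrier A \<and> (\<forall>B. invariant_subgroup B \<longrightarrow> F \<subseteq> B \<longrightarrow> B = carrier A)"
    and polycentral_trivial: "\<exists>K. K \<lhd> G \<and> polycentral G K (carrier G) \<and> K \<subseteq> action_kernel"
    and group_finitely_generated: "\<exists>S. finite S \<and> S \<subseteq> carrier G \<and> generate G S = carrier G"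
begin

sublocale just_non_nilpotent G T L
proof unfold_locales
  show "(inv_mod ^^ k) L \<noteq> UNIV" for k
    using action_not_nilpotent[of k] preimage_inject[OF fixed_mod_funpow_subset order_refl, of "{\<one>\<^bsub>A\<^esub>}" k]
    unfolding preimage_trivial[symmetric] inv_mod_funpow_preimage preimage_carrier by auto
  show "\<exists>k. (inv_mod ^^ k) W = UNIV" if W: "opsub W" "W \<noteq> L" for W
  proof -
    have "ev ` W \<noteq> {\<one>\<^bsub>A\<^esub>}" using opsub_eq_preimage(2)[OF W(1)] W(2) preimage_trivial by metis
    then obtain k where "(fixed_mod ^^ k) (ev ` W) = carrier A"
      using action_proper_nilpotent opsub_eq_preimage(1)[OF W(1)] by blast
    then have "(inv_mod ^^ k) W = UNIV"
      using inv_mod_funpow_preimage opsub_eq_preimage(2)[OF W(1)] preimage_carrier by metis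
    then show ?thesis by blast
  qed
  obtain F where F: "finite F" "F \<subseteq> carrier A" "\<And>B. invariant_subgroup B \<Longrightarrow> F \<subseteq> B \<Longrightarrow> B = carrier A"
    using operator_finitely_generated by blast
  show "\<exists>F. finite F \<and> (\<forall>W. opsub W \<longrightarrow> F \<subseteq> W \<longrightarrow> W = UNIV)"
  proof (intro exI conjI allI impI)
    show "finite (frag_of ` F)" using F(1) by simp
    fix W assume W: "opsub W" "frag_of ` F \<subseteq> W"
    have "a \<in> ev ` W" if "a \<in> F" for a
    proof -
      have "frag_of a \<in> W" "a = ev (frag_of a)"
        using that F(2) W(2) by (auto simp: ev_frag_of retract_def)
      then show ?thesis by (rule rev_image_eqI)
    qed
    then have "ev ` W = carrier A" using F(3) opsub_eq_preimage(1)[OF W(1)] by blast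
    then show "W = UNIV" using opsub_eq_preimage(2)[OF W(1)] preimage_carrier by simp
  qed
  show "\<exists>K. K \<lhd> G \<and> polycentral G K (carrier G) \<and> (\<forall>k\<in>K. \<forall>v. T k v - v \<in> L)"
  proof -
    obtain K where K: "K \<lhd> G" "polycentral G K (carrier G)" "K \<subseteq> action_kernel"
      using polycentral_trivial by blast
    have "T k v - v \<in> L" if "k \<in> K" for k v
      using K(3) that ev_closed unfolding diff_mem_L_iff
      by (auto simp: ev_T action_kernel_def)
    then show ?thesis using K by blast
  qed
qed

end

lemma (in group) subgroup_nat_pow_closed:
  assumes "subgroup H G" "x \<in> H"
  shows "x [^] (n::nat) \<in> H"
  by (induction n) (use assms in \<open>simp_all add: subgroup.one_closed subgroup.m_closed\<close>)

context just_non_nilpotent_group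
begin

lemma central_element_action:
  assumes z: "z \<in> carrier G" "z \<notin> action_kernel"
    and comm: "\<And>g. g \<in> carrier G \<Longrightarrow> z \<otimes> g \<otimes> inv z \<otimes> inv g \<in> action_kernel"
  obtains p n :: nat where "Factorial_Ring.prime p" "\<And>a. a \<in> carrier A \<Longrightarrow> a [^]\<^bsub>A\<^esub> p = \<one>\<^bsub>A\<^esub>"
    "n > 0" "z [^] n \<in> action_kernel"
    "\<And>B. invariant_subgroup B \<Longrightarrow> B \<noteq> {\<one>\<^bsub>A\<^esub>} \<Longrightarrow> B = carrier A"
proof -
  interpret z: central_element G T L z
  proof unfold_locales
    show "T g (T z v) - T z (T g v) \<in> L" if g: "g \<in> carrier G" for g v
    proof -
      have "\<alpha> g (\<alpha> z (ev v)) = \<alpha> z (\<alpha> g (ev v))"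
        by (rule commuting_action_if_commutator[OF z(1) g comm[OF g] ev_closed])
      then show ?thesis unfolding diff_mem_L_iff ev_T[OF g] ev_T[OF z(1)] .
    qed
    obtain a where "a \<in> carrier A" "\<alpha> z a \<noteq> a" using z by (auto simp: action_kernel_def)
    moreover from this obtain u where "ev u = a" using ev_surj by blast
    ultimately show "\<exists>v. T z v - v \<notin> L" unfolding diff_mem_L_iff using ev_T[OF z(1)] by metis
  qed (rule z(1))
  obtain p n where pn: "Factorial_Ring.prime p" "\<And>v. frag_cmul p v \<in> L"
    "n > 0" "\<And>v. T (z [^] (n::nat)) v - v \<in> L" "\<And>W. opsub W \<Longrightarrow> W \<noteq> L \<Longrightarrow> W = UNIV"
    using z.central_element_structure by blast
  have p_nat: "int (nat p) = p" using prime_ge_0_int[OF pn(1)] by simp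
  have "Factorial_Ring.prime (nat p)" using pn(1) prime_nat_iff_prime by blast
  moreover have "a [^]\<^bsub>A\<^esub> nat p = \<one>\<^bsub>A\<^esub>" if a: "a \<in> carrier A" for a
  proof -
    obtain u where u: "ev u = a" using ev_surj[OF a] .
    have "a [^]\<^bsub>A\<^esub> int (nat p) = \<one>\<^bsub>A\<^esub>" unfolding p_nat using pn(2)[of u] u by (simp add: ev_cmul)
    then show ?thesis unfolding int_pow_int .
  qed
  moreover have "z [^] n \<in> action_kernel"
  proof -
    have "\<alpha> (z [^] n) a = a" if a: "a \<in> carrier A" for a
    proof -
      obtain u where u: "ev u = a" using ev_surj[OF a] .
      have "ev (T (z [^] n) u) = ev u" using pn(4)[of u] unfolding diff_mem_L_iff .
      then show ?thesis using ev_T[OF nat_pow_closed[OF z(1)], of n u] u by simp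
    qed
    then show ?thesis using z(1) by (simp add: action_kernel_def)
  qed
  moreover have "B = carrier A" if B: "invariant_subgroup B" "B \<noteq> {\<one>\<^bsub>A\<^esub>}" for B
  proof -
    have "{\<one>\<^bsub>A\<^esub>} \<subseteq> carrier A" by simp
    then have "preimage B \<noteq> L"
      using preimage_inject[OF invariant_subgroup_subset[OF B(1)], of "{\<one>\<^bsub>A\<^esub>}"] B(2)
      unfolding preimage_trivial by blast
    then have "preimage B = preimage (carrier A)"
      using pn(5) opsub_preimage[OF B(1)] preimage_carrier by blast
    then show ?thesis by (rule preimage_inject[OF invariant_subgroup_subset[OF B(1)] order_refl])
  qed
  ultimately show ?thesis using that pn(3) by blast
qed

text \<open>The first element of the polycentral series that acts non-trivially is central modulo
  the preceding subgroup, which acts trivially.\<close>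

lemma obtain_central_element:
  obtains z where "z \<in> carrier G" "z \<notin> action_kernel"
    "\<And>g. g \<in> carrier G \<Longrightarrow> z \<otimes> g \<otimes> inv z \<otimes> inv g \<in> action_kernel"
proof -
  have sub: "subgroup action_kernel G" by (rule normal_imp_subgroup[OF action_kernel_normal])
  have dich: "H \<subseteq> action_kernel \<or> (\<exists>z\<in>central_mod G action_kernel. z \<notin> action_kernel)"
    if "polycentral G K H" "K \<subseteq> action_kernel" for K H
    using that
  proof (induction rule: polycentral.induct)
    case (step H x)
    show ?case
    proof (cases "H \<subseteq> action_kernel")
      case True
      then have "x \<in> central_mod G action_kernel" using step.hyps by (auto simp: central_mod_def)
      moreover have "generate G (insert x H) \<subseteq> action_kernel" if "x \<in> action_kernel"
        using that True by (intro generate_subgroup_incl sub) auto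
      ultimately show ?thesis by blast
    next
      case False
      then show ?thesis using step by blast
    qed
  qed simp
  have "\<not> carrier G \<subseteq> action_kernel"
  proof
    assume "carrier G \<subseteq> action_kernel"
    then have "(fixed_mod ^^ 1) {\<one>\<^bsub>A\<^esub>} = carrier A" by (auto simp: fixed_mod_def action_kernel_def)
    then show False using action_not_nilpotent by blast
  qed
  then obtain z where "z \<in> central_mod G action_kernel" "z \<notin> action_kernel"
    using dich polycentral_trivial by blast
  then show ?thesis using that by (auto simp: central_mod_def)
qed

lemma torsion_mod_kernel:
  assumes "z \<in> central_mod G action_kernel"
  obtains n :: nat where "n > 0" "z [^] n \<in> action_kernel"
proof (cases "z \<in> action_kernel")
  case True
  then show ?thesis using that[of 1] assms by (simp add: central_mod_def)
next
  case False
  have z: "z \<in> carrier G" and c: "\<And>g. g \<in> carrier G \<Longrightarrow> z \<otimes> g \<otimes> inv z \<otimes> inv g \<in> action_kernel"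
    using assms by (auto simp: central_mod_def)
  show ?thesis
  proof (rule central_element_action[OF z False])
    fix g assume "g \<in> carrier G"
    then show "z \<otimes> g \<otimes> inv z \<otimes> inv g \<in> action_kernel" by (rule c)
  next
    fix n :: nat assume "n > 0" "z [^] n \<in> action_kernel"
    then show ?thesis by (rule that)
  qed
qed

text \<open>In a cyclic step \<open>x\<close> is central only modulo \<open>H\<close>, so its order
  on \<open>A\<close> is not controlled directly. But the commutators of its powers with the
  finitely many generators take finitely many values in the image of \<open>H\<close>, and a
  repetition yields a positive power of \<open>x\<close> that is central modulo the kernel, hence
  torsion there.\<close>

lemma finite_image_mod_kernel:
  assumes "polycentral G K H" "K \<lhd> G" "K \<subseteq> action_kernel"
  shows "finite ((\<lambda>h. action_kernel #> h) ` H)"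
  using assms(1)
proof (induction rule: polycentral.induct)
  case base
  have "(\<lambda>h. action_kernel #> h) ` K \<subseteq> {action_kernel}"
    using assms(3) subgroup.rcos_const[OF normal_imp_subgroup[OF action_kernel_normal] is_group] by auto
  then show ?case by (rule finite_subset) simp
next
  case (step H x)
  interpret C: normal action_kernel G by (rule action_kernel_normal)
  let ?\<kappa> = "\<lambda>h. action_kernel #> h"
  have H: "H \<lhd> G" using polycentral_normal[OF step.hyps(1) assms(2)] .
  interpret H: normal H G by fact
  have x: "x \<in> carrier G" using step.hyps by (simp add: central_mod_def)
  have cosets: "?\<kappa> (a \<otimes> b) = ?\<kappa> a <#> ?\<kappa> b" if "a \<in> carrier G" "b \<in> carrier G" for a b
    using C.rcos_sum[OF that] by simp
  have cong_l: "?\<kappa> (b \<otimes> a) = ?\<kappa> (b \<otimes> a')"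
    if "?\<kappa> a = ?\<kappa> a'" "a \<in> carrier G" "a' \<in> carrier G" "b \<in> carrier G" for a a' b
    using that by (simp add: cosets)
  have cong_r: "?\<kappa> (a \<otimes> b) = ?\<kappa> (a' \<otimes> b)"
    if "?\<kappa> a = ?\<kappa> a'" "a \<in> carrier G" "a' \<in> carrier G" "b \<in> carrier G" for a a' b
    using that by (simp add: cosets)
  obtain S where S: "finite S" "S \<subseteq> carrier G" "generate G S = carrier G"
    using group_finitely_generated by blast
  have comm_H: "x [^] n \<otimes> s \<otimes> inv (x [^] n) \<otimes> inv s \<in> H" if "s \<in> carrier G" for s and n :: nat
  proof -
    have "x [^] n \<in> central_mod G H"
      using subgroup_nat_pow_closed[OF normal_imp_subgroup[OF central_mod_normal[OF H]]]
        step.hyps(2) by blast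
    then show ?thesis using that by (auto simp: central_mod_def)
  qed
  define \<phi> where "\<phi> n = (\<lambda>s\<in>S. ?\<kappa> (x [^] (n::nat) \<otimes> s \<otimes> inv (x [^] n) \<otimes> inv s))" for n
  have "\<phi> n \<in> S \<rightarrow>\<^sub>E ?\<kappa> ` H" for n
    using comm_H S(2) by (auto simp: \<phi>_def)
  then have "range \<phi> \<subseteq> S \<rightarrow>\<^sub>E ?\<kappa> ` H" by blast
  moreover have "finite (S \<rightarrow>\<^sub>E ?\<kappa> ` H)" using S(1) step.IH by (intro finite_PiE) auto
  ultimately have "\<not> inj \<phi>"
    using finite_imageD[of \<phi> UNIV] finite_subset infinite_UNIV_nat by blast
  then obtain m n where mn: "m < n" "\<phi> m = \<phi> n"
    unfolding inj_def by (metis linorder_neqE_nat)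
  define y where "y = x [^] (n - m)"
  have y: "y \<in> carrier G" using x by (simp add: y_def)
  have xn: "x [^] n = x [^] m \<otimes> y" unfolding y_def using x mn(1) by (simp add: nat_pow_mult)
  have "y \<otimes> s \<otimes> inv y \<otimes> inv s \<in> action_kernel" if s: "s \<in> S" for s
  proof -
    define u where "u = x [^] m"
    have u: "u \<in> carrier G" using x by (simp add: u_def)
    have sc: "s \<in> carrier G" using s S(2) by auto
    \<comment> \<open>Equality of the two values reads \<open>[u, s] = [u y, s]\<close> modulo the
      kernel; multiplying by \<open>s u\<close> on the right and cancelling \<open>u\<close> on the
      left leaves \<open>s = y s y^-1\<close>.\<close>
    have "?\<kappa> (u \<otimes> s \<otimes> inv u \<otimes> inv s) = ?\<kappa> (u \<otimes> y \<otimes> s \<otimes> inv (u \<otimes> y) \<otimes> inv s)"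
      using fun_cong[OF mn(2), of s] s by (simp add: \<phi>_def xn u_def)
    then have "?\<kappa> (u \<otimes> s \<otimes> inv u \<otimes> inv s \<otimes> (s \<otimes> u)) = ?\<kappa> (u \<otimes> y \<otimes> s \<otimes> inv (u \<otimes> y) \<otimes> inv s \<otimes> (s \<otimes> u))"
      by (rule cong_r) (use u y sc in auto)
    then have "?\<kappa> (u \<otimes> s) = ?\<kappa> (u \<otimes> (y \<otimes> s \<otimes> inv y))"
      using u y sc by (simp add: word_simps)
    then have "?\<kappa> (inv u \<otimes> (u \<otimes> s)) = ?\<kappa> (inv u \<otimes> (u \<otimes> (y \<otimes> s \<otimes> inv y)))"
      by (rule cong_l) (use u y sc in auto)
    then have "?\<kappa> s = ?\<kappa> (y \<otimes> s \<otimes> inv y)" using u y sc by (simp add: inv_mult_cancel)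
    then have "?\<kappa> (s \<otimes> inv s) = ?\<kappa> (y \<otimes> s \<otimes> inv y \<otimes> inv s)"
      by (rule cong_r) (use y sc in auto)
    then have "?\<kappa> (y \<otimes> s \<otimes> inv y \<otimes> inv s) = action_kernel"
      using sc C.subset by simp
    moreover have "y \<otimes> s \<otimes> inv y \<otimes> inv s \<in> ?\<kappa> (y \<otimes> s \<otimes> inv y \<otimes> inv s)"
      using y sc by (intro rcos_self C.subgroup_axioms) auto
    ultimately show ?thesis by simp
  qed
  then have "S \<subseteq> {s \<in> carrier G. y \<otimes> s \<otimes> inv y \<otimes> inv s \<in> action_kernel}" using S(2) by blast
  then have "generate G S \<subseteq> {s \<in> carrier G. y \<otimes> s \<otimes> inv y \<otimes> inv s \<in> action_kernel}"
    by (rule generate_subgroup_incl[OF _ commutator_preimage_subgroup[OF action_kernel_normal y]])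
  then have "y \<in> central_mod G action_kernel" using y S(3) by (auto simp: central_mod_def)
  then obtain k :: nat where k: "k > 0" "y [^] k \<in> action_kernel" by (rule torsion_mod_kernel)
  define j where "j = (n - m) * k"
  have j: "j > 0" "x [^] j \<in> action_kernel" using k mn(1) x by (auto simp: j_def y_def nat_pow_pow)
  have \<kappa>_kernel: "?\<kappa> c = action_kernel" if "c \<in> action_kernel" for c
    using that by (rule C.rcos_const[OF is_group])
  \<comment> \<open>Negative powers of \<open>x\<close> are avoided because \<open>x [^] j\<close>
    is trivial modulo the kernel, and normality of \<open>H\<close> lets powers of \<open>x\<close>
    move past elements of \<open>H\<close>.\<close>
  have D: "?\<kappa> g \<in> {?\<kappa> (h \<otimes> x [^] (i::nat)) | h i. h \<in> H}" if "g \<in> generate G (insert x H)" for g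
    using that
  proof (induction rule: generate.induct)
    case one
    have "?\<kappa> \<one> = ?\<kappa> (\<one> \<otimes> x [^] (0::nat))" by simp
    then show ?case using H.one_closed by blast
  next
    case (incl g)
    have "?\<kappa> x = ?\<kappa> (\<one> \<otimes> x [^] (1::nat))" using x by simp
    moreover have "?\<kappa> g = ?\<kappa> (g \<otimes> x [^] (0::nat))" if "g \<in> H" using that H.subset by auto
    ultimately show ?case using incl H.one_closed by blast
  next
    case (inv g)
    have "?\<kappa> (inv x) = ?\<kappa> (\<one> \<otimes> x [^] (j - 1))"
    proof -
      have "x [^] j = x [^] (j - 1) \<otimes> x"
        using nat_pow_Suc[of x "j - 1"] j(1) by simp
      then have "x [^] (j - 1) = x [^] j \<otimes> inv x" using x by (simp add: m_assoc)
      then have "?\<kappa> (x [^] (j - 1)) = ?\<kappa> (\<one> \<otimes> inv x)"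
        using cong_r[of "x [^] j" \<one> "inv x"] \<kappa>_kernel[OF j(2)] \<kappa>_kernel[OF C.one_closed] x by simp
      then show ?thesis using x by simp
    qed
    moreover have "?\<kappa> (inv g) = ?\<kappa> (inv g \<otimes> x [^] (0::nat))" if "g \<in> H" using that H.subset by auto
    ultimately show ?case using inv H.one_closed H.m_inv_closed by blast
  next
    case (eng g1 g2)
    then obtain h1 i1 h2 i2 where *: "?\<kappa> g1 = ?\<kappa> (h1 \<otimes> x [^] (i1::nat))" "h1 \<in> H"
      "?\<kappa> g2 = ?\<kappa> (h2 \<otimes> x [^] (i2::nat))" "h2 \<in> H" by blast
    have ins: "insert x H \<subseteq> carrier G" using x H.subset by auto
    have c: "g1 \<in> carrier G" "g2 \<in> carrier G" "h1 \<in> carrier G" "h2 \<in> carrier G"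
      "x [^] i1 \<in> carrier G" "x [^] i2 \<in> carrier G"
      using generate_in_carrier[OF ins] eng.hyps * H.subset x by auto
    have "?\<kappa> (g1 \<otimes> g2) = ?\<kappa> ((h1 \<otimes> x [^] i1) \<otimes> (h2 \<otimes> x [^] i2))"
      using c * by (simp add: cosets[of g1 g2] cosets[of "h1 \<otimes> x [^] i1" "h2 \<otimes> x [^] i2"])
    also have "(h1 \<otimes> x [^] i1) \<otimes> (h2 \<otimes> x [^] i2) = (h1 \<otimes> (x [^] i1 \<otimes> h2 \<otimes> inv (x [^] i1))) \<otimes> x [^] (i1 + i2)"
      using c x by (simp add: word_simps nat_pow_mult[symmetric])
    finally show ?case
      using H.m_closed[OF *(2) H.inv_op_closed2[OF c(5) *(4)]] by blast
  qed
  have mod_j: "?\<kappa> (h \<otimes> x [^] i) = ?\<kappa> h <#> ?\<kappa> (x [^] (i mod j))" if h: "h \<in> H" for h and i :: nat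
  proof -
    have hc: "h \<in> carrier G" using h H.subset by auto
    have pk: "(x [^] j) [^] (i div j) \<in> action_kernel"
      by (rule subgroup_nat_pow_closed[OF C.subgroup_axioms j(2)])
    have "x [^] i = (x [^] j) [^] (i div j) \<otimes> x [^] (i mod j)"
      using x by (simp add: nat_pow_pow nat_pow_mult)
    then have "?\<kappa> (x [^] i) = ?\<kappa> (\<one> \<otimes> x [^] (i mod j))"
      using cong_r[of "(x [^] j) [^] (i div j)" \<one> "x [^] (i mod j)"] \<kappa>_kernel[OF pk]
        \<kappa>_kernel[OF C.one_closed] x by simp
    then show ?thesis using cosets[OF hc, of "x [^] i"] x by simp
  qed
  have "?\<kappa> ` generate G (insert x H) \<subseteq> (\<lambda>(q, i). q <#> ?\<kappa> (x [^] i)) ` (?\<kappa> ` H \<times> {..<j})"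
  proof
    fix q assume "q \<in> ?\<kappa> ` generate G (insert x H)"
    then obtain h and i :: nat where h: "q = ?\<kappa> (h \<otimes> x [^] i)" "h \<in> H" using D by blast
    then have "q = ?\<kappa> h <#> ?\<kappa> (x [^] (i mod j))" by (simp only: mod_j)
    then show "q \<in> (\<lambda>(q, i). q <#> ?\<kappa> (x [^] i)) ` (?\<kappa> ` H \<times> {..<j})"
      using j(1) h(2) by (intro image_eqI[where x = "(?\<kappa> h, i mod j)"]) auto
  qed
  then show ?case by (rule finite_subset) (use step.IH in simp)
qed

text \<open>The orbit of one nontrivial element generates an invariant subgroup, which is all of
  \<open>A\<close> by irreducibility. Finitely many generators of order dividing \<open>p\<close>
  generate a finite abelian group.\<close>

theorem finite_irreducible:
  obtains p :: nat where "Factorial_Ring.prime p" "\<And>a. a \<in> carrier A \<Longrightarrow> a [^]\<^bsub>A\<^esub> p = \<one>\<^bsub>A\<^esub>"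
    "finite (carrier A)" "\<And>B. invariant_subgroup B \<Longrightarrow> B \<noteq> {\<one>\<^bsub>A\<^esub>} \<Longrightarrow> B = carrier A"
proof -
  obtain z where z: "z \<in> carrier G" "z \<notin> action_kernel"
    "\<And>g. g \<in> carrier G \<Longrightarrow> z \<otimes> g \<otimes> inv z \<otimes> inv g \<in> action_kernel"
    using obtain_central_element by blast
  obtain p :: nat where p: "Factorial_Ring.prime p" "\<And>a. a \<in> carrier A \<Longrightarrow> a [^]\<^bsub>A\<^esub> p = \<one>\<^bsub>A\<^esub>"
    "\<And>B. invariant_subgroup B \<Longrightarrow> B \<noteq> {\<one>\<^bsub>A\<^esub>} \<Longrightarrow> B = carrier A"
    using central_element_action[OF z] by metis
  obtain K where K: "K \<lhd> G" "polycentral G K (carrier G)" "K \<subseteq> action_kernel"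
    using polycentral_trivial by blast
  have fin: "finite ((\<lambda>h. action_kernel #> h) ` carrier G)"
    by (rule finite_image_mod_kernel[OF K(2,1,3)])
  have "carrier A \<noteq> {\<one>\<^bsub>A\<^esub>}" using action_not_nilpotent[of 0] by simp
  then obtain a where a: "a \<in> carrier A" "a \<noteq> \<one>\<^bsub>A\<^esub>" using A.one_closed by blast
  define orbit where "orbit = (\<lambda>g. \<alpha> g a) ` carrier G"
  have orbit_sub: "orbit \<subseteq> carrier A" using a by (auto simp: orbit_def action_closed)
  \<comment> \<open>Elements congruent modulo the kernel act alike, so the orbit is an image of the
    finite set of cosets.\<close>
  define f where "f q = \<alpha> (SOME g. g \<in> carrier G \<and> action_kernel #> g = q) a" for q
  have "\<alpha> g a = f (action_kernel #> g)" if g: "g \<in> carrier G" for g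
  proof -
    define h where "h = (SOME h. h \<in> carrier G \<and> action_kernel #> h = action_kernel #> g)"
    have "h \<in> carrier G \<and> action_kernel #> h = action_kernel #> g"
      unfolding h_def by (rule someI[of _ g]) (simp add: g)
    then show ?thesis using action_cong_coset[OF _ g _ a(1), of h] by (simp add: f_def h_def)
  qed
  then have "orbit \<subseteq> f ` ((\<lambda>h. action_kernel #> h) ` carrier G)" by (auto simp: orbit_def)
  then have "finite orbit" using fin finite_subset by blast
  then have fin_gen: "finite (generate A orbit)"
    using A.finite_generate_torsion[OF _ orbit_sub, of p] p(2) orbit_sub prime_gt_0_nat[OF p(1)] by blast
  have "invariant_subgroup (generate A orbit)"
    unfolding invariant_subgroup_def
  proof (intro conjI ballI)
    show "subgroup (generate A orbit) A" by (rule A.generate_is_subgroup[OF orbit_sub])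
    fix g b assume g: "g \<in> carrier G" and "b \<in> generate A orbit"
    from this(2) show "\<alpha> g b \<in> generate A orbit"
    proof (induction rule: generate.induct)
      case one then show ?case using g by (simp add: action_unit generate.one)
    next
      case (incl b)
      then have "\<alpha> g b \<in> orbit" using g a by (auto simp: orbit_def simp flip: action_mult)
      then show ?case by (rule generate.incl)
    next
      case (inv b)
      then have "\<alpha> g b \<in> orbit" using g a by (auto simp: orbit_def simp flip: action_mult)
      then have "inv\<^bsub>A\<^esub> (\<alpha> g b) \<in> generate A orbit" by (rule generate.inv)
      then show ?case using inv g orbit_sub action_inv by (metis subsetD)
    next
      case (eng b c)
      then show ?case
        using g action_distrib A.generate_in_carrier[OF orbit_sub] generate.eng by metis
    qed
  qed
  moreover have "a \<in> generate A orbit"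
  proof -
    have "a \<in> orbit" unfolding orbit_def using action_one[OF a(1)] by (metis image_eqI one_closed)
    then show ?thesis by (rule generate.incl)
  qed
  ultimately have "generate A orbit = carrier A" using p(3) a(2) by blast
  then show ?thesis using that p fin_gen by simp
qed

end

section \<open>Finite operator groups as representations on natural numbers\<close>

definition zmod_ring :: "nat \<Rightarrow> nat ring" where
  "zmod_ring p = \<lparr>carrier = {..<p}, monoid.mult = (\<lambda>x y. x * y mod p), one = 1,
     ring.zero = 0, ring.add = (\<lambda>x y. (x + y) mod p)\<rparr>"

lemma zmod_ring_simps:
  "carrier (zmod_ring p) = {..<p}" "x \<otimes>\<^bsub>zmod_ring p\<^esub> y = x * y mod p" "\<one>\<^bsub>zmod_ring p\<^esub> = 1"
  "\<zero>\<^bsub>zmod_ring p\<^esub> = 0" "x \<oplus>\<^bsub>zmod_ring p\<^esub> y = (x + y) mod p"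
  by (simp_all add: zmod_ring_def)

lemma field_zmod_ring:
  assumes p: "Factorial_Ring.prime p"
  shows "field (zmod_ring p)"
proof -
  have p1: "p > 1" using prime_gt_1_nat[OF p] .
  have "cring (zmod_ring p)"
  proof (rule cringI)
    show "abelian_group (zmod_ring p)"
    proof (rule abelian_groupI)
      fix x assume "x \<in> carrier (zmod_ring p)"
      then show "\<exists>y\<in>carrier (zmod_ring p). y \<oplus>\<^bsub>zmod_ring p\<^esub> x = \<zero>\<^bsub>zmod_ring p\<^esub>"
        using p1 by (intro bexI[of _ "(p - x) mod p"]) (auto simp: zmod_ring_simps mod_add_left_eq)
    qed (use p1 in \<open>auto simp: zmod_ring_simps mod_simps add_ac\<close>)
    show "Group.comm_monoid (zmod_ring p)"
      by (rule comm_monoidI) (use p1 in \<open>auto simp: zmod_ring_simps mod_simps mult_ac\<close>)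
  qed (use p1 in \<open>auto simp: zmod_ring_simps mod_simps algebra_simps\<close>)
  then show ?thesis
  proof (rule cring.cring_fieldI2)
    show "\<zero>\<^bsub>zmod_ring p\<^esub> \<noteq> \<one>\<^bsub>zmod_ring p\<^esub>" by (simp add: zmod_ring_simps)
    fix a assume a: "a \<in> carrier (zmod_ring p)" "a \<noteq> \<zero>\<^bsub>zmod_ring p\<^esub>"
    then have "\<not> p dvd a" by (auto simp: zmod_ring_simps dest: dvd_imp_le)
    then have "coprime a p" using prime_imp_coprime[OF p] by (simp add: coprime_commute)
    then have gcd: "gcd a p = 1" by (rule coprime_imp_gcd_eq_1)
    have "a \<noteq> 0" using a(2) by (simp add: zmod_ring_simps)
    then obtain x y where "a * x = p * y + 1"
      using bezout_nat[of a p] unfolding gcd by blast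
    then have "a * (x mod p) mod p = (p * y + 1) mod p" by (simp only: mod_mult_right_eq)
    also have "\<dots> = 1" using p1 by (simp only: mod_mult_self4 mod_less)
    finally have "a * (x mod p) mod p = 1" .
    then show "\<exists>b\<in>carrier (zmod_ring p). a \<otimes>\<^bsub>zmod_ring p\<^esub> b = \<one>\<^bsub>zmod_ring p\<^esub>"
      using p1 by (intro bexI[of _ "x mod p"]) (auto simp: zmod_ring_simps)
  qed
qed

locale finite_operator_group = operator_group G A \<alpha>
  for G :: "('g, 'b) monoid_scheme" (structure) and A :: "('m, 'c) monoid_scheme" and \<alpha> +
  fixes p :: nat
  assumes p_prime: "Factorial_Ring.prime p"
    and exponent: "a \<in> carrier A \<Longrightarrow> a [^]\<^bsub>A\<^esub> p = \<one>\<^bsub>A\<^esub>"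
    and finite_carrier: "finite (carrier A)"
begin

text \<open>An arbitrary enumeration: the representations in the hypothesis of the theorem have
  carriers in \<open>nat\<close>, so \<open>A\<close> is transported along it.\<close>

definition code :: "'m \<Rightarrow> nat" where
  "code = (SOME f. bij_betw f (carrier A) {0..<card (carrier A)})"

definition decode :: "nat \<Rightarrow> 'm" where
  "decode = inv_into (carrier A) code"

lemma code_inj: "inj_on code (carrier A)"
  using someI_ex[OF ex_bij_betw_finite_nat[OF finite_carrier]] by (simp add: code_def bij_betw_def)

lemma decode_code: "a \<in> carrier A \<Longrightarrow> decode (code a) = a"
  by (simp add: decode_def code_inj)

definition coded_module :: "(nat, nat) module" where
  "coded_module = \<lparr>carrier = code ` carrier A, monoid.mult = (\<lambda>x y. x), one = 0,
     ring.zero = code \<one>\<^bsub>A\<^esub>, ring.add = (\<lambda>x y. code (decode x \<otimes>\<^bsub>A\<^esub> decode y)),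
     module.smult = (\<lambda>n x. code (decode x [^]\<^bsub>A\<^esub> n))\<rparr>"

definition coded_action :: "'g \<Rightarrow> nat \<Rightarrow> nat" where
  "coded_action g = (\<lambda>x\<in>code ` carrier A. code (\<alpha> g (decode x)))"

lemma coded_simps:
  "carrier coded_module = code ` carrier A" "\<zero>\<^bsub>coded_module\<^esub> = code \<one>\<^bsub>A\<^esub>"
  "a \<in> carrier A \<Longrightarrow> b \<in> carrier A \<Longrightarrow> code a \<oplus>\<^bsub>coded_module\<^esub> code b = code (a \<otimes>\<^bsub>A\<^esub> b)"
  "a \<in> carrier A \<Longrightarrow> n \<odot>\<^bsub>coded_module\<^esub> code a = code (a [^]\<^bsub>A\<^esub> n)"
  "a \<in> carrier A \<Longrightarrow> coded_action g (code a) = code (\<alpha> g a)"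
  by (simp_all add: coded_module_def coded_action_def decode_code)

lemma pow_mod:
  assumes "a \<in> carrier A"
  shows "a [^]\<^bsub>A\<^esub> (n mod p) = a [^]\<^bsub>A\<^esub> n"
proof -
  have "a [^]\<^bsub>A\<^esub> (p * (n div p) + n mod p) = (a [^]\<^bsub>A\<^esub> p) [^]\<^bsub>A\<^esub> (n div p) \<otimes>\<^bsub>A\<^esub> a [^]\<^bsub>A\<^esub> (n mod p)"
    using assms by (simp only: A.nat_pow_mult[symmetric] A.nat_pow_pow A.nat_pow_closed)
  then show ?thesis using assms by (simp add: exponent)
qed

lemma module_coded: "Module.module (zmod_ring p) coded_module"
proof (rule moduleI)
  show "cring (zmod_ring p)" using field_zmod_ring[OF p_prime] by (simp add: field_def domain_def)
  show "abelian_group coded_module"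
  proof (rule abelian_groupI)
    fix x assume "x \<in> carrier coded_module"
    then obtain a where "a \<in> carrier A" "x = code a" by (auto simp: coded_simps)
    then show "\<exists>y\<in>carrier coded_module. y \<oplus>\<^bsub>coded_module\<^esub> x = \<zero>\<^bsub>coded_module\<^esub>"
      by (intro bexI[of _ "code (inv\<^bsub>A\<^esub> a)"]) (simp_all add: coded_simps)
  qed (auto simp: coded_simps A.m_ac)
qed (auto simp: coded_simps zmod_ring_simps pow_mod A.nat_pow_mult A.nat_pow_distrib A.nat_pow_pow mult.commute)

lemma coded_action_Bij: "g \<in> carrier G \<Longrightarrow> coded_action g \<in> Bij (carrier coded_module)"
proof -
  assume g: "g \<in> carrier G"
  have "inj_on (coded_action g) (code ` carrier A)"
  proof (rule inj_onI)
    fix x y assume "x \<in> code ` carrier A" "y \<in> code ` carrier A" and eq: "coded_action g x = coded_action g y"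
    then obtain a b where ab: "x = code a" "y = code b" "a \<in> carrier A" "b \<in> carrier A" by blast
    then have "\<alpha> g a = \<alpha> g b"
      using eq inj_onD[OF code_inj] g by (simp add: coded_simps action_closed)
    then have "\<alpha> (inv g \<otimes> g) a = \<alpha> (inv g \<otimes> g) b"
      using ab g by (simp only: action_mult inv_closed)
    then show "x = y" using ab g by (simp add: action_one)
  qed
  moreover have "coded_action g ` code ` carrier A = code ` carrier A"
  proof
    show "code ` carrier A \<subseteq> coded_action g ` code ` carrier A"
    proof
      fix x assume "x \<in> code ` carrier A"
      then obtain a where a: "a \<in> carrier A" "x = code a" by blast
      have "\<alpha> g (\<alpha> (inv g) a) = a" using a g by (simp add: action_one flip: action_mult)
      then have "coded_action g (code (\<alpha> (inv g) a)) = x"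
        using a g by (simp add: coded_simps action_closed)
      then show "x \<in> coded_action g ` code ` carrier A"
        using action_closed[OF inv_closed[OF g] a(1)] by blast
    qed
  qed (use g in \<open>auto simp: coded_simps action_closed\<close>)
  ultimately show ?thesis
    by (simp add: Bij_def coded_simps(1) bij_betw_def) (simp add: coded_action_def)
qed

lemma coded_action_GL: "g \<in> carrier G \<Longrightarrow> coded_action g \<in> carrier (GL_group (zmod_ring p) coded_module)"
proof -
  assume g: "g \<in> carrier G"
  have "\<alpha> g (a [^]\<^bsub>A\<^esub> n) = \<alpha> g a [^]\<^bsub>A\<^esub> (n::nat)" if "a \<in> carrier A" for a n
    using group_hom.hom_nat_pow[OF action_group_hom[OF g] that] .
  then show ?thesis
    using coded_action_Bij[OF g] g
    by (auto simp: GL_group_def coded_simps action_closed action_distrib)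
qed

lemma representation_coded: "representation G (zmod_ring p) coded_module coded_action"
  unfolding representation_def
proof (intro conjI group_axioms field_zmod_ring[OF p_prime] module_coded homI coded_action_GL)
  fix g h assume gh: "g \<in> carrier G" "h \<in> carrier G"
  have "compose (carrier coded_module) (coded_action g) (coded_action h) x = coded_action (g \<otimes> h) x" for x
  proof (cases "x \<in> code ` carrier A")
    case True
    then obtain a where "a \<in> carrier A" "x = code a" by blast
    then show ?thesis using gh by (simp add: compose_def coded_simps action_closed action_mult)
  next
    case False
    then show ?thesis by (simp add: compose_def coded_simps(1) coded_action_def)
  qed
  then show "coded_action (g \<otimes> h) = coded_action g \<otimes>\<^bsub>GL_group (zmod_ring p) coded_module\<^esub> coded_action h"
    using coded_action_Bij gh by (simp add: GL_group_def BijGroup_def fun_eq_iff)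
qed

lemma finite_dimensional_coded: "finite_dimensional_space (zmod_ring p) coded_module"
proof -
  have "W = carrier coded_module" if "submodule W (zmod_ring p) coded_module" "carrier coded_module \<subseteq> W" for W
    using that subgroup.subset[of W "add_monoid coded_module"] by (auto simp: submodule_def)
  then show ?thesis
    unfolding finite_dimensional_space_def using finite_carrier
    by (intro exI[of _ "carrier coded_module"]) (auto simp: coded_simps(1))
qed

text \<open>Forgetting scalars turns an invariant subspace into an invariant subgroup of
  \<open>A\<close>, to which irreducibility applies.\<close>

lemma irreducible_coded:
  assumes nontriv: "carrier A \<noteq> {\<one>\<^bsub>A\<^esub>}"
    and irred: "\<And>B. invariant_subgroup B \<Longrightarrow> B \<noteq> {\<one>\<^bsub>A\<^esub>} \<Longrightarrow> B = carrier A"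
  shows "irreducible_representation G (zmod_ring p) coded_module coded_action"
  unfolding irreducible_representation_def
proof (intro conjI allI impI representation_coded)
  show "carrier coded_module \<noteq> {\<zero>\<^bsub>coded_module\<^esub>}"
  proof
    assume eq: "carrier coded_module = {\<zero>\<^bsub>coded_module\<^esub>}"
    have "a = \<one>\<^bsub>A\<^esub>" if a: "a \<in> carrier A" for a
    proof -
      have "code a = code \<one>\<^bsub>A\<^esub>" using eq a by (auto simp: coded_simps)
      then show ?thesis using inj_onD[OF code_inj] a by simp
    qed
    then show False using nontriv by auto
  qed
  fix W assume W: "submodule W (zmod_ring p) coded_module \<and> (\<forall>g\<in>carrier G. coded_action g ` W \<subseteq> W)"
  interpret V: Module.module "zmod_ring p" coded_module by (rule module_coded)
  have sub: "subgroup W (add_monoid coded_module)" using W by (simp add: submodule_def)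
  have W_sub: "W \<subseteq> code ` carrier A" using subgroup.subset[OF sub] by (simp add: coded_simps)
  define B where "B = {a \<in> carrier A. code a \<in> W}"
  have W_eq: "W = code ` B" using W_sub by (auto simp: B_def)
  have "subgroup B A"
  proof (rule subgroup.intro)
    show "\<one>\<^bsub>A\<^esub> \<in> B" using subgroup.one_closed[OF sub] by (simp add: B_def coded_simps)
    show "x \<otimes>\<^bsub>A\<^esub> y \<in> B" if "x \<in> B" "y \<in> B" for x y
      using subgroup.m_closed[OF sub, of "code x" "code y"] that by (simp add: B_def coded_simps)
    show "inv\<^bsub>A\<^esub> x \<in> B" if x: "x \<in> B" for x
    proof -
      have xA: "x \<in> carrier A" "code x \<in> W" using x by (auto simp: B_def)
      have "\<ominus>\<^bsub>coded_module\<^esub> code x = code (inv\<^bsub>A\<^esub> x)"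
        by (rule V.minus_equality) (use xA in \<open>auto simp: coded_simps\<close>)
      moreover have "\<ominus>\<^bsub>coded_module\<^esub> code x \<in> W"
        using subgroup.m_inv_closed[OF sub xA(2)] by (simp add: a_inv_def)
      ultimately show ?thesis using xA by (simp add: B_def)
    qed
  qed (auto simp: B_def)
  moreover have "\<alpha> g b \<in> B" if g: "g \<in> carrier G" and b: "b \<in> B" for g b
  proof -
    have "coded_action g (code b) \<in> W" using W g b by (auto simp: B_def)
    then show ?thesis using g b by (simp add: B_def coded_simps action_closed)
  qed
  ultimately have "invariant_subgroup B" by (simp add: invariant_subgroup_def)
  then have "B = {\<one>\<^bsub>A\<^esub>} \<or> B = carrier A" using irred by blast
  then show "W = {\<zero>\<^bsub>coded_module\<^esub>} \<or> W = carrier coded_module"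
    unfolding W_eq by (auto simp: coded_simps)
qed

lemma kernel_coded: "kernel G (GL_group (zmod_ring p) coded_module) coded_action = action_kernel"
proof -
  have "coded_action g = (\<lambda>x\<in>carrier coded_module. x) \<longleftrightarrow> (\<forall>a\<in>carrier A. \<alpha> g a = a)"
    if g: "g \<in> carrier G" for g
  proof
    assume eq: "coded_action g = (\<lambda>x\<in>carrier coded_module. x)"
    show "\<forall>a\<in>carrier A. \<alpha> g a = a"
    proof
      fix a assume a: "a \<in> carrier A"
      have "code (\<alpha> g a) = code a"
        using fun_cong[OF eq, of "code a"] a by (simp add: coded_simps)
      then show "\<alpha> g a = a" using inj_onD[OF code_inj] a g by (simp add: action_closed)
    qed
  next
    assume "\<forall>a\<in>carrier A. \<alpha> g a = a"
    then show "coded_action g = (\<lambda>x\<in>carrier coded_module. x)"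
      by (auto simp: coded_action_def coded_simps(1) decode_code fun_eq_iff)
  qed
  then show ?thesis
    by (auto simp: kernel_def action_kernel_def GL_group_def BijGroup_def)
qed

lemma derivation_inner:
  assumes triv: "trivial_group (cohomology1 G coded_module coded_action)"
    and closed: "\<And>g. g \<in> carrier G \<Longrightarrow> \<gamma> g \<in> carrier A"
    and deriv: "\<And>g h. g \<in> carrier G \<Longrightarrow> h \<in> carrier G \<Longrightarrow> \<gamma> (g \<otimes> h) = \<gamma> g \<otimes>\<^bsub>A\<^esub> \<alpha> g (\<gamma> h)"
  shows "\<exists>a\<in>carrier A. \<forall>g\<in>carrier G. \<gamma> g = \<alpha> g a \<otimes>\<^bsub>A\<^esub> inv\<^bsub>A\<^esub> a"
proof -
  let ?V = coded_module and ?\<rho> = coded_action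
  note rep = representation_coded
  interpret V: Module.module "zmod_ring p" coded_module by (rule module_coded)
  interpret Z: comm_group "cocycle_group1 G ?V ?\<rho>" by (rule comm_group_cocycle_group1[OF rep])
  note sub = subgroup_coboundaries1[OF rep]
  define c where "c = (\<lambda>g\<in>carrier G. code (\<gamma> g))"
  have c: "c \<in> carrier (cocycle_group1 G ?V ?\<rho>)"
    using closed deriv
    by (auto simp: cocycle_group1_def cocycle_iff[OF rep] c_def coded_simps action_closed)
  have "coboundaries1 G ?V ?\<rho> #>\<^bsub>cocycle_group1 G ?V ?\<rho>\<^esub> c \<in> carrier (cohomology1 G ?V ?\<rho>)"
    using c by (auto simp: cohomology1_def FactGroup_def RCOSETS_def)
  then have "coboundaries1 G ?V ?\<rho> #>\<^bsub>cocycle_group1 G ?V ?\<rho>\<^esub> c = coboundaries1 G ?V ?\<rho>"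
    using triv by (auto simp: trivial_group_def cohomology1_def FactGroup_def)
  then have "c \<in> coboundaries1 G ?V ?\<rho>" using Z.rcos_self[OF c sub] by simp
  then obtain v where v: "v \<in> carrier ?V" "c = (\<lambda>g\<in>carrier G. ?\<rho> g v \<ominus>\<^bsub>?V\<^esub> v)"
    by (auto simp: coboundaries1_def)
  then obtain a where a: "a \<in> carrier A" "v = code a" by (auto simp: coded_simps)
  have minus: "\<ominus>\<^bsub>?V\<^esub> code a = code (inv\<^bsub>A\<^esub> a)"
    by (rule V.minus_equality) (use a in \<open>auto simp: coded_simps\<close>)
  have "\<gamma> g = \<alpha> g a \<otimes>\<^bsub>A\<^esub> inv\<^bsub>A\<^esub> a" if g: "g \<in> carrier G" for g
  proof -
    have "code (\<gamma> g) = code (\<alpha> g a \<otimes>\<^bsub>A\<^esub> inv\<^bsub>A\<^esub> a)"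
      using fun_cong[OF v(2), of g] g a by (simp add: c_def a_minus_def minus coded_simps action_closed)
    then show ?thesis using inj_onD[OF code_inj] closed[OF g] g a by (simp add: action_closed)
  qed
  then show ?thesis using a by blast
qed

end

section \<open>Conjugation on abelian normal sections\<close>

locale abelian_section = group G for G :: "('a, 'b) monoid_scheme" (structure) +
  fixes N M :: "'a set"
  assumes N_normal: "N \<lhd> G" and M_normal: "M \<lhd> G" and N_subset_M: "N \<subseteq> M"
    and M_commutator: "x \<in> M \<Longrightarrow> y \<in> M \<Longrightarrow> x \<otimes> y \<otimes> inv x \<otimes> inv y \<in> N"
begin

sublocale N: normal N G by (rule N_normal)

sublocale M: normal M G by (rule M_normal)

text \<open>In this form it becomes \<open>abelianized_subgroup G K\<close> when
  \<open>M = K\<close> and \<open>N = derived G K\<close>.\<close>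

definition sect :: "'a set monoid" where
  "sect = (G\<lparr>carrier := M\<rparr>) Mod N"

definition conj :: "'a \<Rightarrow> 'a set \<Rightarrow> 'a set" where
  "conj g c = (\<lambda>k. g \<otimes> k \<otimes> inv g) ` c"

lemma coset_eq_iff:
  assumes "x \<in> carrier G" "y \<in> carrier G"
  shows "N #> x = N #> y \<longleftrightarrow> x \<otimes> inv y \<in> N"
proof
  assume "N #> x = N #> y"
  then have "x \<in> N #> y" using rcos_self[OF assms(1) N.subgroup_axioms] by simp
  then obtain n where "n \<in> N" "x = n \<otimes> y" by (auto simp: r_coset_def)
  then show "x \<otimes> inv y \<in> N" using assms by (simp add: m_assoc)
next
  assume n: "x \<otimes> inv y \<in> N"
  have "x = (x \<otimes> inv y) \<otimes> y" using assms by (simp add: m_assoc)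
  then have "x \<in> N #> y" using n by (auto simp: r_coset_def)
  then show "N #> x = N #> y" by (rule repr_independence[OF _ assms(2) N.subgroup_axioms, symmetric])
qed

lemma sect_carrier: "carrier sect = (\<lambda>x. N #> x) ` M"
  by (auto simp: sect_def FactGroup_def RCOSETS_def r_coset_def)

lemma sect_mult:
  assumes "x \<in> M" "y \<in> M"
  shows "(N #> x) \<otimes>\<^bsub>sect\<^esub> (N #> y) = N #> (x \<otimes> y)"
proof -
  have "(N #> x) \<otimes>\<^bsub>sect\<^esub> (N #> y) = (N #> x) <#> (N #> y)"
    by (simp add: sect_def FactGroup_def set_mult_def)
  then show ?thesis using N.rcos_sum assms M.subset by auto
qed

lemma sect_one: "\<one>\<^bsub>sect\<^esub> = N"
  by (simp add: sect_def FactGroup_def)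

lemma coset_kernel: "x \<in> carrier G \<Longrightarrow> N #> x = N \<longleftrightarrow> x \<in> N"
  using coset_eq_iff[of x \<one>] N.subset by simp

sublocale sect: comm_group sect
proof -
  have "N \<lhd> G\<lparr>carrier := M\<rparr>"
    by (rule normal_restrict_supergroup[OF M.subgroup_axioms N_normal N_subset_M])
  then have "group sect" unfolding sect_def by (rule normal.factorgroup_is_group)
  moreover have "x \<otimes>\<^bsub>sect\<^esub> y = y \<otimes>\<^bsub>sect\<^esub> x" if xy: "x \<in> carrier sect" "y \<in> carrier sect" for x y
  proof -
    obtain a b where ab: "x = N #> a" "y = N #> b" "a \<in> M" "b \<in> M" using xy by (auto simp: sect_carrier)
    have "a \<otimes> b \<otimes> inv (b \<otimes> a) \<in> N"
      using M_commutator[OF ab(3,4)] ab M.subset by (auto simp: word_simps subset_iff)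
    then have "N #> (a \<otimes> b) = N #> (b \<otimes> a)" using ab M.subset by (subst coset_eq_iff) auto
    then show ?thesis using ab by (simp add: sect_mult)
  qed
  ultimately show "comm_group sect" by (rule group.group_comm_groupI)
qed

lemma sect_inv:
  assumes "x \<in> M"
  shows "inv\<^bsub>sect\<^esub> (N #> x) = N #> inv x"
proof (rule sect.inv_equality)
  show "(N #> inv x) \<otimes>\<^bsub>sect\<^esub> (N #> x) = \<one>\<^bsub>sect\<^esub>"
    using assms M.subset by (auto simp: sect_mult sect_one coset_kernel)
qed (use assms in \<open>auto simp: sect_carrier\<close>)

lemma conj_coset:
  assumes "g \<in> carrier G" "x \<in> carrier G"
  shows "conj g (N #> x) = N #> (g \<otimes> x \<otimes> inv g)"
proof
  show "conj g (N #> x) \<subseteq> N #> (g \<otimes> x \<otimes> inv g)"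
  proof
    fix y assume "y \<in> conj g (N #> x)"
    then obtain n where n: "n \<in> N" "y = g \<otimes> (n \<otimes> x) \<otimes> inv g" by (auto simp: conj_def r_coset_def)
    then have "y = (g \<otimes> n \<otimes> inv g) \<otimes> (g \<otimes> x \<otimes> inv g)" using assms by (simp add: word_simps)
    then show "y \<in> N #> (g \<otimes> x \<otimes> inv g)"
      using N.inv_op_closed2[OF assms(1) n(1)] unfolding r_coset_def by blast
  qed
  show "N #> (g \<otimes> x \<otimes> inv g) \<subseteq> conj g (N #> x)"
  proof
    fix y assume "y \<in> N #> (g \<otimes> x \<otimes> inv g)"
    then obtain n where n: "n \<in> N" "y = n \<otimes> (g \<otimes> x \<otimes> inv g)" by (auto simp: r_coset_def)
    then have "y = g \<otimes> ((inv g \<otimes> n \<otimes> g) \<otimes> x) \<otimes> inv g" using assms by (simp add: word_simps)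
    then show "y \<in> conj g (N #> x)"
      using N.inv_op_closed1[OF assms(1) n(1)] unfolding conj_def r_coset_def by blast
  qed
qed

lemma conj_closed: "g \<in> carrier G \<Longrightarrow> x \<in> M \<Longrightarrow> g \<otimes> x \<otimes> inv g \<in> M"
  by (rule M.inv_op_closed2)

sublocale operator_group G sect conj
proof unfold_locales
  show "conj g \<in> hom sect sect" if g: "g \<in> carrier G" for g
  proof (rule homI)
    fix x assume "x \<in> carrier sect"
    then obtain a where a: "x = N #> a" "a \<in> M" "a \<in> carrier G" using M.subset by (auto simp: sect_carrier)
    then show "conj g x \<in> carrier sect"
      using conj_closed[OF g] by (simp add: conj_coset g sect_carrier)
    fix y assume "y \<in> carrier sect"
    then obtain b where b: "y = N #> b" "b \<in> M" "b \<in> carrier G" using M.subset by (auto simp: sect_carrier)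
    have "g \<otimes> (a \<otimes> b) \<otimes> inv g = (g \<otimes> a \<otimes> inv g) \<otimes> (g \<otimes> b \<otimes> inv g)"
      using a b g by (simp add: word_simps)
    then show "conj g (x \<otimes>\<^bsub>sect\<^esub> y) = conj g x \<otimes>\<^bsub>sect\<^esub> conj g y"
      using a b g conj_closed[OF g] by (simp add: sect_mult conj_coset)
  qed
  show "conj (g \<otimes> h) x = conj g (conj h x)"
    if gh: "g \<in> carrier G" "h \<in> carrier G" and x: "x \<in> carrier sect" for g h x
  proof -
    obtain a where a: "x = N #> a" "a \<in> carrier G" using x M.subset by (auto simp: sect_carrier)
    have "(g \<otimes> h) \<otimes> a \<otimes> inv (g \<otimes> h) = g \<otimes> (h \<otimes> a \<otimes> inv h) \<otimes> inv g"
      using a gh by (simp add: word_simps)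
    then show ?thesis using a gh by (simp add: conj_coset)
  qed
  show "conj \<one> x = x" if x: "x \<in> carrier sect" for x
  proof -
    obtain a where a: "x = N #> a" "a \<in> carrier G" using x M.subset by (auto simp: sect_carrier)
    then show ?thesis by (simp add: conj_coset)
  qed
qed

definition pullback :: "'a set set \<Rightarrow> 'a set" where
  "pullback B = {x \<in> M. N #> x \<in> B}"

lemma mem_pullback: "x \<in> M \<Longrightarrow> x \<in> pullback B \<longleftrightarrow> N #> x \<in> B"
  by (simp add: pullback_def)

lemma image_pullback: "B \<subseteq> carrier sect \<Longrightarrow> (\<lambda>x. N #> x) ` pullback B = B"
  by (auto simp: pullback_def sect_carrier)

lemma pullback_one: "pullback {\<one>\<^bsub>sect\<^esub>} = N"
proof -
  have "N #> x = N \<longleftrightarrow> x \<in> N" if "x \<in> M" for x using that M.subset by (intro coset_kernel) auto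
  then show ?thesis using N_subset_M by (auto simp: pullback_def sect_one)
qed

lemma pullback_normal:
  assumes "invariant_subgroup B"
  shows "pullback B \<lhd> G"
proof (rule normal_invI)
  have B: "subgroup B sect" using assms by (simp add: invariant_subgroup_def)
  show "subgroup (pullback B) G"
  proof (rule subgroup.intro)
    show "pullback B \<subseteq> carrier G" using M.subset by (auto simp: pullback_def)
    show "\<one> \<in> pullback B"
      using subgroup.one_closed[OF B] N.subset by (simp add: pullback_def sect_one coset_mult_one)
    show "x \<otimes> y \<in> pullback B" if "x \<in> pullback B" "y \<in> pullback B" for x y
      using that subgroup.m_closed[OF B, of "N #> x" "N #> y"] by (simp add: pullback_def sect_mult)
    show "inv x \<in> pullback B" if "x \<in> pullback B" for x
      using that subgroup.m_inv_closed[OF B, of "N #> x"] by (simp add: pullback_def sect_inv)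
  qed
  fix g x assume g: "g \<in> carrier G" and x: "x \<in> pullback B"
  then have "conj g (N #> x) \<in> B" using assms by (simp add: invariant_subgroup_def pullback_def)
  moreover have "x \<in> M" "x \<in> carrier G" using x M.subset by (auto simp: pullback_def)
  ultimately show "g \<otimes> x \<otimes> inv g \<in> pullback B"
    using g conj_closed[OF g] by (simp add: pullback_def conj_coset)
qed

lemma N_subset_pullback:
  assumes "invariant_subgroup B"
  shows "N \<subseteq> pullback B"
proof -
  have "\<one>\<^bsub>sect\<^esub> \<in> B" using assms subgroup.one_closed by (auto simp: invariant_subgroup_def)
  then have "pullback {\<one>\<^bsub>sect\<^esub>} \<subseteq> pullback B" by (auto simp: pullback_def)
  then show ?thesis by (simp only: pullback_one)
qed

lemma conj_diff:
  assumes "g \<in> carrier G" "x \<in> M"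
  shows "conj g (N #> x) \<otimes>\<^bsub>sect\<^esub> inv\<^bsub>sect\<^esub> (N #> x) = N #> (g \<otimes> x \<otimes> inv g \<otimes> inv x)"
proof -
  have "x \<in> carrier G" using assms(2) M.subset by auto
  then show ?thesis using assms conj_closed by (simp add: conj_coset sect_inv sect_mult)
qed

lemma commutator_in_M:
  assumes "g \<in> carrier G" "x \<in> M"
  shows "g \<otimes> x \<otimes> inv g \<otimes> inv x \<in> M"
  using assms conj_closed by simp

text \<open>The coset of \<open>x\<close> is fixed by \<open>conj g\<close> modulo a subgroup
  exactly if \<open>[g, x]\<close> lies in its preimage. For \<open>x\<close> in \<open>M\<close>
  these commutators stay in \<open>M\<close>, so intersecting with \<open>M\<close> at the end is
  enough.\<close>

lemma pullback_fixed_mod_funpow: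
  assumes "invariant_subgroup B"
  shows "pullback ((fixed_mod ^^ k) B) = (central_mod G ^^ k) (pullback B) \<inter> M"
proof (induction k)
  case 0 then show ?case by (auto simp: pullback_def)
next
  case (Suc k)
  let ?X = "(fixed_mod ^^ k) B" and ?Y = "(central_mod G ^^ k) (pullback B)"
  have Y: "?Y \<lhd> G"
    by (induction k) (auto intro: central_mod_normal pullback_normal[OF assms])
  have "x \<in> pullback (fixed_mod ?X) \<longleftrightarrow> x \<in> central_mod G ?Y" if x: "x \<in> M" for x
  proof -
    have xc: "x \<in> carrier G" using x M.subset by auto
    have "x \<in> pullback (fixed_mod ?X) \<longleftrightarrow> (\<forall>g\<in>carrier G. N #> (g \<otimes> x \<otimes> inv g \<otimes> inv x) \<in> ?X)"
      using x by (auto simp: pullback_def fixed_mod_def sect_carrier conj_diff)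
    also have "\<dots> \<longleftrightarrow> (\<forall>g\<in>carrier G. g \<otimes> x \<otimes> inv g \<otimes> inv x \<in> pullback ?X)"
      using mem_pullback commutator_in_M[OF _ x] by blast
    also have "\<dots> \<longleftrightarrow> (\<forall>g\<in>carrier G. g \<otimes> x \<otimes> inv g \<otimes> inv x \<in> ?Y)"
      using Suc.IH commutator_in_M[OF _ x] by blast
    also have "\<dots> \<longleftrightarrow> x \<in> central_mod G ?Y"
      using commutator_swap[OF normal_imp_subgroup[OF Y]] xc by (auto simp: central_mod_def)
    finally show ?thesis .
  qed
  then show ?case by (auto simp: pullback_def)
qed

end

section \<open>Maximal non-nilpotent quotients\<close>

lemma (in group) exists_maximal_non_nilpotent:
  assumes fg: "finite S" "S \<subseteq> carrier G" "generate G S = carrier G"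
    and D: "D \<lhd> G" "\<And>n. \<not> lower_central_series G n \<subseteq> D"
  obtains N where "N \<lhd> G" "D \<subseteq> N" "\<And>n. \<not> lower_central_series G n \<subseteq> N"
    "\<And>R. R \<lhd> G \<Longrightarrow> N \<subset> R \<Longrightarrow> \<exists>n. lower_central_series G n \<subseteq> R"
proof -
  let ?\<A> = "{N. N \<lhd> G \<and> D \<subseteq> N \<and> (\<forall>n. \<not> lower_central_series G n \<subseteq> N)}"
  have "\<exists>N\<in>?\<A>. \<forall>R\<in>?\<A>. N \<subseteq> R \<longrightarrow> R = N"
  proof (rule subset_Zorn_nonempty)
    show "?\<A> \<noteq> {}" using D by blast
    fix \<C> assume ne: "\<C> \<noteq> {}" and chain: "subset.chain ?\<A> \<C>"
    have C: "N \<lhd> G" "D \<subseteq> N" "\<not> lower_central_series G n \<subseteq> N" if "N \<in> \<C>" for N n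
      using that chain by (auto simp: subset_chain_def)
    have total: "A \<subseteq> B \<or> B \<subseteq> A" if "A \<in> \<C>" "B \<in> \<C>" for A B
      using that chain by (auto simp: subset_chain_def)
    have sub: "subgroup N G" if "N \<in> \<C>" for N using C(1)[OF that] by (rule normal_imp_subgroup)
    have "\<Union>\<C> \<lhd> G"
    proof (rule normal_invI)
      show "subgroup (\<Union>\<C>) G"
      proof (rule subgroup.intro)
        show "\<Union>\<C> \<subseteq> carrier G" using subgroup.subset[OF sub] by blast
        show "\<one> \<in> \<Union>\<C>" using subgroup.one_closed[OF sub] ne by blast
        show "inv x \<in> \<Union>\<C>" if "x \<in> \<Union>\<C>" for x using subgroup.m_inv_closed[OF sub] that by blast
        fix x y assume "x \<in> \<Union>\<C>" "y \<in> \<Union>\<C>"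
        then obtain A B where AB: "x \<in> A" "A \<in> \<C>" "y \<in> B" "B \<in> \<C>" by blast
        then obtain C where "C \<in> \<C>" "x \<in> C" "y \<in> C" using total[OF AB(2,4)] by blast
        then show "x \<otimes> y \<in> \<Union>\<C>" using subgroup.m_closed[OF sub] by blast
      qed
      fix x h assume x: "x \<in> carrier G" and "h \<in> \<Union>\<C>"
      then obtain A where A: "A \<in> \<C>" "h \<in> A" by blast
      have "x \<otimes> h \<otimes> inv x \<in> A" by (rule normal.inv_op_closed2[OF C(1)[OF A(1)] x A(2)])
      then show "x \<otimes> h \<otimes> inv x \<in> \<Union>\<C>" using A(1) by blast
    qed
    moreover have "D \<subseteq> \<Union>\<C>" using C(2) ne by blast
    moreover have "\<not> lower_central_series G n \<subseteq> \<Union>\<C>" for n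
    proof
      assume *: "lower_central_series G n \<subseteq> \<Union>\<C>"
      obtain F where F: "finite F" "F \<subseteq> lower_central_series G n"
        "\<And>N. N \<lhd> G \<Longrightarrow> F \<subseteq> N \<Longrightarrow> lower_central_series G n \<subseteq> N"
        using lcs_normal_closure_finite[OF fg, of n] by metis
      have "F \<subseteq> \<Union>\<C>" using F(2) * by blast
      then obtain N where "N \<in> \<C>" "F \<subseteq> N"
        using finite_subset_Union_chain[OF F(1) _ ne chain] by blast
      then show False using F(3) C(1,3) by blast
    qed
    ultimately show "\<Union>\<C> \<in> ?\<A>" by blast
  qed
  then obtain N where N: "N \<in> ?\<A>" "\<forall>R\<in>?\<A>. N \<subseteq> R \<longrightarrow> R = N" by (rule bexE)
  have "\<exists>n. lower_central_series G n \<subseteq> R" if "R \<lhd> G" "N \<subset> R" for R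
  proof (rule ccontr)
    assume "\<nexists>n. lower_central_series G n \<subseteq> R"
    then have "R \<in> ?\<A>" using that N(1) by blast
    then show False using N(2) that by blast
  qed
  then show ?thesis using that N(1) by blast
qed

text \<open>If \<open>central_mod\<close> did not enlarge \<open>M\<close>, its iterates would stay
  at \<open>M\<close>, whereas nilpotency of \<open>G/M\<close> makes them reach
  \<open>G\<close>.\<close>

lemma (in group) central_mod_extends:
  assumes "M \<lhd> G" "lower_central_series G n \<subseteq> M" "M \<noteq> carrier G"
  obtains z where "z \<in> central_mod G M" "z \<notin> M"
proof -
  have "\<not> central_mod G M \<subseteq> M"
  proof
    assume "central_mod G M \<subseteq> M"
    then have "central_mod G M = M" using subset_central_mod[OF assms(1)] by blast
    then have "(central_mod G ^^ k) M = M" for k by (induction k) auto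
    then have "lower_central_series G 0 \<subseteq> M"
      using lcs_add_subset_iff[OF assms(1), of 0 n] assms(2) by simp
    then show False using assms(3) subgroup.subset[OF normal_imp_subgroup[OF assms(1)]] by auto
  qed
  then show ?thesis using that by blast
qed

locale maximal_non_nilpotent = group G for G :: "('a, 'b) monoid_scheme" (structure) +
  fixes K N :: "'a set" and S c
  assumes gens: "finite S" "S \<subseteq> carrier G" "generate G S = carrier G"
    and K_normal: "K \<lhd> G" and lcs_K: "lower_central_series G c \<subseteq> K"
    and N_normal': "N \<lhd> G" and derived_N: "derived G K \<subseteq> N"
    and lcs_N: "\<not> lower_central_series G n \<subseteq> N"
    and maximal: "R \<lhd> G \<Longrightarrow> N \<subset> R \<Longrightarrow> \<exists>n. lower_central_series G n \<subseteq> R"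
begin

text \<open>The product of \<open>N\<close> with a term of the lower central series, phrased by
  cosets. That term rather than \<open>K\<close> is taken because it is known to be finitely
  generated as a normal subgroup and inherits the failure of nilpotency.\<close>

definition M :: "'a set" where
  "M = {x \<in> carrier G. \<exists>u\<in>lower_central_series G c. N #> x = N #> u}"

lemma lcs_subset_M: "lower_central_series G c \<subseteq> M"
  using lcs_subset_carrier by (auto simp: M_def)

lemma K_commutator:
  assumes "x \<in> K" "y \<in> K"
  shows "x \<otimes> y \<otimes> inv x \<otimes> inv y \<in> N"
proof -
  have "x \<otimes> y \<otimes> inv x \<otimes> inv y \<in> derived G K"
    unfolding derived_def by (rule generate.incl) (use assms in blast)
  then show ?thesis using derived_N by blast
qed

sublocale Q: group "G Mod N"
  by (rule normal.factorgroup_is_group[OF N_normal'])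

lemma coset_mult:
  assumes "x \<in> carrier G" "y \<in> carrier G"
  shows "N #> (x \<otimes> y) = (N #> x) \<otimes>\<^bsub>G Mod N\<^esub> (N #> y)"
  using normal.rcos_sum[OF N_normal' assms] by (simp add: FactGroup_def)

lemma coset_mem: "x \<in> carrier G \<Longrightarrow> N #> x \<in> carrier (G Mod N)"
  by (auto simp: FactGroup_def RCOSETS_def)

lemma coset_inv:
  assumes "x \<in> carrier G"
  shows "N #> inv x = inv\<^bsub>G Mod N\<^esub> (N #> x)"
  using normal.rcos_inv[OF N_normal' assms] normal.inv_FactGroup[OF N_normal' coset_mem[OF assms]] by simp

lemma M_normal': "M \<lhd> G"
proof (rule normal_invI)
  have lcs_c: "u \<in> carrier G" if "u \<in> lower_central_series G c" for u
    using that lcs_subset_carrier by blast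
  note lcs = normal_imp_subgroup[OF lcs_normal[of c]]
  show "subgroup M G"
  proof (rule subgroup.intro)
    show "\<one> \<in> M" using subgroup.one_closed[OF lcs] by (auto simp: M_def)
    show "x \<otimes> y \<in> M" if xy: "x \<in> M" "y \<in> M" for x y
    proof -
      obtain u v where uv: "u \<in> lower_central_series G c" "N #> x = N #> u"
        "v \<in> lower_central_series G c" "N #> y = N #> v" "x \<in> carrier G" "y \<in> carrier G"
        using xy by (auto simp: M_def)
      have "N #> (x \<otimes> y) = N #> (u \<otimes> v)" using uv lcs_c by (simp add: coset_mult)
      then show ?thesis using uv subgroup.m_closed[OF lcs uv(1,3)] by (auto simp: M_def)
    qed
    show "inv x \<in> M" if x: "x \<in> M" for x
    proof -
      obtain u where u: "u \<in> lower_central_series G c" "N #> x = N #> u" "x \<in> carrier G"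
        using x by (auto simp: M_def)
      have "N #> inv x = N #> inv u" using u lcs_c by (simp add: coset_inv)
      then show ?thesis using u subgroup.m_inv_closed[OF lcs u(1)] by (auto simp: M_def)
    qed
  qed (auto simp: M_def)
  fix g x assume g: "g \<in> carrier G" and "x \<in> M"
  then obtain u where u: "u \<in> lower_central_series G c" "N #> x = N #> u" "x \<in> carrier G"
    by (auto simp: M_def)
  have "N #> (g \<otimes> x \<otimes> inv g) = N #> (g \<otimes> u \<otimes> inv g)" using u g lcs_c by (simp add: coset_mult)
  moreover have "g \<otimes> u \<otimes> inv g \<in> lower_central_series G c"
    by (rule normal.inv_op_closed2[OF lcs_normal g u(1)])
  ultimately show "g \<otimes> x \<otimes> inv g \<in> M" using u g by (auto simp: M_def)
qed

lemma N_subset_M': "N \<subseteq> M"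
proof
  fix x assume x: "x \<in> N"
  then have xc: "x \<in> carrier G" using subgroup.subset[OF normal_imp_subgroup[OF N_normal']] by auto
  have "N #> x = N" using subgroup.rcos_const[OF normal_imp_subgroup[OF N_normal'] is_group x] .
  moreover have "N #> \<one> = N"
    using coset_mult_one subgroup.subset[OF normal_imp_subgroup[OF N_normal']] by blast
  moreover have "\<one> \<in> lower_central_series G c"
    using subgroup.one_closed[OF normal_imp_subgroup[OF lcs_normal]] .
  ultimately show "x \<in> M" using xc unfolding M_def by blast
qed

text \<open>\<open>N\<close> need not lie in \<open>K\<close>, and so neither need \<open>M\<close>;
  the commutator is computed with representatives \<open>u\<close> and \<open>v\<close> in
  \<open>K\<close> that are congruent to \<open>x\<close> and \<open>y\<close> modulo
  \<open>N\<close>.\<close>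

lemma M_commutator_generic:
  assumes x: "x \<in> M" and y: "y \<in> carrier G" "N #> y = N #> v" "v \<in> K"
  shows "x \<otimes> y \<otimes> inv x \<otimes> inv y \<in> N"
proof -
  obtain u where u: "u \<in> lower_central_series G c" "N #> x = N #> u" "x \<in> carrier G"
    using x by (auto simp: M_def)
  then have uK: "u \<in> K" using lcs_K by blast
  have c: "u \<in> carrier G" "v \<in> carrier G"
    using uK y(3) subgroup.subset[OF normal_imp_subgroup[OF K_normal]] by auto
  have "N #> (x \<otimes> y \<otimes> inv x \<otimes> inv y) = N #> (u \<otimes> v \<otimes> inv u \<otimes> inv v)"
    using u y c by (simp add: coset_mult coset_inv)
  also have "\<dots> = N"
    by (rule subgroup.rcos_const[OF normal_imp_subgroup[OF N_normal'] is_group K_commutator[OF uK y(3)]])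
  finally have "N #> (x \<otimes> y \<otimes> inv x \<otimes> inv y) = N" .
  then show ?thesis
    using rcos_self[OF _ normal_imp_subgroup[OF N_normal'], of "x \<otimes> y \<otimes> inv x \<otimes> inv y"] u y by simp
qed

sublocale abelian_section G N M
proof (intro abelian_section.intro abelian_section_axioms.intro group_axioms N_normal' M_normal' N_subset_M')
  show "x \<otimes> y \<otimes> inv x \<otimes> inv y \<in> N" if "x \<in> M" "y \<in> M" for x y
  proof -
    obtain v where "v \<in> lower_central_series G c" "N #> y = N #> v" "y \<in> carrier G"
      using \<open>y \<in> M\<close> by (auto simp: M_def)
    then show ?thesis using M_commutator_generic[OF that(1)] lcs_K by blast
  qed
qed

lemma K_subset_kernel: "K \<subseteq> action_kernel"
proof
  fix k assume k: "k \<in> K"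
  then have kc: "k \<in> carrier G" using subgroup.subset[OF normal_imp_subgroup[OF K_normal]] by auto
  have "conj k a = a" if a: "a \<in> carrier sect" for a
  proof -
    obtain x where x: "x \<in> M" "a = N #> x" using a by (auto simp: sect_carrier)
    then have xc: "x \<in> carrier G" using M.subset by blast
    have "k \<otimes> x \<otimes> inv k \<otimes> inv x \<in> N"
      by (rule commutator_swap[OF normal_imp_subgroup[OF N_normal'] xc kc
            M_commutator_generic[OF x(1) kc refl k]])
    then have "N #> (k \<otimes> x \<otimes> inv k) = N #> x" using kc xc by (subst coset_eq_iff) auto
    then show ?thesis using x kc xc by (simp add: conj_coset)
  qed
  then show "k \<in> action_kernel" using kc by (simp add: action_kernel_def)
qed

lemma lcs_in_pullback:
  assumes "invariant_subgroup B" "lower_central_series G c \<subseteq> pullback B"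
  shows "B = carrier sect"
proof
  show "B \<subseteq> carrier sect" by (rule invariant_subgroup_subset[OF assms(1)])
  show "carrier sect \<subseteq> B"
  proof
    fix a assume "a \<in> carrier sect"
    then obtain x where x: "x \<in> M" "a = N #> x" by (auto simp: sect_carrier)
    from x(1) obtain u where u: "u \<in> lower_central_series G c" "N #> x = N #> u"
      unfolding M_def by blast
    have "u \<in> pullback B" using assms(2) u(1) by blast
    then show "a \<in> B" unfolding x(2) u(2) by (simp add: pullback_def)
  qed
qed

lemma invariant_trivial: "invariant_subgroup {\<one>\<^bsub>sect\<^esub>}"
  using sect.triv_subgroup action_unit by (simp add: invariant_subgroup_def)

sublocale just_non_nilpotent_group G sect conj
proof unfold_locales
  show "(fixed_mod ^^ k) {\<one>\<^bsub>sect\<^esub>} \<noteq> carrier sect" for k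
  proof
    assume eq: "(fixed_mod ^^ k) {\<one>\<^bsub>sect\<^esub>} = carrier sect"
    have "pullback (carrier sect) = M" by (auto simp: pullback_def sect_carrier)
    \<comment> \<open>A nilpotent action would place \<open>M\<close>, and with it term
      \<open>c\<close> of the lower series, inside the upper series above \<open>N\<close>, making
      \<open>G/N\<close> nilpotent.\<close>
    then have "M \<subseteq> (central_mod G ^^ k) N"
      using pullback_fixed_mod_funpow[OF invariant_trivial, of k] eq by (auto simp: pullback_one)
    then have "lower_central_series G (c + k) \<subseteq> N"
      using lcs_add_subset_iff[OF N_normal'] lcs_subset_M by blast
    then show False using lcs_N by blast
  qed
  show "\<exists>k. (fixed_mod ^^ k) B = carrier sect" if B: "invariant_subgroup B" "B \<noteq> {\<one>\<^bsub>sect\<^esub>}" for B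
  proof -
    have "N \<noteq> pullback B"
    proof
      assume "N = pullback B"
      then have "pullback B = pullback {\<one>\<^bsub>sect\<^esub>}" by (simp add: pullback_one)
      then have "(\<lambda>x. N #> x) ` pullback B = (\<lambda>x. N #> x) ` pullback {\<one>\<^bsub>sect\<^esub>}"
        by (rule arg_cong)
      also have "\<dots> = {\<one>\<^bsub>sect\<^esub>}" by (rule image_pullback) simp
      finally have "B = {\<one>\<^bsub>sect\<^esub>}"
        unfolding image_pullback[OF invariant_subgroup_subset[OF B(1)]] .
      then show False using B(2) by blast
    qed
    then have "N \<subset> pullback B" using N_subset_pullback[OF B(1)] by blast
    then obtain k where k: "lower_central_series G k \<subseteq> pullback B"
      using maximal pullback_normal[OF B(1)] by blast
    then have "lower_central_series G 0 \<subseteq> (central_mod G ^^ k) (pullback B)"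
      using lcs_add_subset_iff[OF pullback_normal[OF B(1)], of 0 k] by simp
    then have "M \<subseteq> (central_mod G ^^ k) (pullback B)" using M.subset by auto
    then have "pullback ((fixed_mod ^^ k) B) = M"
      using pullback_fixed_mod_funpow[OF B(1), of k] by blast
    then have "(fixed_mod ^^ k) B = carrier sect"
      using image_pullback[OF fixed_mod_funpow_subset[OF invariant_subgroup_subset[OF B(1)]], of k]
      by (simp add: sect_carrier)
    then show ?thesis by blast
  qed
  obtain F where F: "finite F" "F \<subseteq> lower_central_series G c"
    "\<And>N. N \<lhd> G \<Longrightarrow> F \<subseteq> N \<Longrightarrow> lower_central_series G c \<subseteq> N"
    using lcs_normal_closure_finite[OF gens, of c] by metis
  show "\<exists>F. finite F \<and> F \<subseteq> carrier sect \<and> (\<forall>B. invariant_subgroup B \<longrightarrow> F \<subseteq> B \<longrightarrow> B = carrier sect)"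
  proof (intro exI conjI allI impI)
    show "finite ((\<lambda>x. N #> x) ` F)" using F(1) by simp
    show "(\<lambda>x. N #> x) ` F \<subseteq> carrier sect" using F(2) lcs_subset_M by (auto simp: sect_carrier)
    fix B assume B: "invariant_subgroup B" "(\<lambda>x. N #> x) ` F \<subseteq> B"
    have "F \<subseteq> pullback B" using B(2) F(2) lcs_subset_M by (auto simp: pullback_def)
    then show "B = carrier sect" using lcs_in_pullback[OF B(1)] F(3)[OF pullback_normal[OF B(1)]] by blast
  qed
  show "\<exists>K. K \<lhd> G \<and> polycentral G K (carrier G) \<and> K \<subseteq> action_kernel"
    using K_normal polycentral_carrier[OF gens K_normal lcs_K] K_subset_kernel by blast
  show "\<exists>S. finite S \<and> S \<subseteq> carrier G \<and> generate G S = carrier G" using gens by blast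
qed

lemma M_neq_carrier: "M \<noteq> carrier G"
proof
  assume "M = carrier G"
  then have "lower_central_series G 0 \<subseteq> central_mod G N"
    using M_commutator by (auto simp: central_mod_def)
  then have "lower_central_series G (Suc 0) \<subseteq> N"
    using lcs_Suc_subset_iff[OF normal_imp_subgroup[OF N_normal']] by blast
  then show False using lcs_N by blast
qed

text \<open>A nontrivial centre of \<open>G/N\<close> would have a nilpotent quotient by maximality,
  and a central extension of a nilpotent group is nilpotent. The triviality of the centre is what
  makes the derivation below outer.\<close>

lemma central_mod_N: "central_mod G N = N"
proof (rule ccontr)
  assume "central_mod G N \<noteq> N"
  then have "N \<subset> central_mod G N" using subset_central_mod[OF N_normal'] by blast
  then obtain n where "lower_central_series G n \<subseteq> central_mod G N"
    using maximal central_mod_normal[OF N_normal'] by blast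
  then have "lower_central_series G (Suc n) \<subseteq> N"
    using lcs_Suc_subset_iff[OF normal_imp_subgroup[OF N_normal']] by blast
  then show False using lcs_N by blast
qed

text \<open>An element \<open>z\<close> that is central modulo \<open>M\<close> yields the derivation \<open>g \<mapsto> [g, z]\<close> into \<open>M/N\<close>.
  If it is inner, say given by \<open>m\<close>, then \<open>m\<inverse> z\<close> is central modulo \<open>N\<close>.\<close>

lemma exists_outer_derivation:
  shows "\<exists>\<gamma>. (\<forall>g\<in>carrier G. \<gamma> g \<in> carrier sect) \<and>
    (\<forall>g\<in>carrier G. \<forall>h\<in>carrier G. \<gamma> (g \<otimes> h) = \<gamma> g \<otimes>\<^bsub>sect\<^esub> conj g (\<gamma> h)) \<and>
    \<not> (\<exists>a\<in>carrier sect. \<forall>g\<in>carrier G. \<gamma> g = conj g a \<otimes>\<^bsub>sect\<^esub> inv\<^bsub>sect\<^esub> a)"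
proof -
  obtain z where z: "z \<in> central_mod G M" "z \<notin> M"
    using central_mod_extends[OF M_normal lcs_subset_M M_neq_carrier] by blast
  have zc: "z \<in> carrier G" using z by (simp add: central_mod_def)
  have zM: "g \<otimes> z \<otimes> inv g \<otimes> inv z \<in> M" if "g \<in> carrier G" for g
    using commutator_swap[OF M.subgroup_axioms zc that] z(1) that by (auto simp: central_mod_def)
  define \<gamma> where "\<gamma> g = N #> (g \<otimes> z \<otimes> inv g \<otimes> inv z)" for g
  have "\<gamma> g \<in> carrier sect" if "g \<in> carrier G" for g
    using zM[OF that] by (simp add: \<gamma>_def sect_carrier)
  moreover have "\<gamma> (g \<otimes> h) = \<gamma> g \<otimes>\<^bsub>sect\<^esub> conj g (\<gamma> h)" if gh: "g \<in> carrier G" "h \<in> carrier G" for g h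
  proof -
    let ?x = "g \<otimes> z \<otimes> inv g \<otimes> inv z" and ?y = "g \<otimes> (h \<otimes> z \<otimes> inv h \<otimes> inv z) \<otimes> inv g"
    have y: "?y \<in> M" by (rule conj_closed[OF gh(1) zM[OF gh(2)]])
    \<comment> \<open>The identity \<open>[g h, z] = g [h, z] g^-1 [g, z]\<close> gives the factors
      in the opposite order; they commute because the section is abelian.\<close>
    have "(g \<otimes> h) \<otimes> z \<otimes> inv (g \<otimes> h) \<otimes> inv z = ?y \<otimes> ?x" using gh zc by (simp add: word_simps)
    then have "\<gamma> (g \<otimes> h) = (N #> ?y) \<otimes>\<^bsub>sect\<^esub> (N #> ?x)"
      unfolding \<gamma>_def using sect_mult[OF y zM[OF gh(1)]] by simp
    also have "\<dots> = (N #> ?x) \<otimes>\<^bsub>sect\<^esub> (N #> ?y)"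
      by (rule sect.m_comm) (use y zM[OF gh(1)] in \<open>auto simp: sect_carrier\<close>)
    also have "N #> ?y = conj g (\<gamma> h)"
      unfolding \<gamma>_def by (rule conj_coset[symmetric]) (use gh zc in auto)
    finally show ?thesis by (simp add: \<gamma>_def)
  qed
  moreover have "\<not> (\<exists>a\<in>carrier sect. \<forall>g\<in>carrier G. \<gamma> g = conj g a \<otimes>\<^bsub>sect\<^esub> inv\<^bsub>sect\<^esub> a)"
  proof
    assume "\<exists>a\<in>carrier sect. \<forall>g\<in>carrier G. \<gamma> g = conj g a \<otimes>\<^bsub>sect\<^esub> inv\<^bsub>sect\<^esub> a"
    then obtain m where m: "m \<in> M"
      "\<And>g. g \<in> carrier G \<Longrightarrow> \<gamma> g = conj g (N #> m) \<otimes>\<^bsub>sect\<^esub> inv\<^bsub>sect\<^esub> (N #> m)"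
      by (auto simp: sect_carrier)
    have mc: "m \<in> carrier G" using m(1) M.subset by auto
    define w where "w = inv m \<otimes> z"
    have wc: "w \<in> carrier G" using mc zc by (simp add: w_def)
    have "g \<otimes> w \<otimes> inv g \<otimes> inv w \<in> N" if g: "g \<in> carrier G" for g
    proof -
      let ?x = "g \<otimes> z \<otimes> inv g \<otimes> inv z" and ?y = "g \<otimes> m \<otimes> inv g \<otimes> inv m"
      have "N #> ?x = N #> ?y" using m(2)[OF g] unfolding \<gamma>_def conj_diff[OF g m(1)] .
      then have "?x \<otimes> inv ?y \<in> N" using g zc mc by (subst coset_eq_iff[symmetric]) auto
      \<comment> \<open>Two conjugations turn \<open>?x ?y^-1\<close> first into
        \<open>?y^-1 ?x\<close> and then into the commutator of \<open>g\<close> with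
        \<open>w\<close>, which therefore lies in \<open>N\<close>.\<close>
      then have "inv ?y \<otimes> (?x \<otimes> inv ?y) \<otimes> ?y \<in> N" using g zc mc by (intro N.inv_op_closed1) auto
      then have "inv m \<otimes> (inv ?y \<otimes> (?x \<otimes> inv ?y) \<otimes> ?y) \<otimes> m \<in> N"
        by (rule N.inv_op_closed1[OF mc])
      moreover have "inv m \<otimes> (inv ?y \<otimes> (?x \<otimes> inv ?y) \<otimes> ?y) \<otimes> m = g \<otimes> w \<otimes> inv g \<otimes> inv w"
        using g zc mc by (simp add: w_def word_simps)
      ultimately show ?thesis by simp
    qed
    then have "w \<in> central_mod G N"
      using wc commutator_swap[OF N.subgroup_axioms _ wc] by (auto simp: central_mod_def)
    then have "w \<in> M" using central_mod_N N_subset_M by blast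
    then have "m \<otimes> w \<in> M" using m(1) by simp
    then show False using z(2) mc zc by (simp add: w_def inv_mult_cancel)
  qed
  ultimately show ?thesis by blast
qed

theorem exists_nontrivial_cohomology:
  obtains F :: "nat ring" and V :: "(nat, nat) module" and \<rho> where
    "field F" "finite (carrier F)" "Factorial_Ring.prime (card (carrier F))"
    "finite_dimensional_space F V" "irreducible_representation G F V \<rho>"
    "\<not> trivial_representation G F V \<rho>" "K \<subseteq> kernel G (GL_group F V) \<rho>"
    "\<not> trivial_group (cohomology1 G V \<rho>)"
proof -
  obtain p :: nat where p: "Factorial_Ring.prime p" "\<And>a. a \<in> carrier sect \<Longrightarrow> a [^]\<^bsub>sect\<^esub> p = \<one>\<^bsub>sect\<^esub>"
    "finite (carrier sect)" "\<And>B. invariant_subgroup B \<Longrightarrow> B \<noteq> {\<one>\<^bsub>sect\<^esub>} \<Longrightarrow> B = carrier sect"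
    using finite_irreducible by blast
  interpret fin: finite_operator_group G sect conj p
    by unfold_locales (use p in auto)
  obtain \<gamma> where \<gamma>: "\<And>g. g \<in> carrier G \<Longrightarrow> \<gamma> g \<in> carrier sect"
    "\<And>g h. g \<in> carrier G \<Longrightarrow> h \<in> carrier G \<Longrightarrow> \<gamma> (g \<otimes> h) = \<gamma> g \<otimes>\<^bsub>sect\<^esub> conj g (\<gamma> h)"
    "\<not> (\<exists>a\<in>carrier sect. \<forall>g\<in>carrier G. \<gamma> g = conj g a \<otimes>\<^bsub>sect\<^esub> inv\<^bsub>sect\<^esub> a)"
    using exists_outer_derivation by blast
  have "action_kernel \<noteq> carrier G" using obtain_central_element by metis
  then have "\<not> trivial_representation G (zmod_ring p) fin.coded_module fin.coded_action"
    unfolding trivial_representation_def fin.kernel_coded .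
  moreover have "carrier sect \<noteq> {\<one>\<^bsub>sect\<^esub>}" using action_not_nilpotent[of 0] by simp
  then have "irreducible_representation G (zmod_ring p) fin.coded_module fin.coded_action"
    using p(4) by (rule fin.irreducible_coded)
  moreover have "\<not> trivial_group (cohomology1 G fin.coded_module fin.coded_action)"
    using fin.derivation_inner[of \<gamma>] \<gamma> by blast
  moreover have "K \<subseteq> kernel G (GL_group (zmod_ring p) fin.coded_module) fin.coded_action"
    unfolding fin.kernel_coded by (rule K_subset_kernel)
  ultimately show ?thesis
    using that[OF field_zmod_ring[OF p(1)]] fin.finite_dimensional_coded p(1)
    by (simp add: zmod_ring_simps(1))
qed

end

section \<open>The action of the integral group ring\<close>

context comm_group
begin

lemma hom_finprod:
  assumes "h \<in> hom G G" "f \<in> S \<rightarrow> carrier G"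
  shows "h (finprod G f S) = finprod G (\<lambda>x. h (f x)) S"
proof -
  interpret h: group_hom G G h using assms(1) by unfold_locales
  show ?thesis
    using assms(2)
  proof (induction S rule: infinite_finite_induct)
    case (insert x S)
    then have "f \<in> S \<rightarrow> carrier G" "f x \<in> carrier G" by auto
    then show ?case using insert by (simp add: Pi_def)
  qed simp_all
qed

lemma finprod_int_pow:
  assumes "f \<in> S \<rightarrow> carrier G"
  shows "finprod G f S [^] (k::int) = finprod G (\<lambda>x. f x [^] k) S"
  by (rule hom_finprod) (use assms in \<open>auto simp: hom_def int_pow_distrib\<close>)

lemma finprod_same_base:
  assumes "a \<in> carrier G" "finite S"
  shows "finprod G (\<lambda>x. a [^] (k x :: int)) S = a [^] (\<Sum>x\<in>S. k x)"
  using assms(2) by (induction S rule: finite_induct) (use assms(1) in \<open>simp_all add: int_pow_mult\<close>)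

lemma finprod_in_subgroup:
  assumes "subgroup B G" "\<And>x. x \<in> S \<Longrightarrow> f x \<in> B"
  shows "finprod G f S \<in> B"
  using assms(2)
proof (induction S rule: infinite_finite_induct)
  case (insert x S)
  then have "f \<in> S \<rightarrow> carrier G" "f x \<in> carrier G"
    using subgroup.subset[OF assms(1)] by auto
  then show ?case using insert subgroup.m_closed[OF assms(1)] by simp
qed (simp_all add: subgroup.one_closed[OF assms(1)])

end

context operator_group
begin

abbreviation act :: "('g \<Rightarrow>\<^sub>0 int) \<Rightarrow> 'm \<Rightarrow> 'm" where
  "act \<equiv> group_ring_action A \<alpha>"

lemma act_superset:
  assumes "finite S" "Poly_Mapping.keys r \<subseteq> S" "S \<subseteq> carrier G" "m \<in> carrier A"
  shows "act r m = (\<Otimes>\<^bsub>A\<^esub>x\<in>S. \<alpha> x m [^]\<^bsub>A\<^esub> Poly_Mapping.lookup r x)"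
  unfolding group_ring_action_def
  by (rule A.finprod_mono_neutral_cong_left)
    (use assms action_closed in \<open>auto simp: in_keys_iff subset_iff\<close>)

lemma act_closed:
  assumes "Poly_Mapping.keys r \<subseteq> carrier G" "m \<in> carrier A"
  shows "act r m \<in> carrier A"
  unfolding group_ring_action_def
  by (rule A.finprod_closed) (use assms action_closed in auto)

lemma act_zero: "act 0 m = \<one>\<^bsub>A\<^esub>"
  by (simp add: group_ring_action_def)

lemma act_single:
  assumes "x \<in> carrier G" "m \<in> carrier A"
  shows "act (Poly_Mapping.single x n) m = \<alpha> x m [^]\<^bsub>A\<^esub> n"
  using act_superset[of "{x}" "Poly_Mapping.single x n" m] assms action_closed by auto

lemma act_add:
  assumes "Poly_Mapping.keys r \<subseteq> carrier G" "Poly_Mapping.keys s \<subseteq> carrier G" "m \<in> carrier A"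
  shows "act (r + s) m = act r m \<otimes>\<^bsub>A\<^esub> act s m"
proof -
  let ?S = "Poly_Mapping.keys r \<union> Poly_Mapping.keys s"
  have S: "finite ?S" "?S \<subseteq> carrier G" using assms by auto
  have c: "\<alpha> x m \<in> carrier A" if "x \<in> ?S" for x using action_closed S(2) that assms(3) by blast
  have "act (r + s) m = (\<Otimes>\<^bsub>A\<^esub>x\<in>?S. \<alpha> x m [^]\<^bsub>A\<^esub> Poly_Mapping.lookup (r + s) x)"
    by (rule act_superset[OF S(1) keys_add S(2) assms(3)])
  also have "\<dots> = (\<Otimes>\<^bsub>A\<^esub>x\<in>?S. \<alpha> x m [^]\<^bsub>A\<^esub> Poly_Mapping.lookup r x \<otimes>\<^bsub>A\<^esub> \<alpha> x m [^]\<^bsub>A\<^esub> Poly_Mapping.lookup s x)"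
    by (rule A.finprod_cong') (use c in \<open>auto simp: lookup_add A.int_pow_mult\<close>)
  also have "\<dots> = (\<Otimes>\<^bsub>A\<^esub>x\<in>?S. \<alpha> x m [^]\<^bsub>A\<^esub> Poly_Mapping.lookup r x) \<otimes>\<^bsub>A\<^esub> (\<Otimes>\<^bsub>A\<^esub>x\<in>?S. \<alpha> x m [^]\<^bsub>A\<^esub> Poly_Mapping.lookup s x)"
    by (rule A.finprod_multf) (use c in auto)
  also have "\<dots> = act r m \<otimes>\<^bsub>A\<^esub> act s m"
    using act_superset[OF S(1) _ S(2) assms(3)] by simp
  finally show ?thesis .
qed

lemma act_sum:
  assumes "\<And>i. i \<in> I \<Longrightarrow> Poly_Mapping.keys (f i) \<subseteq> carrier G" "m \<in> carrier A"
  shows "act (sum f I) m = (\<Otimes>\<^bsub>A\<^esub>i\<in>I. act (f i) m)"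
  using assms(1)
proof (induction I rule: infinite_finite_induct)
  case (insert i I)
  have "Poly_Mapping.keys (sum f I) \<subseteq> carrier G" by (rule keys_sum_subset) (use insert.prems in auto)
  then have "act (sum f (insert i I)) m = act (f i) m \<otimes>\<^bsub>A\<^esub> act (sum f I) m"
    using insert by (simp add: act_add assms(2))
  moreover have "(\<lambda>i. act (f i) m) \<in> I \<rightarrow> carrier A" "act (f i) m \<in> carrier A"
    using insert.prems act_closed assms(2) by auto
  ultimately show ?case using insert by simp
qed (simp_all add: act_zero)

lemma act_mult:
  assumes r: "Poly_Mapping.keys r \<subseteq> carrier G" and s: "Poly_Mapping.keys s \<subseteq> carrier G"
    and m: "m \<in> carrier A"
  shows "act (group_ring_mult G r s) m = act r (act s m)"
proof -
  let ?r = "Poly_Mapping.lookup r" and ?s = "Poly_Mapping.lookup s"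
  let ?f = "\<lambda>x y. Poly_Mapping.single (x \<otimes> y) (?r x * ?s y)"
  have key: "Poly_Mapping.keys (?f x y) \<subseteq> carrier G"
    if "x \<in> Poly_Mapping.keys r" "y \<in> Poly_Mapping.keys s" for x y
    using that r s by auto
  have c: "\<alpha> y m \<in> carrier A" if "y \<in> Poly_Mapping.keys s" for y
    using that s m action_closed by blast
  have inner: "act (\<Sum>y\<in>Poly_Mapping.keys s. ?f x y) m = \<alpha> x (act s m) [^]\<^bsub>A\<^esub> ?r x"
    if x: "x \<in> Poly_Mapping.keys r" for x
  proof -
    have xc: "x \<in> carrier G" using x r by blast
    have "act (\<Sum>y\<in>Poly_Mapping.keys s. ?f x y) m = (\<Otimes>\<^bsub>A\<^esub>y\<in>Poly_Mapping.keys s. act (?f x y) m)"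
      by (rule act_sum[OF key[OF x] m])
    also have "\<dots> = (\<Otimes>\<^bsub>A\<^esub>y\<in>Poly_Mapping.keys s. \<alpha> x (\<alpha> y m [^]\<^bsub>A\<^esub> ?s y) [^]\<^bsub>A\<^esub> ?r x)"
    proof (rule A.finprod_cong')
      fix y assume y: "y \<in> Poly_Mapping.keys s"
      then have yc: "y \<in> carrier G" using s by blast
      have "\<alpha> x (\<alpha> y m [^]\<^bsub>A\<^esub> ?s y) = \<alpha> x (\<alpha> y m) [^]\<^bsub>A\<^esub> ?s y"
        using group_hom.hom_int_pow[OF action_group_hom[OF xc] c[OF y]] .
      then show "act (?f x y) m = \<alpha> x (\<alpha> y m [^]\<^bsub>A\<^esub> ?s y) [^]\<^bsub>A\<^esub> ?r x"
        using xc yc m by (simp add: act_single action_mult action_closed A.int_pow_pow mult.commute)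
    qed (use c xc action_closed in auto)
    also have "\<dots> = (\<Otimes>\<^bsub>A\<^esub>y\<in>Poly_Mapping.keys s. \<alpha> x (\<alpha> y m [^]\<^bsub>A\<^esub> ?s y)) [^]\<^bsub>A\<^esub> ?r x"
      by (rule A.finprod_int_pow[symmetric]) (use c xc action_closed in auto)
    also have "(\<Otimes>\<^bsub>A\<^esub>y\<in>Poly_Mapping.keys s. \<alpha> x (\<alpha> y m [^]\<^bsub>A\<^esub> ?s y)) = \<alpha> x (act s m)"
      unfolding group_ring_action_def
      by (rule A.hom_finprod[OF action_hom[OF xc], symmetric]) (use c in auto)
    finally show ?thesis .
  qed
  have "act (group_ring_mult G r s) m
      = (\<Otimes>\<^bsub>A\<^esub>x\<in>Poly_Mapping.keys r. act (\<Sum>y\<in>Poly_Mapping.keys s. ?f x y) m)"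
    unfolding group_ring_mult_def by (rule act_sum[OF keys_sum_subset[OF key] m])
  also have "\<dots> = (\<Otimes>\<^bsub>A\<^esub>x\<in>Poly_Mapping.keys r. \<alpha> x (act s m) [^]\<^bsub>A\<^esub> ?r x)"
    by (rule A.finprod_cong') (use inner r act_closed[OF s m] action_closed in auto)
  also have "\<dots> = act r (act s m)" by (simp add: group_ring_action_def[of A \<alpha> r])
  finally show ?thesis .
qed

lemma act_invariant:
  assumes "invariant_subgroup B" "Poly_Mapping.keys r \<subseteq> carrier G" "m \<in> B"
  shows "act r m \<in> B"
proof -
  have B: "subgroup B A" using assms(1) by (simp add: invariant_subgroup_def)
  show ?thesis
    unfolding group_ring_action_def
    by (rule A.finprod_in_subgroup[OF B])
      (use assms A.subgroup_int_pow_closed[OF B] in \<open>auto simp: invariant_subgroup_def\<close>)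
qed

text \<open>Additively, a coefficient sum of zero turns \<open>r m\<close> into the sum of the terms
  \<open>r(x) (x m - m)\<close>, and each difference lies in \<open>B\<close> by the choice of
  \<open>m\<close>.\<close>

lemma act_augmentation:
  assumes "invariant_subgroup B" "Poly_Mapping.keys r \<subseteq> carrier G" "augmentation r = 0" "m \<in> fixed_mod B"
  shows "act r m \<in> B"
proof -
  let ?k = "Poly_Mapping.lookup r"
  have B: "subgroup B A" using assms(1) by (simp add: invariant_subgroup_def)
  have m: "m \<in> carrier A" using assms(4) by (simp add: fixed_mod_def)
  have d: "\<alpha> x m \<otimes>\<^bsub>A\<^esub> inv\<^bsub>A\<^esub> m \<in> B" and c: "\<alpha> x m \<in> carrier A" if "x \<in> Poly_Mapping.keys r" for x
    using that assms(2,4) action_closed m by (auto simp: fixed_mod_def)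
  have "act r m = (\<Otimes>\<^bsub>A\<^esub>x\<in>Poly_Mapping.keys r. (\<alpha> x m \<otimes>\<^bsub>A\<^esub> inv\<^bsub>A\<^esub> m) [^]\<^bsub>A\<^esub> ?k x \<otimes>\<^bsub>A\<^esub> m [^]\<^bsub>A\<^esub> ?k x)"
    unfolding group_ring_action_def
  proof (rule A.finprod_cong')
    fix x assume x: "x \<in> Poly_Mapping.keys r"
    have "\<alpha> x m = (\<alpha> x m \<otimes>\<^bsub>A\<^esub> inv\<^bsub>A\<^esub> m) \<otimes>\<^bsub>A\<^esub> m" using c[OF x] m by (simp add: A.m_assoc)
    then show "\<alpha> x m [^]\<^bsub>A\<^esub> ?k x = (\<alpha> x m \<otimes>\<^bsub>A\<^esub> inv\<^bsub>A\<^esub> m) [^]\<^bsub>A\<^esub> ?k x \<otimes>\<^bsub>A\<^esub> m [^]\<^bsub>A\<^esub> ?k x"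
      using c[OF x] m by (metis A.int_pow_distrib A.inv_closed A.m_closed)
  qed (use c m in auto)
  also have "\<dots> = (\<Otimes>\<^bsub>A\<^esub>x\<in>Poly_Mapping.keys r. (\<alpha> x m \<otimes>\<^bsub>A\<^esub> inv\<^bsub>A\<^esub> m) [^]\<^bsub>A\<^esub> ?k x)
      \<otimes>\<^bsub>A\<^esub> (\<Otimes>\<^bsub>A\<^esub>x\<in>Poly_Mapping.keys r. m [^]\<^bsub>A\<^esub> ?k x)"
    by (rule A.finprod_multf) (use c m in auto)
  also have "(\<Otimes>\<^bsub>A\<^esub>x\<in>Poly_Mapping.keys r. m [^]\<^bsub>A\<^esub> ?k x) = \<one>\<^bsub>A\<^esub>"
    using assms(3) m by (simp add: A.finprod_same_base augmentation_def)
  finally have "act r m = (\<Otimes>\<^bsub>A\<^esub>x\<in>Poly_Mapping.keys r. (\<alpha> x m \<otimes>\<^bsub>A\<^esub> inv\<^bsub>A\<^esub> m) [^]\<^bsub>A\<^esub> ?k x)"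
    using c m by (simp add: A.finprod_closed Pi_def)
  moreover have "\<dots> \<in> B"
    by (rule A.finprod_in_subgroup[OF B A.subgroup_int_pow_closed[OF B d]])
  ultimately show ?thesis by simp
qed

lemma invariant_fixed_mod:
  assumes "invariant_subgroup B"
  shows "invariant_subgroup (fixed_mod B)"
proof -
  have "ev ` preimage (fixed_mod B) = fixed_mod B"
  proof
    show "fixed_mod B \<subseteq> ev ` preimage (fixed_mod B)"
    proof
      fix a assume a: "a \<in> fixed_mod B"
      then have "a \<in> carrier A" by (simp add: fixed_mod_def)
      then obtain u where "ev u = a" by (rule ev_surj)
      then show "a \<in> ev ` preimage (fixed_mod B)" using a by (auto simp: preimage_def)
    qed
  qed (auto simp: preimage_def)
  then show ?thesis
    using opsub_eq_preimage(1)[OF opsub_inv_mod(1)[OF opsub_preimage[OF assms]]]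
    by (simp add: inv_mod_preimage)
qed

text \<open>Quantifying over \<open>B\<close> and \<open>m\<close> lets the hypothesis for exponent
  \<open>n\<close> be applied to the left factor after the right factor has moved \<open>m\<close>
  one term down the series. The claim on keys rides along because \<open>act_add\<close> and
  \<open>act_mult\<close> are stated for elements supported on the group.\<close>

lemma act_augmentation_power:
  assumes "r \<in> augmentation_ideal G [^]\<^bsub>ideals_set (integral_group_ring G)\<^esub> (n::nat)"
  shows "Poly_Mapping.keys r \<subseteq> carrier G \<and>
    (\<forall>B m. invariant_subgroup B \<longrightarrow> m \<in> (fixed_mod ^^ n) B \<longrightarrow> act r m \<in> B)"
  using assms
proof (induction n arbitrary: r)
  \<comment> \<open>The zeroth power in \<open>ideals_set\<close> is the whole ring, so the claim is
    that \<open>B\<close> is stable under the group ring.\<close>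
  case 0
  then show ?case
    using act_invariant by (simp add: nat_pow_def ideals_set_def integral_group_ring_def)
next
  case (Suc n)
  let ?I = "augmentation_ideal G" and ?R = "integral_group_ring G"
  have "r \<in> ideal_prod ?R (?I [^]\<^bsub>ideals_set ?R\<^esub> n) ?I"
    using Suc.prems by (simp add: nat_pow_def ideals_set_def)
  then show ?case
  proof (induction rule: ideal_prod.induct)
    case (prod a b)
    have a: "Poly_Mapping.keys a \<subseteq> carrier G"
      "\<And>B m. invariant_subgroup B \<Longrightarrow> m \<in> (fixed_mod ^^ n) B \<Longrightarrow> act a m \<in> B"
      using Suc.IH[OF prod(1)] by auto
    have b: "Poly_Mapping.keys b \<subseteq> carrier G" "augmentation b = 0"
      using prod(2) by (auto simp: augmentation_ideal_def integral_group_ring_def)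
    have ab: "a \<otimes>\<^bsub>?R\<^esub> b = group_ring_mult G a b" by (simp add: integral_group_ring_def)
    show ?case
      unfolding ab
    proof (intro conjI allI impI)
      show "Poly_Mapping.keys (group_ring_mult G a b) \<subseteq> carrier G"
        by (rule group_ring_mult_closed[OF group_axioms a(1) b(1)])
      fix B m assume B: "invariant_subgroup B" and m: "m \<in> (fixed_mod ^^ Suc n) B"
      have inv: "invariant_subgroup ((fixed_mod ^^ n) B)"
        by (induction n) (auto intro: B invariant_fixed_mod)
      have m': "m \<in> fixed_mod ((fixed_mod ^^ n) B)" using m by simp
      then have mc: "m \<in> carrier A" by (simp add: fixed_mod_def)
      show "act (group_ring_mult G a b) m \<in> B"
        unfolding act_mult[OF a(1) b(1) mc] by (rule a(2)[OF B act_augmentation[OF inv b m']])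
    qed
  next
    case (sum s1 s2)
    have s: "s1 \<oplus>\<^bsub>?R\<^esub> s2 = s1 + s2" by (simp add: integral_group_ring_def)
    show ?case
      unfolding s
    proof (intro conjI allI impI)
      show "Poly_Mapping.keys (s1 + s2) \<subseteq> carrier G" using sum keys_add[of s1 s2] by blast
      fix B m assume B: "invariant_subgroup B" and m: "m \<in> (fixed_mod ^^ Suc n) B"
      have mc: "m \<in> carrier A" using m by (simp add: fixed_mod_def)
      have "act s1 m \<in> B" "act s2 m \<in> B" using sum B m by blast+
      then have "act s1 m \<otimes>\<^bsub>A\<^esub> act s2 m \<in> B"
        using B subgroup.m_closed by (fastforce simp: invariant_subgroup_def)
      then show "act (s1 + s2) m \<in> B" using act_add[OF _ _ mc] sum by simp
    qed
  qed
qed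

end

section \<open>Nilpotency of the quotient and powers of the augmentation ideal\<close>

theorem theorem1p6:
  fixes G :: "('a, 'b) monoid_scheme" and K :: "'a set"
  assumes "finitely_generated_group G"
    and "normal K G"
    and "nilpotent_group (G Mod K)"
    and "\<And>(F :: nat ring) (V :: (nat, nat) module) \<rho>.
           \<lbrakk>field F; finite (carrier F); Factorial_Ring.prime (card (carrier F));
            finite_dimensional_space F V;
            irreducible_representation G F V \<rho>;
            \<not> trivial_representation G F V \<rho>;
            K \<subseteq> kernel G (GL_group F V) \<rho>\<rbrakk>
           \<Longrightarrow> trivial_group (cohomology1 G V \<rho>)"
  shows "nilpotent_group (G Mod (derived G K)) \<and>
         (\<exists>n::nat. annihilates
            (augmentation_ideal (G Mod K) [^]\<^bsub>ideals_set (integral_group_ring (G Mod K))\<^esub> n)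
            (abelianized_subgroup G K) (conjugation_action G))"
proof -
  interpret group G using assms(1) by (simp add: finitely_generated_group_def)
  interpret K: normal K G by fact
  obtain S where S: "finite S" "S \<subseteq> carrier G" "generate G S = carrier G"
    using assms(1) by (auto simp: finitely_generated_group_def)
  obtain c where c: "lower_central_series G c \<subseteq> K"
    using assms(3) nilpotent_quotient_iff[OF assms(2)] by blast
  have D: "derived G K \<lhd> G" by (rule derived_is_normal[OF assms(2)])
  have "\<exists>n. lower_central_series G n \<subseteq> derived G K"
  proof (rule ccontr)
    assume neg: "\<nexists>n. lower_central_series G n \<subseteq> derived G K"
    obtain N where N: "N \<lhd> G" "derived G K \<subseteq> N" "\<And>n. \<not> lower_central_series G n \<subseteq> N"
      "\<And>R. R \<lhd> G \<Longrightarrow> N \<subset> R \<Longrightarrow> \<exists>n. lower_central_series G n \<subseteq> R"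
      using exists_maximal_non_nilpotent[OF S D] neg by metis
    interpret maximal_non_nilpotent G K N S c
      by (intro maximal_non_nilpotent.intro maximal_non_nilpotent_axioms.intro group_axioms S assms(2) c N)
    show False by (rule exists_nontrivial_cohomology) (use assms(4) in blast)
  qed
  then obtain n where n: "lower_central_series G n \<subseteq> derived G K" by blast
  have nilp: "nilpotent_group (G Mod (derived G K))"
    using n nilpotent_quotient_iff[OF D] by blast
  have K_comm: "x \<otimes>\<^bsub>G\<^esub> y \<otimes>\<^bsub>G\<^esub> inv\<^bsub>G\<^esub> x \<otimes>\<^bsub>G\<^esub> inv\<^bsub>G\<^esub> y \<in> derived G K" if "x \<in> K" "y \<in> K" for x y
    unfolding derived_def by (rule generate.incl) (use that in blast)
  have D_sub: "derived G K \<subseteq> K" by (rule derived_incl[OF order_refl K.subgroup_axioms])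
  interpret s: abelian_section G "derived G K" K
    by (intro abelian_section.intro abelian_section_axioms.intro group_axioms D assms(2) D_sub K_comm)
  have sect: "s.sect = abelianized_subgroup G K"
    by (simp add: s.sect_def abelianized_subgroup_def)
  \<comment> \<open>The set-valued action of \<open>G/K\<close> agrees with conjugation by any
    representative, so its module laws and fixed points can be read off from those for
    \<open>G\<close>.\<close>
  have conj: "conjugation_action G (K #>\<^bsub>G\<^esub> g) m = s.conj g m"
    if g: "g \<in> carrier G" and m: "m \<in> carrier s.sect" for g m
  proof -
    obtain k where k: "k \<in> K" "m = derived G K #>\<^bsub>G\<^esub> k" using m by (auto simp: s.sect_carrier)
    then have "k \<in> carrier G" using K.subset by auto
    then show ?thesis
      unfolding k(2) conjugation_action_coset[OF assms(2) g k(1)] by (simp add: s.conj_coset g)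
  qed
  have Q_carrier: "carrier (G Mod K) = (\<lambda>g. K #>\<^bsub>G\<^esub> g) ` carrier G"
    by (auto simp: FactGroup_def RCOSETS_def)
  have Q_mult: "(K #>\<^bsub>G\<^esub> g) \<otimes>\<^bsub>G Mod K\<^esub> (K #>\<^bsub>G\<^esub> h) = K #>\<^bsub>G\<^esub> (g \<otimes>\<^bsub>G\<^esub> h)"
    if "g \<in> carrier G" "h \<in> carrier G" for g h
    using K.rcos_sum[OF that] by (simp add: FactGroup_def)
  have Q_one: "\<one>\<^bsub>G Mod K\<^esub> = K #>\<^bsub>G\<^esub> \<one>\<^bsub>G\<^esub>"
    using K.subset by (simp add: FactGroup_def coset_mult_one)
  interpret Q: group "G Mod K" by (rule K.factorgroup_is_group)
  interpret Q: operator_group "G Mod K" s.sect "conjugation_action G"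
  proof unfold_locales
    show "conjugation_action G q \<in> hom s.sect s.sect" if q: "q \<in> carrier (G Mod K)" for q
    proof -
      obtain g where g: "g \<in> carrier G" "q = K #>\<^bsub>G\<^esub> g" using q Q_carrier by blast
      then show ?thesis
        using s.action_hom[OF g(1)] conj[OF g(1)] s.sect.m_closed by (auto simp: hom_def)
    qed
    show "conjugation_action G (q \<otimes>\<^bsub>G Mod K\<^esub> q') m = conjugation_action G q (conjugation_action G q' m)"
      if q: "q \<in> carrier (G Mod K)" "q' \<in> carrier (G Mod K)" and m: "m \<in> carrier s.sect" for q q' m
    proof -
      obtain g where g: "q = K #>\<^bsub>G\<^esub> g" "g \<in> carrier G" using q(1) unfolding Q_carrier by (rule imageE)
      obtain h where h: "q' = K #>\<^bsub>G\<^esub> h" "h \<in> carrier G" using q(2) unfolding Q_carrier by (rule imageE)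
      have "conjugation_action G (q \<otimes>\<^bsub>G Mod K\<^esub> q') m = s.conj (g \<otimes>\<^bsub>G\<^esub> h) m"
        unfolding g(1) h(1) Q_mult[OF g(2) h(2)] by (rule conj[OF m_closed[OF g(2) h(2)] m])
      also have "\<dots> = s.conj g (s.conj h m)" by (rule s.action_mult[OF g(2) h(2) m])
      also have "\<dots> = conjugation_action G q (conjugation_action G q' m)"
        unfolding g(1) h(1) conj[OF h(2) m] conj[OF g(2) s.action_closed[OF h(2) m]] by (rule refl)
      finally show ?thesis .
    qed
    show "conjugation_action G \<one>\<^bsub>G Mod K\<^esub> m = m" if m: "m \<in> carrier s.sect" for m
      unfolding Q_one conj[OF one_closed m] by (rule s.action_one[OF m])
  qed
  have fixed: "Q.fixed_mod B = s.fixed_mod B" for B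
    unfolding Q.fixed_mod_def s.fixed_mod_def Q_carrier by (auto simp: conj)
  \<comment> \<open>The same \<open>n\<close> serves both claims: \<open>n\<close> steps of the
    upper series above \<open>[K, K]\<close> reach \<open>G\<close> and so contain \<open>K\<close>,
    hence \<open>n\<close> iterated fixed point sets exhaust \<open>K/[K, K]\<close>.\<close>
  have "lower_central_series G 0 \<subseteq> (central_mod G ^^ n) (derived G K)"
    using lcs_add_subset_iff[OF D, of 0 n] n by simp
  then have central: "K \<subseteq> (central_mod G ^^ n) (derived G K)" using K.subset by auto
  have triv: "s.invariant_subgroup {\<one>\<^bsub>s.sect\<^esub>}"
    using s.sect.triv_subgroup s.action_unit by (simp add: s.invariant_subgroup_def)
  have triv_sub: "{\<one>\<^bsub>s.sect\<^esub>} \<subseteq> carrier s.sect" by simp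
  have "s.pullback ((s.fixed_mod ^^ n) {\<one>\<^bsub>s.sect\<^esub>}) = K"
    using s.pullback_fixed_mod_funpow[OF triv, of n] central s.pullback_one by auto
  then have "(s.fixed_mod ^^ n) {\<one>\<^bsub>s.sect\<^esub>} = carrier s.sect"
    using s.image_pullback[OF s.fixed_mod_funpow_subset[OF triv_sub, of n]]
    by (simp add: s.sect_carrier)
  moreover have "Q.fixed_mod = s.fixed_mod" by (rule ext) (rule fixed)
  ultimately have full: "(Q.fixed_mod ^^ n) {\<one>\<^bsub>s.sect\<^esub>} = carrier s.sect" by simp
  have "Q.invariant_subgroup {\<one>\<^bsub>s.sect\<^esub>}"
    using s.sect.triv_subgroup Q.action_unit by (simp add: Q.invariant_subgroup_def)
  then have "annihilates
      (augmentation_ideal (G Mod K) [^]\<^bsub>ideals_set (integral_group_ring (G Mod K))\<^esub> n)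
      s.sect (conjugation_action G)"
    unfolding annihilates_def using Q.act_augmentation_power full by blast
  then show ?thesis using nilp unfolding sect by blast
qed

end
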